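(* Let $T>0$, $\alpha\in(0,1/2)$, and let $(\pi^n)_{n\in\mathbb{N}}$ be the sequence of dyadic Lebesgue partitions generated by the coordinate process $S$ on $\Omega=C([0,\infty),\mathbb{R})$. For typical price paths $\omega\in\Omega$, the discrete local times $L^{\pi^n}(S,\cdot)$ converge uniformly in $(t,u)\in[0,T]\times\mathbb{R}$ to a limit $L(S,\cdot)\in C([0,T],C^{\alpha}(\mathbb{R}))$, and there exists $C=C(\omega)>0$ such that $$\sup_n\Bigl\{2^{n\alpha}\,\|L^{\pi^n}(S,\cdot)-L(S,\cdot)\|_{L^\infty([0,T]\times\mathbb{R})}\Bigr\}\le C.$$ Moreover, for all $p>2$ we have $$\sup_{n\in\mathbb{N}}\|L^{\pi^n}\|_{C_T\mathcal{V}^p}<\infty$$ for typical price paths.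
   Context: Setting: $\Omega=C([0,\infty),\mathbb{R})$ is the set of all continuous functions $\omega\colon[0,\infty)\to\mathbb{R}$, $S_t(\omega):=\omega(t)$, $\mathcal{F}_t:=\sigma(S_s:s\le t)$, $\mathcal{F}:=\bigvee_{t\ge0}\mathcal{F}_t$. Stopping times (with values in $[0,\infty]$) and the $\sigma$-algebras $\mathcal{F}_\tau$ are defined as usual. Simple strategies: a process $H\colon\Omega\times[0,\infty)\to\mathbb{R}$ is a simple strategy if there are stopping times $0=\tau_0(\omega)<\tau_1(\omega)<\dots$ such that for every $\omega\in\Omega$ and $T\in(0,\infty)$ one has $\tau_n(\omega)\le T$ for only finitely many $n$, and $\mathcal{F}_{\tau_n}$-measurable bounded functions $F_n\colon\Omega\to\mathbb{R}$, such that $H_t(\omega)=\sum_{n\ge0}F_n(\omega)\mathbf{1}_{(\tau_n(\omega),\tau_{n+1}(\omega)]}(t)$. Then $(H\cdot S)_t(\omega):=\sum_{n=0}^\infty F_n(\omega)[S_{\tau_{n+1}(\omega)\wedge t}(\omega)-S_{\tau_n(\omega)\wedge t}(\omega)]$. For $\lambda>0$, $H$ is $\lambda$-admissible if $(H\cdot S)_t(\omega)\ge-\lambda$ for all $t\in[0,\infty)$, $\omega\in\Omega$; $\mathcal{H}_\lambda$ is the set of $\lambda$-admissible simple strategies. Outer measure: for $A\subseteq\Omega$, $$\overline{P}(A):=\inf\Bigl\{\lambda>0:\exists (H^n)_{n\in\mathbb{N}}\subseteq\mathcal{H}_\lambda\text{ s.t. }\liminf_{t\to\infty}\liminf_{n\to\infty}(\lambda+(H^n\cdot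 S)_t(\omega))\ge\mathbf{1}_A(\omega)\ \forall\omega\in\Omega\Bigr\}.$$ $A$ is a null set if $\overline{P}(A)=0$. A property holds for typical price paths if the set of $\omega\in\Omega$ where it is violated is a null set. Dyadic Lebesgue partitions: for $n\in\mathbb{N}$ let $\mathbb{D}^n:=\{k2^{-n}:k\in\mathbb{Z}\}$, $\tau^n_0(\omega):=0$ and, for $k=0,1,2,\dots$, $\tau^n_{k+1}(\omega):=\inf\{t\ge\tau^n_k(\omega): S_t(\omega)\in\mathbb{D}^n\setminus\{S_{\tau^n_k(\omega)}(\omega)\}\}$ (with $\inf\emptyset=\infty$, the sequence stopping once $\infty$ is reached). Put $\pi^n(\omega):=\{0=\tau^n_0(\omega)<\tau^n_1(\omega)<\dots\}$. Discrete local time: for real $a,b$ let $J(a,b):=(a,b]$ if $a\le b$ and $J(a,b):=(b,a]$ if $a>b$. For $\pi=\{0=t_0<t_1<\dots\}$ (possibly depending on $\omega$ and possibly ending in $\infty$), $t\ge0$, $u\in\mathbb{R}$, $$L^{\pi}_t(S,u)(\omega):=\sum_{j}\mathbf{1}_{J(S_{t_j\wedge t}(\omega),\,S_{t_{j+1}\wedge t}(\omega))}(u)\,|S_{t_{j+1}\wedge t}(\omega)-u|,$$ where the sum is over all finite $t_j$ and $t_{j+1}$ is the successor of $t_j$ (possibly $\infty$). $C^\alpha(\mathbb{R})$ is the space of bounded $\alpha$-Hölder continuous functions on $\mathbb{R}$ with its usual norm. For $h\colon\mathbb{R}\to\mathbb{R}$, $\|h\|_{p\text{-var}}:=\sup\{(\sum_{k=1}^m|h(u_k)-h(u_{k-1})|^p)^{1/p}: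 -\infty<u_0<\dots<u_m<\infty,\ m\in\mathbb{N}\}$, and $$\|L^{\pi^n}\|_{C_T\mathcal{V}^p}:=\sup_{t\in[0,T]}\|L^{\pi^n}_t(S,\cdot)\|_{p\text{-var}}.$$ *)

theory Defs
  imports "HOL-Probability.Probability"
begin

section \<open>Path space and filtration\<close>

type_synonym path = "real \<Rightarrow> real"

text \<open>
  The space \<open>C([0,\<infinity>), \<real>)\<close>. Extensionality pins down the irrelevant values at negative times, so
  that elements of \<open>paths\<close> correspond exactly to continuous functions on \<open>[0,\<infinity>)\<close>.
\<close>

definition paths :: "path set" where
  "paths = {\<omega> \<in> extensional {0..}. continuous_on {0..} \<omega>}"

text \<open>
  Times range over \<open>[0,\<infinity>]\<close>, so that the library notions of stopping time and of its
  \<open>\<sigma>\<close>-algebra apply to \<open>[0,\<infinity>]\<close>-valued stopping times; at \<open>t = \<infinity>\<close> this is the join of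
  all the \<open>\<sigma>\<close>-algebras at finite times. At this index the stopping time condition is void, and
  the one in \<open>pre_sigma\<close> says that the event belongs to the join.
\<close>

definition path_filtration :: "ennreal \<Rightarrow> path measure" where
  "path_filtration t =
     sigma paths {{\<omega> \<in> paths. \<omega> s \<in> B} | s B. 0 \<le> s \<and> ennreal s \<le> t \<and> B \<in> sets borel}"

interpretation path_filtration: filtration paths path_filtration
proof
  have *: "{{\<omega> \<in> paths. \<omega> s \<in> B} | s B. 0 \<le> s \<and> ennreal s \<le> t \<and> B \<in> sets borel} \<subseteq> Pow paths"
    for t by auto
  show "space (path_filtration i) = paths" for i
    unfolding path_filtration_def by (rule space_measure_of[OF *])
  show "sets (path_filtration i) \<le> sets (path_filtration j)" if "i \<le> j" for i j
    unfolding path_filtration_def sets_measure_of[OF *]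
    using that by (intro sigma_sets_mono') (blast intro: order_trans)
qed

text \<open>The value of a path at time \<open>\<tau> \<and> t\<close>, for a possibly infinite time \<open>\<tau>\<close>.\<close>

definition stopped_value :: "path \<Rightarrow> ennreal \<Rightarrow> real \<Rightarrow> real" where
  "stopped_value \<omega> \<tau> t = \<omega> (enn2real (min \<tau> (ennreal t)))"


section \<open>Simple strategies and the outer measure\<close>

text \<open>
  \<open>H\<close> is the simple strategy with trading times \<open>\<tau>\<close> and positions \<open>F\<close>. The trading times are
  strictly increasing as long as they are finite, and constantly \<open>\<infinity>\<close> afterwards. In the series
  below only finitely many terms are nonzero for fixed \<open>\<omega>\<close> and \<open>t\<close>.
\<close>

definition simple_strategy ::
    "(path \<Rightarrow> real \<Rightarrow> real) \<Rightarrow> (nat \<Rightarrow> path \<Rightarrow> ennreal) \<Rightarrow> (nat \<Rightarrow> path \<Rightarrow> real) \<Rightarrow> bool" where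
  "simple_strategy H \<tau> F \<longleftrightarrow>
     (\<forall>n. stopping_time path_filtration (\<tau> n)) \<and>
     (\<forall>\<omega>\<in>paths. \<tau> 0 \<omega> = 0) \<and>
     (\<forall>\<omega>\<in>paths. \<forall>n. \<tau> n \<omega> < \<tau> (Suc n) \<omega> \<or> \<tau> n \<omega> = \<infinity> \<and> \<tau> (Suc n) \<omega> = \<infinity>) \<and>
     (\<forall>\<omega>\<in>paths. \<forall>T>0. finite {n. \<tau> n \<omega> \<le> ennreal T}) \<and>
     (\<forall>n. F n \<in> borel_measurable (path_filtration.pre_sigma (\<tau> n))) \<and>
     (\<forall>n. \<exists>B. \<forall>\<omega>\<in>paths. \<bar>F n \<omega>\<bar> \<le> B) \<and>
     (\<forall>\<omega>\<in>paths. \<forall>t\<ge>0.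
        H \<omega> t = (\<Sum>n. F n \<omega> * indicator {\<tau> n \<omega> <.. \<tau> (Suc n) \<omega>} (ennreal t)))"

text \<open>
  The integral of the simple strategy with trading times \<open>\<tau>\<close> and positions \<open>F\<close> against the
  coordinate process. It is written in terms of \<open>\<tau>\<close> and \<open>F\<close>, but depends only on the process
  \<open>H\<close> that they represent.
\<close>

definition simple_integral ::
    "(nat \<Rightarrow> path \<Rightarrow> ennreal) \<Rightarrow> (nat \<Rightarrow> path \<Rightarrow> real) \<Rightarrow> real \<Rightarrow> path \<Rightarrow> real" where
  "simple_integral \<tau> F t \<omega> =
     (\<Sum>n. F n \<omega> * (stopped_value \<omega> (\<tau> (Suc n) \<omega>) t - stopped_value \<omega> (\<tau> n \<omega>) t))"

definition admissible_strategy ::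
    "real \<Rightarrow> (path \<Rightarrow> real \<Rightarrow> real) \<Rightarrow> (nat \<Rightarrow> path \<Rightarrow> ennreal) \<Rightarrow> (nat \<Rightarrow> path \<Rightarrow> real) \<Rightarrow> bool" where
  "admissible_strategy c H \<tau> F \<longleftrightarrow>
     simple_strategy H \<tau> F \<and> (\<forall>\<omega>\<in>paths. \<forall>t\<ge>0. simple_integral \<tau> F t \<omega> \<ge> - c)"

definition outer_price :: "path set \<Rightarrow> real" where
  "outer_price A = Inf {c. c > 0 \<and>
     (\<exists>H \<tau> F. (\<forall>n::nat. admissible_strategy c (H n) (\<tau> n) (F n)) \<and>
       (\<forall>\<omega>\<in>paths.
          Liminf at_top (\<lambda>t::real. liminf (\<lambda>n. ereal (c + simple_integral (\<tau> n) (F n) t \<omega>)))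
            \<ge> indicator A \<omega>))}"

definition typical :: "(path \<Rightarrow> bool) \<Rightarrow> bool" where
  "typical P \<longleftrightarrow> outer_price {\<omega> \<in> paths. \<not> P \<omega>} = 0"


section \<open>Dyadic Lebesgue partitions and discrete local times\<close>

definition dyadic :: "nat \<Rightarrow> real set" where
  "dyadic n = {of_int k / 2 ^ n | k. True}"

text \<open>Once the value \<open>\<infinity>\<close> is reached, the sequence stays there, as \<open>Inf {} = \<infinity>\<close>.\<close>

primrec lebesgue_time :: "nat \<Rightarrow> path \<Rightarrow> nat \<Rightarrow> ennreal" where
  "lebesgue_time n \<omega> 0 = 0"
| "lebesgue_time n \<omega> (Suc k) =
     Inf {ennreal t | t. 0 \<le> t \<and> lebesgue_time n \<omega> k \<le> ennreal t \<and>
            \<omega> t \<in> dyadic n - {\<omega> (enn2real (lebesgue_time n \<omega> k))}}"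

definition between :: "real \<Rightarrow> real \<Rightarrow> real set" where
  "between a b = (if a \<le> b then {a<..b} else {b<..a})"

text \<open>
  A partition is a sequence of times which increases strictly until it possibly reaches, and then
  stays at, \<open>\<infinity>\<close>. If it has finitely many points before each finite time, then the series has only
  finitely many nonzero terms.
\<close>

definition discrete_local_time :: "(nat \<Rightarrow> ennreal) \<Rightarrow> path \<Rightarrow> real \<Rightarrow> real \<Rightarrow> real" where
  "discrete_local_time \<pi> \<omega> t u =
     (\<Sum>j. if \<pi> j < \<infinity> then
        indicator (between (stopped_value \<omega> (\<pi> j) t) (stopped_value \<omega> (\<pi> (Suc j)) t)) u *
          \<bar>stopped_value \<omega> (\<pi> (Suc j)) t - u\<bar>
      else 0)"

abbreviation dyadic_local_time :: "nat \<Rightarrow> path \<Rightarrow> real \<Rightarrow> real \<Rightarrow> real" where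
  "dyadic_local_time n \<omega> \<equiv> discrete_local_time (lebesgue_time n \<omega>) \<omega>"


section \<open>Function spaces and norms\<close>

definition holder_norm :: "real \<Rightarrow> (real \<Rightarrow> real) \<Rightarrow> ennreal" where
  "holder_norm \<alpha> f =
     (SUP u. ennreal \<bar>f u\<bar>) + (SUP u. SUP v\<in>-{u}. ennreal (\<bar>f u - f v\<bar> / \<bar>u - v\<bar> powr \<alpha>))"

definition holder_space :: "real \<Rightarrow> (real \<Rightarrow> real) set" where
  "holder_space \<alpha> = {f. holder_norm \<alpha> f < \<infinity>}"

text \<open>The space \<open>C([0,T], C\<^sup>\<alpha>(\<real>))\<close>.\<close>

definition continuous_holder_space :: "real \<Rightarrow> real \<Rightarrow> (real \<Rightarrow> real \<Rightarrow> real) set" where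
  "continuous_holder_space T \<alpha> =
     {L. (\<forall>t\<in>{0..T}. L t \<in> holder_space \<alpha>) \<and>
         (\<forall>t\<in>{0..T}. ((\<lambda>s. holder_norm \<alpha> (\<lambda>u. L s u - L t u)) \<longlongrightarrow> 0) (at t within {0..T}))}"

text \<open>The norm of \<open>L\<^sup>\<infinity>([0,T] \<times> \<real>)\<close>.\<close>

definition linfty_norm :: "real \<Rightarrow> (real \<Rightarrow> real \<Rightarrow> real) \<Rightarrow> ennreal" where
  "linfty_norm T f =
     esssup (restrict_space lborel ({0..T} \<times> UNIV)) (\<lambda>(t, u). ennreal \<bar>f t u\<bar>)"

definition p_variation :: "real \<Rightarrow> (real \<Rightarrow> real) \<Rightarrow> ennreal" where
  "p_variation p h =
     (SUP (m, u) \<in> {(m::nat, u::nat \<Rightarrow> real). 1 \<le> m \<and> strict_mono_on {0..m} u}.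
        ennreal ((\<Sum>k=1..m. \<bar>h (u k) - h (u (k - 1))\<bar> powr p) powr (1 / p)))"

definition sup_p_variation :: "real \<Rightarrow> real \<Rightarrow> (real \<Rightarrow> real \<Rightarrow> real) \<Rightarrow> ennreal" where
  "sup_p_variation T p f = (SUP t\<in>{0..T}. p_variation p (f t))"

end

theory Submission
  imports Defs
begin

text \<open>
  Write \<open>h = 2\<^sup>-\<^sup>n\<close>, let \<open>x\<^sub>k\<close> be the value of the path at its \<open>k\<close>-th Lebesgue time of level \<open>n\<close>,
  and let \<open>L\<^sup>n\<close> be the discrete local time of level \<open>n\<close>. After its first step the sequence \<open>x\<close> is a
  nearest neighbour walk on the grid of mesh \<open>h\<close>. The discrete Tanaka formula (\<open>discrete_tanaka\<close>)
  says that \<open>L\<^sup>n\<^sub>t(u)\<close> is \<open>(u - S\<^sub>t)\<^sup>+ - (u - S\<^sub>0)\<^sup>+\<close> plus the integral \<open>I\<^sup>n\<^sub>t(u)\<close> of the position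
  that is \<open>1\<close> while \<open>x\<^sub>k < u\<close>. So differences of local times are gains from trade, and a gain that
  is unusually large compared with the number of trades could be turned into a fortune.

  Compare levels \<open>n - 1\<close> and \<open>n\<close>. The two positions at the height \<open>u\<close> differ only when the fine walk
  has left the coarse grid, and this matters only immediately after it has stepped across one
  particular edge, that is, a pair of adjacent grid points next to \<open>u\<close>. Hence, up to \<open>O(h)\<close>, \<open>I\<^sup>n -
  I\<^sup>n\<^sup>-\<^sup>1\<close> at \<open>u\<close> is the gain of an investor who bets on the step that follows each passage of that
  edge (\<open>consecutive_levels\<close>). In the same way \<open>I\<^sup>n(u + h) - I\<^sup>n(u)\<close> is the sum of two such gains
  (\<open>neighbouring_levels\<close>).

  Suppose that such an investor always holds the multiple \<open>2\<^sup>n\<^sup>/\<^sup>2\<close> of the current capital. A step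
  changes the capital by the factor \<open>1 \<plusminus> 2\<^sup>-\<^sup>n\<^sup>/\<^sup>2\<close>, so the capital stays positive, and its
  logarithm is at least \<open>2\<^sup>n\<^sup>/\<^sup>2\<close> times the gain of unit bets minus \<open>2 \<cdot> 2\<^sup>-\<^sup>n\<close> times the number of
  bets. The strategies for all edges in \<open>[-n, n]\<close> and all \<open>n\<close> can be run together with summable
  weights, because the Lebesgue partitions are nested and a strategy on a coarse partition is also
  one on every finer partition. The paths on which the capital \<open>64\<^sup>n\<close> is reached by one of the bets
  for infinitely many \<open>n\<close> therefore form a null set (\<open>null_set_borel_cantelli\<close>). On all other paths,
  which are called concentrated below, the gain of unit bets at any of these edges is, for all large
  \<open>n\<close> and at all times, at most \<open>2\<^sup>-\<^sup>n\<^sup>/\<^sup>2\<close> times \<open>64 n + 2 \<cdot> 2\<^sup>-\<^sup>n N\<close>, where \<open>N\<close> is the number of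
  passages (\<open>typical_concentrated\<close>).

  What remains is deterministic. Since \<open>2\<^sup>-\<^sup>n N\<close> is at most \<open>L\<^sup>n + 2h\<close> at the edge, the estimate
  bounds itself: for large \<open>n\<close> the supremum \<open>A\<^sub>n\<close> of \<open>L\<^sup>n\<close> over \<open>[0,T] \<times> \<real>\<close> satisfies \<open>A\<^sub>n + 1 \<le> (1
  + \<delta>\<^sub>n) (A\<^sub>n\<^sub>-\<^sub>1 + 1)\<close> with a summable sequence \<open>\<delta>\<close>. So \<open>A\<close> is bounded, and \<open>L\<^sup>n - L\<^sup>n\<^sup>-\<^sup>1\<close> and the
  differences of \<open>I\<^sup>n\<close> between adjacent grid points are \<open>O(n 2\<^sup>-\<^sup>n\<^sup>/\<^sup>2)\<close>
  (\<open>local_time_rough_estimates\<close>). For \<open>\<beta> < 1/2\<close>, comparing two heights at distance about \<open>2\<^sup>-\<^sup>m\<close> on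
  level \<open>m\<close> turns this into \<open>\<beta>\<close>-Hoelder bounds for the limit and, down to the scale \<open>h\<close>, for \<open>I\<^sup>n\<close>
  (\<open>holder_estimates\<close>). With \<open>\<beta> = 1/p\<close>, the \<open>p\<close>-th powers of the increments of \<open>I\<^sup>n\<close> are dominated
  by increments of grid points, which telescope; this bounds the \<open>p\<close>-variation uniformly in \<open>n\<close>.
  Continuity in time with values in the \<open>\<alpha>\<close>-Hoelder space follows from uniform convergence by
  interpolating between the supremum norm and a \<open>\<beta>\<close>-Hoelder bound with \<open>\<beta> > \<alpha>\<close>.
\<close>

section \<open>Time partitions and integrals along them\<close>

definition time_partition :: "(nat \<Rightarrow> ennreal) \<Rightarrow> bool" where
  "time_partition \<pi> \<longleftrightarrow> \<pi> 0 = 0 \<and> (\<forall>k. \<pi> k < \<pi> (Suc k) \<or> \<pi> k = \<infinity> \<and> \<pi> (Suc k) = \<infinity>) \<and>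
     (\<forall>T>0. finite {k. \<pi> k \<le> ennreal T})"

text \<open>
  The integral of a simple strategy along a single path, with the positions as plain numbers. It is
  also used for positions that nobody needs to trade, such as the one in Tanaka's formula.
\<close>

definition path_integral :: "(nat \<Rightarrow> ennreal) \<Rightarrow> (nat \<Rightarrow> real) \<Rightarrow> path \<Rightarrow> real \<Rightarrow> real" where
  "path_integral \<pi> f \<omega> t =
     (\<Sum>k. f k * (stopped_value \<omega> (\<pi> (Suc k)) t - stopped_value \<omega> (\<pi> k) t))"

lemma simple_integral_eq: "simple_integral \<tau> F t \<omega> = path_integral (\<lambda>k. \<tau> k \<omega>) (\<lambda>k. F k \<omega>) \<omega> t"
  by (simp add: simple_integral_def path_integral_def)

lemma stopped_value_before: "\<sigma> \<le> ennreal t \<Longrightarrow> stopped_value \<omega> \<sigma> t = \<omega> (enn2real \<sigma>)"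
  by (simp add: stopped_value_def min_absorb1)

lemma stopped_value_after: "0 \<le> t \<Longrightarrow> ennreal t \<le> \<sigma> \<Longrightarrow> stopped_value \<omega> \<sigma> t = \<omega> t"
  by (simp add: stopped_value_def min_absorb2)

lemma partition_mono:
  assumes "time_partition \<pi>" "i \<le> j"
  shows "\<pi> i \<le> \<pi> j"
proof (rule lift_Suc_mono_le[OF _ assms(2)])
  show "\<pi> n \<le> \<pi> (Suc n)" for n
    using assms(1) unfolding time_partition_def by (metis less_imp_le order_refl)
qed

lemma partition_strict:
  assumes "time_partition \<pi>" "i < j" "\<pi> i < \<infinity>"
  shows "\<pi> i < \<pi> j"
proof -
  have "\<pi> i < \<pi> (Suc i)" using assms unfolding time_partition_def by (metis less_irrefl)
  also have "\<dots> \<le> \<pi> j" using assms by (intro partition_mono) auto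
  finally show ?thesis .
qed

lemma partition_index:
  assumes "time_partition \<pi>" "0 \<le> t"
  obtains k where "\<pi> k \<le> ennreal t" "ennreal t < \<pi> (Suc k)"
proof -
  let ?A = "{k. \<pi> k \<le> ennreal t}"
  have "?A \<subseteq> {k. \<pi> k \<le> ennreal (t + 1)}" by (auto elim!: order_trans intro!: ennreal_leI)
  moreover have "0 < t + 1" using assms(2) by simp
  then have "finite {k. \<pi> k \<le> ennreal (t + 1)}"
    using assms(1) unfolding time_partition_def by blast
  ultimately have fin: "finite ?A" by (rule finite_subset)
  have "0 \<in> ?A" using assms by (auto simp: time_partition_def)
  then have "Max ?A \<in> ?A" using fin by (intro Max_in) auto
  moreover have "Suc (Max ?A) \<notin> ?A" using fin Max_ge[of ?A "Suc (Max ?A)"] by (metis Suc_n_not_le_n)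
  ultimately show ?thesis using that[of "Max ?A"] by auto
qed

lemma path_integral_finite_sum:
  assumes "time_partition \<pi>" "0 \<le> t" "ennreal t \<le> \<pi> (Suc j)"
  shows "path_integral \<pi> f \<omega> t =
    (\<Sum>k\<le>j. f k * (stopped_value \<omega> (\<pi> (Suc k)) t - stopped_value \<omega> (\<pi> k) t))"
  unfolding path_integral_def
proof (rule suminf_finite)
  fix k assume "k \<notin> {..j}"
  then have "ennreal t \<le> \<pi> k" "ennreal t \<le> \<pi> (Suc k)"
    using assms(3) partition_mono[OF assms(1), of "Suc j" k] partition_mono[OF assms(1), of "Suc j" "Suc k"]
    by auto
  then show "f k * (stopped_value \<omega> (\<pi> (Suc k)) t - stopped_value \<omega> (\<pi> k) t) = 0"
    using assms(2) by (simp add: stopped_value_after)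
qed simp

text \<open>
  The form in which the integral is computed throughout: completed steps contribute fully, the
  running one up to the current time, and later ones not at all.
\<close>

lemma path_integral_local:
  assumes "time_partition \<pi>" "0 \<le> t" "\<pi> j \<le> ennreal t" "ennreal t \<le> \<pi> (Suc j)"
  shows "path_integral \<pi> f \<omega> t =
    (\<Sum>i<j. f i * (\<omega> (enn2real (\<pi> (Suc i))) - \<omega> (enn2real (\<pi> i)))) + f j * (\<omega> t - \<omega> (enn2real (\<pi> j)))"
proof -
  let ?g = "\<lambda>k. f k * (stopped_value \<omega> (\<pi> (Suc k)) t - stopped_value \<omega> (\<pi> k) t)"
  have "path_integral \<pi> f \<omega> t = sum ?g {..j}" by (rule path_integral_finite_sum[OF assms(1,2,4)])
  also have "\<dots> = sum ?g {..<j} + ?g j" by (simp add: lessThan_Suc_atMost[symmetric])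
  also have "?g j = f j * (\<omega> t - \<omega> (enn2real (\<pi> j)))"
    using assms by (simp add: stopped_value_after stopped_value_before)
  also have "sum ?g {..<j} = (\<Sum>i<j. f i * (\<omega> (enn2real (\<pi> (Suc i))) - \<omega> (enn2real (\<pi> i))))"
  proof (rule sum.cong[OF refl])
    fix i assume "i \<in> {..<j}"
    then have "\<pi> i \<le> ennreal t" "\<pi> (Suc i) \<le> ennreal t"
      using assms(3) partition_mono[OF assms(1), of i j] partition_mono[OF assms(1), of "Suc i" j]
      by auto
    then show "?g i = f i * (\<omega> (enn2real (\<pi> (Suc i))) - \<omega> (enn2real (\<pi> i)))"
      by (simp add: stopped_value_before)
  qed
  finally show ?thesis .
qed

lemma path_integral_cong:
  assumes \<pi>: "time_partition \<pi>" and t: "0 \<le> t" and eq: "\<And>i. \<pi> i \<le> ennreal t \<Longrightarrow> f i = g i"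
  shows "path_integral \<pi> f \<omega> t = path_integral \<pi> g \<omega> t"
proof -
  obtain k where k: "\<pi> k \<le> ennreal t" "ennreal t < \<pi> (Suc k)" using partition_index[OF \<pi> t] .
  have "f i = g i" if "i \<le> k" for i using partition_mono[OF \<pi> that] k(1) by (intro eq) simp
  then show ?thesis using k
    by (subst (1 2) path_integral_local[OF \<pi> t k(1)]) (auto intro!: sum.cong arg_cong2[where f="(+)"])
qed

lemma path_integral_as_sum:
  assumes "time_partition \<pi>" "0 \<le> t"
  obtains j D where "\<And>f. path_integral \<pi> f \<omega> t = (\<Sum>k\<le>j. f k * D k)"
  using partition_index[OF assms] path_integral_finite_sum[OF assms] by (metis less_imp_le)

lemma path_integral_sum:
  assumes "time_partition \<pi>" "0 \<le> t"
  shows "path_integral \<pi> (\<lambda>k. \<Sum>i\<in>I. f i k) \<omega> t = (\<Sum>i\<in>I. path_integral \<pi> (f i) \<omega> t)"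
  by (rule path_integral_as_sum[OF assms, of \<omega>]) (simp add: sum_distrib_right sum.swap[of _ I])

lemma path_integral_cmult:
  assumes "time_partition \<pi>" "0 \<le> t"
  shows "path_integral \<pi> (\<lambda>k. c * f k) \<omega> t = c * path_integral \<pi> f \<omega> t"
  by (rule path_integral_as_sum[OF assms, of \<omega>]) (simp add: sum_distrib_left mult.assoc)

lemma path_integral_diff:
  assumes "time_partition \<pi>" "0 \<le> t"
  shows "path_integral \<pi> (\<lambda>k. f k - g k) \<omega> t = path_integral \<pi> f \<omega> t - path_integral \<pi> g \<omega> t"
  by (rule path_integral_as_sum[OF assms, of \<omega>]) (simp add: left_diff_distrib sum_subtractf)

text \<open>
  The position held at time \<open>s\<close>, as a right-continuous step function. As a series of indicators it
  is measurable when \<open>s\<close> is a stopping time, and it vanishes at \<open>s = \<infinity>\<close>.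
\<close>

definition active_position :: "(nat \<Rightarrow> ennreal) \<Rightarrow> (nat \<Rightarrow> real) \<Rightarrow> ennreal \<Rightarrow> real" where
  "active_position \<pi> f s = (\<Sum>j. f j * indicator {\<pi> j..<\<pi> (Suc j)} s)"

lemma active_position_eq:
  assumes "time_partition \<pi>" "\<pi> j \<le> s" "s < \<pi> (Suc j)"
  shows "active_position \<pi> f s = f j"
proof -
  have "active_position \<pi> f s = (\<Sum>k\<in>{j}. f k * indicator {\<pi> k..<\<pi> (Suc k)} s)"
    unfolding active_position_def
  proof (rule suminf_finite)
    fix k assume "k \<notin> {j}"
    then have "Suc k \<le> j \<or> Suc j \<le> k" by auto
    then have "\<pi> (Suc k) \<le> \<pi> j \<or> \<pi> (Suc j) \<le> \<pi> k" using partition_mono[OF assms(1)] by blast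
    then have "s \<notin> {\<pi> k..<\<pi> (Suc k)}" using assms(2,3) by auto
    then show "f k * indicator {\<pi> k..<\<pi> (Suc k)} s = 0" by simp
  qed simp
  then show ?thesis using assms by simp
qed

lemma active_position_top: "active_position \<pi> f \<infinity> = 0"
  by (simp add: active_position_def)

lemma active_position_bound:
  assumes "time_partition \<pi>" "\<And>j. \<bar>f j\<bar> \<le> B"
  shows "\<bar>active_position \<pi> f s\<bar> \<le> B"
proof (cases "s = \<infinity>")
  case True
  then show ?thesis using assms(2)[of 0] by (simp only: active_position_top)
next
  case False
  then have s: "s = ennreal (enn2real s)" by (simp add: less_top)
  obtain k where "\<pi> k \<le> s" "s < \<pi> (Suc k)" using partition_index[OF assms(1), of "enn2real s"] s by auto
  then show ?thesis using active_position_eq[OF assms(1)] assms(2) by metis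
qed

text \<open>
  Trading on a finer partition can imitate trading on a coarser one: hold, at each fine time, the
  position that is active in the coarse partition. The coarse integral up to the times of the fine
  partition has exactly the increments of the fine integral, because no coarse time lies strictly
  between two consecutive fine ones.
\<close>

lemma path_integral_refine:
  assumes \<pi>: "time_partition \<pi>" and \<rho>: "time_partition \<rho>"
    and nested: "\<And>j. \<pi> j < \<infinity> \<Longrightarrow> \<exists>k. \<rho> k = \<pi> j" and t: "0 \<le> t"
  shows "path_integral \<rho> (\<lambda>k. active_position \<pi> f (\<rho> k)) \<omega> t = path_integral \<pi> f \<omega> t"
proof -
  define A where "A s = path_integral \<pi> f \<omega> s" for s
  have inc: "A s - A (enn2real (\<rho> k)) = active_position \<pi> f (\<rho> k) * (\<omega> s - \<omega> (enn2real (\<rho> k)))"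
    if "0 \<le> s" "\<rho> k \<le> ennreal s" "ennreal s \<le> \<rho> (Suc k)" for s k
  proof -
    have fin: "\<rho> k < \<infinity>" using that(2) by (simp add: le_less_trans)
    define r where "r = enn2real (\<rho> k)"
    have r: "\<rho> k = ennreal r" "0 \<le> r" using fin by (auto simp: r_def)
    obtain j where j: "\<pi> j \<le> \<rho> k" "\<rho> k < \<pi> (Suc j)"
      using partition_index[OF \<pi> r(2)] r(1) by metis
    have le: "\<rho> (Suc k) \<le> \<pi> (Suc j)"
    proof (cases "\<pi> (Suc j) < \<infinity>")
      case True
      then obtain l where l: "\<rho> l = \<pi> (Suc j)" using nested by blast
      have "k < l" using j(2) l partition_mono[OF \<rho>, of l k] by (cases "k < l") auto
      then show ?thesis using partition_mono[OF \<rho>, of "Suc k" l] l by simp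
    next
      case False
      then have "\<pi> (Suc j) = \<infinity>" by (simp add: less_top[symmetric])
      then show ?thesis by simp
    qed
    have "A s = (\<Sum>i<j. f i * (\<omega> (enn2real (\<pi> (Suc i))) - \<omega> (enn2real (\<pi> i)))) +
        f j * (\<omega> s - \<omega> (enn2real (\<pi> j)))"
      unfolding A_def using that j le by (intro path_integral_local[OF \<pi>]) (auto intro: order_trans)
    moreover have "A r = (\<Sum>i<j. f i * (\<omega> (enn2real (\<pi> (Suc i))) - \<omega> (enn2real (\<pi> i)))) +
        f j * (\<omega> r - \<omega> (enn2real (\<pi> j)))"
      unfolding A_def using r j by (intro path_integral_local[OF \<pi>]) auto
    moreover have "active_position \<pi> f (\<rho> k) = f j" using active_position_eq[OF \<pi>] j by blast
    ultimately show ?thesis by (simp add: r_def algebra_simps)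
  qed
  obtain m where m: "\<rho> m \<le> ennreal t" "ennreal t < \<rho> (Suc m)" using partition_index[OF \<rho> t] .
  have "path_integral \<rho> (\<lambda>k. active_position \<pi> f (\<rho> k)) \<omega> t =
     (\<Sum>i<m. active_position \<pi> f (\<rho> i) * (\<omega> (enn2real (\<rho> (Suc i))) - \<omega> (enn2real (\<rho> i))))
       + active_position \<pi> f (\<rho> m) * (\<omega> t - \<omega> (enn2real (\<rho> m)))"
    using m t by (intro path_integral_local[OF \<rho>]) auto
  also have "active_position \<pi> f (\<rho> m) * (\<omega> t - \<omega> (enn2real (\<rho> m))) = A t - A (enn2real (\<rho> m))"
    using inc[of t m] m t by auto
  also have "(\<Sum>i<m. active_position \<pi> f (\<rho> i) * (\<omega> (enn2real (\<rho> (Suc i))) - \<omega> (enn2real (\<rho> i)))) =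
     (\<Sum>i<m. A (enn2real (\<rho> (Suc i))) - A (enn2real (\<rho> i)))"
  proof (rule sum.cong[OF refl])
    fix i assume "i \<in> {..<m}"
    then have "\<rho> (Suc i) \<le> ennreal t" using m(1) partition_mono[OF \<rho>, of "Suc i" m] by auto
    then have "\<rho> (Suc i) < \<infinity>" by (simp add: le_less_trans)
    then show "active_position \<pi> f (\<rho> i) * (\<omega> (enn2real (\<rho> (Suc i))) - \<omega> (enn2real (\<rho> i))) =
      A (enn2real (\<rho> (Suc i))) - A (enn2real (\<rho> i))"
      using inc[of "enn2real (\<rho> (Suc i))" i] partition_mono[OF \<rho>, of i "Suc i"] by simp
  qed
  also have "\<dots> = A (enn2real (\<rho> m)) - A (enn2real (\<rho> 0))" by (rule sum_lessThan_telescope)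
  also have "A (enn2real (\<rho> 0)) = 0"
    using path_integral_local[OF \<pi>, of 0 0 f \<omega>] \<rho> \<pi> by (simp add: A_def time_partition_def)
  finally show ?thesis by (simp add: A_def)
qed

section \<open>Dyadic grids and Lebesgue times\<close>

declare lebesgue_time.simps(2) [simp del]

lemma dyadic_separated:
  assumes "a \<in> dyadic n" "b \<in> dyadic n" "a \<noteq> b"
  shows "1 / 2 ^ n \<le> \<bar>a - b\<bar>"
proof -
  obtain i j :: int where ij: "a = of_int i / 2 ^ n" "b = of_int j / 2 ^ n"
    using assms(1,2) unfolding dyadic_def by blast
  have "i \<noteq> j" using assms(3) ij by auto
  then have "1 \<le> \<bar>i - j\<bar>" by linarith
  then have "1 \<le> \<bar>real_of_int i - of_int j\<bar>" by (metis of_int_1_le_iff of_int_abs of_int_diff)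
  moreover have "\<bar>a - b\<bar> = \<bar>real_of_int i - of_int j\<bar> / 2 ^ n"
    by (simp add: ij diff_divide_distrib[symmetric])
  ultimately show ?thesis by (simp add: divide_right_mono)
qed

lemma dyadic_mono: "m \<le> n \<Longrightarrow> dyadic m \<subseteq> dyadic n"
proof
  fix a assume "m \<le> n" "a \<in> dyadic m"
  then obtain k :: int where "a = of_int k / 2 ^ m" by (auto simp: dyadic_def)
  also have "\<dots> = of_int (k * 2 ^ (n - m)) / 2 ^ n"
    using \<open>m \<le> n\<close> by (simp add: field_simps flip: power_add)
  finally show "a \<in> dyadic n" unfolding dyadic_def by blast
qed

lemma dyadic_add_mesh:
  assumes "a \<in> dyadic n" shows "a + 1 / 2 ^ n \<in> dyadic n" "a - 1 / 2 ^ n \<in> dyadic n"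
proof -
  obtain i :: int where a: "a = of_int i / 2 ^ n" using assms(1) unfolding dyadic_def by blast
  have "a + 1 / 2 ^ n = of_int (i + 1) / 2 ^ n" "a - 1 / 2 ^ n = of_int (i - 1) / 2 ^ n"
    by (simp_all add: a add_divide_distrib diff_divide_distrib)
  then show "a + 1 / 2 ^ n \<in> dyadic n" "a - 1 / 2 ^ n \<in> dyadic n" unfolding dyadic_def by blast+
qed

definition dyadic_ceiling :: "nat \<Rightarrow> real \<Rightarrow> real" where
  "dyadic_ceiling n u = of_int \<lceil>u * 2 ^ n\<rceil> / 2 ^ n"

lemma dyadic_ceiling_in: "dyadic_ceiling n u \<in> dyadic n"
  unfolding dyadic_ceiling_def dyadic_def by blast

lemma dyadic_ceiling_ge: "u \<le> dyadic_ceiling n u"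
  by (simp add: dyadic_ceiling_def field_simps)

lemma dyadic_ceiling_less: "dyadic_ceiling n u < u + 1 / 2 ^ n"
proof -
  have "of_int \<lceil>u * 2 ^ n\<rceil> < u * 2 ^ n + 1" by linarith
  then show ?thesis by (simp add: dyadic_ceiling_def field_simps)
qed

lemma dyadic_less_ceiling_iff:
  assumes "a \<in> dyadic n" shows "a < dyadic_ceiling n u \<longleftrightarrow> a < u"
proof -
  obtain i :: int where a: "a = of_int i / 2 ^ n" using assms(1) unfolding dyadic_def by blast
  have "a < dyadic_ceiling n u \<longleftrightarrow> i < \<lceil>u * 2 ^ n\<rceil>"
    by (simp add: a dyadic_ceiling_def divide_less_cancel)
  also have "\<dots> \<longleftrightarrow> a < u" by (simp add: less_ceiling_iff a field_simps)
  finally show ?thesis .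
qed

lemma dyadic_above:
  obtains d where "d \<in> dyadic n" "a < d" "d \<le> a + 1 / 2 ^ n"
proof -
  let ?d = "of_int (\<lfloor>a * 2 ^ n\<rfloor> + 1) / 2 ^ n :: real"
  have "a * 2 ^ n < of_int (\<lfloor>a * 2 ^ n\<rfloor> + 1)" "of_int (\<lfloor>a * 2 ^ n\<rfloor> + 1) \<le> a * 2 ^ n + 1" by linarith+
  then have "a < ?d" "?d \<le> a + 1 / 2 ^ n" by (simp_all add: field_simps)
  moreover have "?d \<in> dyadic n" unfolding dyadic_def by blast
  ultimately show ?thesis by (rule that[rotated])
qed

lemma dyadic_uminus: "a \<in> dyadic n \<Longrightarrow> - a \<in> dyadic n"
  unfolding dyadic_def by clarsimp (metis minus_divide_left of_int_minus)

lemma dyadic_below: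
  obtains d where "d \<in> dyadic n" "d < a" "a - 1 / 2 ^ n \<le> d"
proof -
  obtain d where "d \<in> dyadic n" "- a < d" "d \<le> - a + 1 / 2 ^ n" by (rule dyadic_above)
  then show ?thesis using that[of "- d"] by (simp add: dyadic_uminus)
qed

text \<open>
  Discreteness of the grid makes its hitting times attained.
\<close>

lemma closed_dyadic_minus: "closed (dyadic n - A)"
proof (rule discrete_imp_closed)
  show "0 < (1 / 2 ^ n :: real)" by simp
  show "\<forall>x\<in>dyadic n - A. \<forall>y\<in>dyadic n - A. dist y x < 1 / 2 ^ n \<longrightarrow> y = x"
    using dyadic_separated by (fastforce simp: dist_real_def)
qed

abbreviation skeleton :: "nat \<Rightarrow> path \<Rightarrow> nat \<Rightarrow> real" where
  "skeleton n \<omega> k \<equiv> \<omega> (enn2real (lebesgue_time n \<omega> k))"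

lemma paths_continuous: "\<omega> \<in> paths \<Longrightarrow> 0 \<le> a \<Longrightarrow> continuous_on {a..b} \<omega>"
  by (auto simp: paths_def elim: continuous_on_subset)

text \<open>
  The infimum that defines the next Lebesgue time is a minimum, since the path hits a closed set.
  This case distinction replaces all further reasoning about infima.
\<close>

lemma lebesgue_time_Suc_cases:
  assumes \<omega>: "\<omega> \<in> paths" and r: "lebesgue_time n \<omega> k = ennreal r" "0 \<le> r"
  obtains (never) "lebesgue_time n \<omega> (Suc k) = \<infinity>" "\<And>t. r \<le> t \<Longrightarrow> \<omega> t \<notin> dyadic n - {\<omega> r}"
  | (hit) s where "r < s" "lebesgue_time n \<omega> (Suc k) = ennreal s" "\<omega> s \<in> dyadic n - {\<omega> r}"
      "\<And>t. r \<le> t \<Longrightarrow> t < s \<Longrightarrow> \<omega> t \<notin> dyadic n - {\<omega> r}"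
proof -
  define A where "A = {r..} \<inter> \<omega> -` (dyadic n - {\<omega> r})"
  have eq: "lebesgue_time n \<omega> (Suc k) = Inf (ennreal ` A)"
    using r by (auto simp: A_def lebesgue_time.simps(2) intro!: arg_cong[where f=Inf])
  have cont: "continuous_on {r..} \<omega>"
    using \<omega> r(2) by (auto simp: paths_def elim: continuous_on_subset)
  have cl: "closed A"
    unfolding A_def by (intro continuous_closed_preimage cont closed_dyadic_minus) auto
  have bdd: "bdd_below A" by (rule bdd_belowI[of _ r]) (auto simp: A_def)
  show ?thesis
  proof (cases "A = {}")
    case True
    then show ?thesis using eq by (intro never) (auto simp: A_def)
  next
    case False
    define s where "s = Inf A"
    have "s \<in> A" unfolding s_def by (rule closed_contains_Inf[OF False bdd cl])
    moreover have le: "s \<le> t" if "t \<in> A" for t unfolding s_def by (rule cInf_lower[OF that bdd])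
    moreover have "Inf (ennreal ` A) = ennreal s"
      using \<open>s \<in> A\<close> le by (intro antisym Inf_lower Inf_greatest) (auto intro: ennreal_leI)
    moreover have "r < s" using \<open>s \<in> A\<close> unfolding A_def by (cases "r = s") auto
    moreover have "\<omega> t \<notin> dyadic n - {\<omega> r}" if "r \<le> t" "t < s" for t
      using le[of t] that by (auto simp: A_def)
    ultimately show ?thesis using eq by (intro hit[of s]) (auto simp: A_def)
  qed
qed

lemma lebesgue_time_strict:
  assumes "\<omega> \<in> paths"
  shows "lebesgue_time n \<omega> k < lebesgue_time n \<omega> (Suc k) \<or>
         lebesgue_time n \<omega> k = \<infinity> \<and> lebesgue_time n \<omega> (Suc k) = \<infinity>"
proof (cases "lebesgue_time n \<omega> k")
  case (real r)
  show ?thesis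
    by (rule lebesgue_time_Suc_cases[OF assms real(2,1)]) (use real in \<open>auto simp: ennreal_less_iff\<close>)
next
  case top
  then have "lebesgue_time n \<omega> (Suc k) = \<infinity>" by (simp add: lebesgue_time.simps(2) top_unique)
  then show ?thesis using top by simp
qed

lemma skeleton_dyadic:
  assumes "\<omega> \<in> paths" "lebesgue_time n \<omega> (Suc k) < \<infinity>"
  shows "skeleton n \<omega> (Suc k) \<in> dyadic n - {skeleton n \<omega> k}"
proof -
  have "lebesgue_time n \<omega> k < \<infinity>" using lebesgue_time_strict[OF assms(1), of n k] assms(2) by auto
  then obtain r where r: "lebesgue_time n \<omega> k = ennreal r" "0 \<le> r" by (cases "lebesgue_time n \<omega> k") auto
  show ?thesis
    by (rule lebesgue_time_Suc_cases[OF assms(1) r]) (use assms r in \<open>auto\<close>)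
qed

lemma skeleton_in_dyadic:
  assumes "\<omega> \<in> paths" "lebesgue_time n \<omega> k < \<infinity>" "0 < k"
  shows "skeleton n \<omega> k \<in> dyadic n"
  using skeleton_dyadic[OF assms(1), of n "k - 1"] assms by simp

lemma no_dyadic_hit:
  assumes "\<omega> \<in> paths" "0 \<le> t" "lebesgue_time n \<omega> k \<le> ennreal t" "ennreal t < lebesgue_time n \<omega> (Suc k)"
  shows "\<omega> t \<notin> dyadic n - {skeleton n \<omega> k}"
proof -
  have "lebesgue_time n \<omega> k < \<infinity>" using assms(3) by (simp add: le_less_trans)
  then obtain r where r: "lebesgue_time n \<omega> k = ennreal r" "0 \<le> r" by (cases "lebesgue_time n \<omega> k") auto
  have "r \<le> t" using assms(2,3) r by simp
  show ?thesis
  proof (rule lebesgue_time_Suc_cases[OF assms(1) r])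
    assume "\<And>t. r \<le> t \<Longrightarrow> \<omega> t \<notin> dyadic n - {\<omega> r}"
    then show ?thesis using \<open>r \<le> t\<close> r by auto
  next
    fix s assume s: "r < s" "lebesgue_time n \<omega> (Suc k) = ennreal s"
      "\<And>t. r \<le> t \<Longrightarrow> t < s \<Longrightarrow> \<omega> t \<notin> dyadic n - {\<omega> r}"
    have "t < s" using assms(2,4) s(2) by (simp add: ennreal_less_iff)
    then show ?thesis using s(3)[OF \<open>r \<le> t\<close>] r by simp
  qed
qed

text \<open>
  Before the next Lebesgue time the path cannot leave the mesh-size neighbourhood of its last
  recorded value, by the intermediate value theorem: on its way out it would hit a grid point. This
  includes the first step, which may start off the grid.
\<close>

lemma oscillation_le_mesh:
  assumes \<omega>: "\<omega> \<in> paths" and t: "0 \<le> t"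
    and le: "lebesgue_time n \<omega> k \<le> ennreal t" "ennreal t \<le> lebesgue_time n \<omega> (Suc k)"
  shows "\<bar>\<omega> t - skeleton n \<omega> k\<bar> \<le> 1 / 2 ^ n"
proof (rule ccontr)
  assume asm: "\<not> ?thesis"
  have "lebesgue_time n \<omega> k < \<infinity>" using le(1) by (simp add: le_less_trans)
  then obtain r where r: "lebesgue_time n \<omega> k = ennreal r" "0 \<le> r" by (cases "lebesgue_time n \<omega> k") auto
  have "r \<le> t" using t le(1) r by simp
  have sk: "skeleton n \<omega> k = \<omega> r" using r by simp
  have cont: "continuous_on {r..t} \<omega>" by (rule paths_continuous[OF \<omega> r(2)])
  have "\<exists>s. r \<le> s \<and> s < t \<and> \<omega> s \<in> dyadic n - {\<omega> r}"
  proof (cases "\<omega> t > \<omega> r")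
    case True
    obtain d where d: "d \<in> dyadic n" "\<omega> r < d" "d \<le> \<omega> r + 1 / 2 ^ n" by (rule dyadic_above)
    have "d < \<omega> t" using asm True d(3) unfolding sk by linarith
    then obtain s where "r \<le> s" "s \<le> t" "\<omega> s = d" using IVT'[of \<omega> r d t] d \<open>r \<le> t\<close> cont by auto
    then show ?thesis using d \<open>d < \<omega> t\<close> by (intro exI[of _ s]) (cases "s = t", auto)
  next
    case False
    obtain d where d: "d \<in> dyadic n" "d < \<omega> r" "\<omega> r - 1 / 2 ^ n \<le> d" by (rule dyadic_below)
    have "\<omega> t < d" using asm False d(3) unfolding sk by linarith
    then obtain s where "r \<le> s" "s \<le> t" "\<omega> s = d" using IVT2'[of \<omega> t d r] d \<open>r \<le> t\<close> cont by auto
    then show ?thesis using d \<open>\<omega> t < d\<close> by (intro exI[of _ s]) (cases "s = t", auto)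
  qed
  then obtain s where s: "r \<le> s" "s < t" "\<omega> s \<in> dyadic n - {\<omega> r}" by blast
  have "ennreal s < lebesgue_time n \<omega> (Suc k)"
    using le(2) s r by (intro less_le_trans[OF _ le(2)]) (auto simp: ennreal_less_iff)
  then show False using no_dyadic_hit[OF \<omega>, of s n k] s r sk by simp
qed

lemma skeleton_step_le:
  assumes \<omega>: "\<omega> \<in> paths" and fin: "lebesgue_time n \<omega> (Suc k) < \<infinity>"
  shows "\<bar>skeleton n \<omega> (Suc k) - skeleton n \<omega> k\<bar> \<le> 1 / 2 ^ n"
  using lebesgue_time_strict[OF \<omega>, of n k] fin
  by (intro oscillation_le_mesh[OF \<omega>]) auto

text \<open>
  From its first recorded grid point on, the sampled path is a nearest neighbour walk.
\<close>

lemma skeleton_step: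
  assumes \<omega>: "\<omega> \<in> paths" and fin: "lebesgue_time n \<omega> (Suc k) < \<infinity>" and k: "0 < k"
  shows "\<bar>skeleton n \<omega> (Suc k) - skeleton n \<omega> k\<bar> = 1 / 2 ^ n"
proof -
  have "lebesgue_time n \<omega> k < \<infinity>" using lebesgue_time_strict[OF \<omega>, of n k] fin by auto
  then have "skeleton n \<omega> k \<in> dyadic n" by (rule skeleton_in_dyadic[OF \<omega> _ k])
  then have "1 / 2 ^ n \<le> \<bar>skeleton n \<omega> (Suc k) - skeleton n \<omega> k\<bar>"
    using skeleton_dyadic[OF \<omega> fin] by (intro dyadic_separated) auto
  then show ?thesis using skeleton_step_le[OF \<omega> fin] by linarith
qed

text \<open>
  Only finitely many Lebesgue times lie before \<open>T\<close>: each step has the height of the mesh, so by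
  uniform continuity its duration is bounded below.
\<close>

lemma lebesgue_partition:
  assumes \<omega>: "\<omega> \<in> paths"
  shows "time_partition (lebesgue_time n \<omega>)"
  unfolding time_partition_def
proof (intro conjI allI impI lebesgue_time_strict[OF \<omega>])
  fix T :: real assume T: "0 < T"
  let ?\<tau> = "lebesgue_time n \<omega>"
  have mono: "?\<tau> i \<le> ?\<tau> j" if "i \<le> j" for i j
    using lebesgue_time_strict[OF \<omega>] by (intro lift_Suc_mono_le[OF _ that]) (metis less_imp_le order_refl)
  have "uniformly_continuous_on {0..T} \<omega>"
    by (intro compact_uniformly_continuous paths_continuous[OF \<omega>]) auto
  then obtain \<delta> where \<delta>: "0 < \<delta>"
    "\<And>s t. s \<in> {0..T} \<Longrightarrow> t \<in> {0..T} \<Longrightarrow> dist t s < \<delta> \<Longrightarrow> dist (\<omega> t) (\<omega> s) < 1 / 2 ^ n"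
    unfolding uniformly_continuous_on_def by (metis zero_less_divide_1_iff zero_less_numeral zero_less_power)
  \<comment> \<open>The first step may be arbitrarily short; so the count starts at index 1.\<close>
  have grow: "real k * \<delta> \<le> enn2real (?\<tau> (Suc k))" if "?\<tau> (Suc k) \<le> ennreal T" for k
    using that
  proof (induction k)
    case (Suc k)
    have le: "?\<tau> (Suc k) \<le> ?\<tau> (Suc (Suc k))" by (rule mono) simp
    have fin: "?\<tau> (Suc (Suc k)) < \<infinity>" using Suc.prems by (simp add: le_less_trans)
    have IH: "real k * \<delta> \<le> enn2real (?\<tau> (Suc k))" using Suc le order_trans by blast
    define r s where "r = enn2real (?\<tau> (Suc k))" and "s = enn2real (?\<tau> (Suc (Suc k)))"
    have rs: "0 \<le> r" "r \<le> s" "s \<le> T"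
      using le fin Suc.prems T unfolding r_def s_def
      by (auto intro!: enn2real_mono enn2real_leI)
    have "dist (\<omega> r) (\<omega> s) = 1 / 2 ^ n"
      using skeleton_step[OF \<omega> fin] unfolding r_def s_def dist_real_def by (simp add: abs_minus_commute)
    then have "\<not> dist r s < \<delta>" using \<delta>(2)[of s r] rs by auto
    then have "r + \<delta> \<le> s" using rs by (auto simp: dist_real_def)
    then show ?case using IH unfolding r_def s_def by (simp add: algebra_simps)
  qed simp
  obtain K :: nat where K: "T / \<delta> < real K" using reals_Archimedean2 by blast
  have "{k. ?\<tau> k \<le> ennreal T} \<subseteq> {..K}"
  proof (clarsimp, rule ccontr)
    fix k assume k: "?\<tau> k \<le> ennreal T" "\<not> k \<le> K"
    have "?\<tau> (Suc K) \<le> ennreal T" using mono[of "Suc K" k] k by auto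
    then have "real K * \<delta> \<le> T" using grow[of K] T enn2real_leI[of T "?\<tau> (Suc K)"] by linarith
    then show False using K \<delta>(1) by (simp add: field_simps)
  qed
  then show "finite {k. ?\<tau> k \<le> ennreal T}" by (rule finite_subset) simp
qed simp

text \<open>
  At a coarse Lebesgue time the path is at a coarse grid point that differs from the previous coarse
  value. If the fine walk had recorded this point already, it would have done so since the previous
  coarse time, and the coarse time would have come earlier.
\<close>

lemma lebesgue_times_nested:
  assumes \<omega>: "\<omega> \<in> paths" and mn: "m \<le> n" and fin: "lebesgue_time m \<omega> j < \<infinity>"
  shows "\<exists>k. lebesgue_time n \<omega> k = lebesgue_time m \<omega> j"
  using fin
proof (induction j)
  case 0
  show ?case by (intro exI[of _ 0]) simp
next
  case (Suc j)
  note pm = lebesgue_partition[OF \<omega>, of m] and pn = lebesgue_partition[OF \<omega>, of n]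
  have less: "lebesgue_time m \<omega> j < lebesgue_time m \<omega> (Suc j)"
    using lebesgue_time_strict[OF \<omega>, of m j] Suc.prems by auto
  then obtain k where k: "lebesgue_time n \<omega> k = lebesgue_time m \<omega> j"
    using Suc.IH order.strict_trans[OF less Suc.prems] by auto
  obtain s where s: "lebesgue_time m \<omega> (Suc j) = ennreal s" "0 \<le> s"
    using Suc.prems by (cases "lebesgue_time m \<omega> (Suc j)") auto
  have hit: "\<omega> s \<in> dyadic m - {skeleton m \<omega> j}" using skeleton_dyadic[OF \<omega> Suc.prems] s by simp
  obtain l where l: "lebesgue_time n \<omega> l \<le> ennreal s" "ennreal s < lebesgue_time n \<omega> (Suc l)"
    using partition_index[OF pn s(2)] .
  have eq: "\<omega> s = skeleton n \<omega> l"
    using no_dyadic_hit[OF \<omega> s(2) l] hit dyadic_mono[OF mn] by auto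
  have "lebesgue_time n \<omega> l = ennreal s"
  proof (rule ccontr)
    assume "lebesgue_time n \<omega> l \<noteq> ennreal s"
    then have lt: "lebesgue_time n \<omega> l < ennreal s" using l by simp
    then obtain r where r: "lebesgue_time n \<omega> l = ennreal r" "0 \<le> r"
      by (cases "lebesgue_time n \<omega> l") auto
    have "k \<le> l"
    proof (rule ccontr)
      assume "\<not> k \<le> l"
      then have "lebesgue_time n \<omega> (Suc l) \<le> lebesgue_time n \<omega> k" by (intro partition_mono[OF pn]) auto
      then show False using l(2) less s(1) k by (metis leD less_le_trans order.strict_trans)
    qed
    then have "lebesgue_time m \<omega> j \<le> ennreal r" using partition_mono[OF pn, of k l] k r by simp
    then have "\<omega> r \<notin> dyadic m - {skeleton m \<omega> j}"
      using lt r s by (intro no_dyadic_hit[OF \<omega>]) auto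
    moreover have "\<omega> r = \<omega> s" using eq r by simp
    ultimately show False using hit by simp
  qed
  then show ?case using s by auto
qed

section \<open>Measurability at Lebesgue times\<close>

lemma paths_evaluation_measurable:
  assumes "0 \<le> s" "ennreal s \<le> t"
  shows "(\<lambda>\<omega>. \<omega> s) \<in> borel_measurable (path_filtration t)"
proof (rule measurableI)
  fix B :: "real set" assume B: "B \<in> sets borel"
  have sub: "{{\<omega> \<in> paths. \<omega> s \<in> B} | s B. 0 \<le> s \<and> ennreal s \<le> t \<and> B \<in> sets borel} \<subseteq> Pow paths"
    by auto
  have "{\<omega> \<in> paths. \<omega> s \<in> B} \<in> sets (path_filtration t)"
    unfolding path_filtration_def sets_measure_of[OF sub]
    using assms B by (intro sigma_sets.Basic) blast
  then show "(\<lambda>\<omega>. \<omega> s) -` B \<inter> space (path_filtration t) \<in> sets (path_filtration t)"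
    by (simp add: path_filtration.space_F vimage_def Int_def conj_commute)
qed simp

text \<open>
  Approximate the random time from below by dyadic times and use the continuity of the paths.
\<close>

lemma value_at_random_time_measurable:
  assumes \<sigma>[measurable]: "\<sigma> \<in> borel_measurable (path_filtration t)"
    and bounds: "\<And>\<omega>. \<omega> \<in> paths \<Longrightarrow> 0 \<le> \<sigma> \<omega>" "\<And>\<omega>. \<omega> \<in> paths \<Longrightarrow> ennreal (\<sigma> \<omega>) \<le> t"
  shows "(\<lambda>\<omega>. \<omega> (\<sigma> \<omega>)) \<in> borel_measurable (path_filtration t)"
proof -
  define g where "g n \<omega> = nat \<lfloor>\<sigma> \<omega> * 2 ^ n\<rfloor>" for n :: nat and \<omega>
  define f where "f n i \<omega> = (if ennreal (real i / 2 ^ n) \<le> t then \<omega> (real i / 2 ^ n) else 0)"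
      for n i :: nat and \<omega> :: path
  have g[measurable]: "g n \<in> measurable (path_filtration t) (count_space UNIV)" for n
    unfolding g_def by measurable
  have f: "f n i \<in> borel_measurable (path_filtration t)" for n i
    unfolding f_def by (cases "ennreal (real i / 2 ^ n) \<le> t") (auto intro: paths_evaluation_measurable)
  have "(\<lambda>\<omega>. f n (g n \<omega>) \<omega>) \<in> borel_measurable (path_filtration t)" for n
    by (rule measurable_compose_countable[OF f g])
  then show ?thesis
  proof (rule borel_measurable_LIMSEQ_real[rotated])
    fix \<omega> assume "\<omega> \<in> space (path_filtration t)"
    then have \<omega>: "\<omega> \<in> paths" by (simp add: path_filtration.space_F)
    have gr: "real (g n \<omega>) / 2 ^ n \<le> \<sigma> \<omega>" "\<sigma> \<omega> - (1/2) ^ n \<le> real (g n \<omega>) / 2 ^ n" for n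
    proof -
      have nn: "0 \<le> \<sigma> \<omega> * 2 ^ n" using bounds(1)[OF \<omega>] by simp
      have "real (g n \<omega>) \<le> \<sigma> \<omega> * 2 ^ n" "\<sigma> \<omega> * 2 ^ n - 1 \<le> real (g n \<omega>)"
        unfolding g_def using nn by linarith+
      then show "real (g n \<omega>) / 2 ^ n \<le> \<sigma> \<omega>" "\<sigma> \<omega> - (1/2) ^ n \<le> real (g n \<omega>) / 2 ^ n"
        by (simp_all add: power_one_over pos_divide_le_eq pos_le_divide_eq left_diff_distrib)
    qed
    have eq: "f n (g n \<omega>) \<omega> = \<omega> (real (g n \<omega>) / 2 ^ n)" for n
      using order_trans[OF ennreal_leI[OF gr(1)] bounds(2)[OF \<omega>]] by (simp add: f_def)
    have lim: "(\<lambda>n. real (g n \<omega>) / 2 ^ n) \<longlonglongrightarrow> \<sigma> \<omega>"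
    proof (rule tendsto_sandwich[of "\<lambda>n. \<sigma> \<omega> - (1/2) ^ n" _ _ "\<lambda>_. \<sigma> \<omega>"])
      show "(\<lambda>n. \<sigma> \<omega> - (1/2) ^ n) \<longlonglongrightarrow> \<sigma> \<omega>"
        using tendsto_diff[OF tendsto_const LIMSEQ_power_zero[of "1/2::real"]] by simp
    qed (use gr in auto)
    have cont: "continuous_on {0..} \<omega>" using \<omega> by (simp add: paths_def)
    show "(\<lambda>n. f n (g n \<omega>) \<omega>) \<longlonglongrightarrow> \<omega> (\<sigma> \<omega>)"
      unfolding eq using bounds(1)[OF \<omega>]
      by (intro continuous_on_tendsto_compose[OF cont lim]) auto
  qed
qed

lemma stopping_time_min_measurable:
  assumes "stopping_time path_filtration \<tau>"
  shows "(\<lambda>\<omega>. min (\<tau> \<omega>) t) \<in> borel_measurable (path_filtration t)"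
proof (rule borel_measurableI_le)
  fix a
  show "{\<omega> \<in> space (path_filtration t). min (\<tau> \<omega>) t \<le> a} \<in> sets (path_filtration t)"
  proof (cases "t \<le> a")
    case True
    then have "{\<omega> \<in> space (path_filtration t). min (\<tau> \<omega>) t \<le> a} = space (path_filtration t)"
      by (auto simp: min_le_iff_disj)
    then show ?thesis by simp
  next
    case False
    then have "{\<omega> \<in> space (path_filtration t). min (\<tau> \<omega>) t \<le> a} = {\<omega> \<in> space (path_filtration t). \<tau> \<omega> \<le> a}"
      by (auto simp: min_le_iff_disj)
    then show ?thesis using path_filtration.stopping_time_le_const[OF assms, of a t] False
      by (simp add: pred_def)
  qed
qed

lemma value_at_min_measurable:
  assumes "stopping_time path_filtration \<tau>"
  shows "(\<lambda>\<omega>. \<omega> (enn2real (min (\<tau> \<omega>) t))) \<in> borel_measurable (path_filtration t)"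
proof (rule value_at_random_time_measurable)
  show "(\<lambda>\<omega>. enn2real (min (\<tau> \<omega>) t)) \<in> borel_measurable (path_filtration t)"
    using stopping_time_min_measurable[OF assms, of t] by measurable
  show "ennreal (enn2real (min (\<tau> \<omega>) t)) \<le> t" for \<omega>
    by (auto simp: ennreal_enn2real_if)
qed simp

lemma value_at_stopping_time_measurable:
  assumes "stopping_time path_filtration \<tau>"
  shows "(\<lambda>\<omega>. \<omega> (enn2real (\<tau> \<omega>))) \<in> borel_measurable (path_filtration.pre_sigma \<tau>)"
proof (rule measurableI)
  fix B :: "real set" assume B: "B \<in> sets borel"
  show "(\<lambda>\<omega>. \<omega> (enn2real (\<tau> \<omega>))) -` B \<inter> space (path_filtration.pre_sigma \<tau>)
      \<in> sets (path_filtration.pre_sigma \<tau>)"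
  proof (rule path_filtration.sets_pre_sigmaI[OF assms])
    fix t
    have "{\<omega> \<in> (\<lambda>\<omega>. \<omega> (enn2real (\<tau> \<omega>))) -` B \<inter> space (path_filtration.pre_sigma \<tau>). \<tau> \<omega> \<le> t} =
      {\<omega> \<in> space (path_filtration t). \<tau> \<omega> \<le> t} \<inter> ((\<lambda>\<omega>. \<omega> (enn2real (min (\<tau> \<omega>) t))) -` B
          \<inter> space (path_filtration t))"
      by (auto simp: path_filtration.space_F path_filtration.space_pre_sigma min_absorb1)
    also have "\<dots> \<in> sets (path_filtration t)"
      using stopping_timeD[OF assms, of t] measurable_sets[OF value_at_min_measurable[OF assms] B]
      by (auto simp: pred_def)
    finally show "{\<omega> \<in> (\<lambda>\<omega>. \<omega> (enn2real (\<tau> \<omega>))) -` B \<inter> space (path_filtration.pre_sigma \<tau>). \<tau> \<omega> \<le> t}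
       \<in> sets (path_filtration t)" .
  qed
qed simp

text \<open>
  Whether a level is hit during a compact time interval is decided by countably many times. This is
  why hitting times of grid points are stopping times without any completion or right-continuity of
  the filtration.
\<close>

lemma hits_level_iff:
  assumes \<omega>: "\<omega> \<in> paths" and r: "0 \<le> \<rho>" "\<rho> \<le> r"
  shows "(\<exists>s\<in>{\<rho>..r}. \<omega> s = d) \<longleftrightarrow> (\<forall>j::nat. \<exists>p\<in>\<rat> \<inter> {0..}. \<bar>\<omega> (min r (\<rho> + p)) - d\<bar> < 1 / Suc j)"
proof
  assume "\<exists>s\<in>{\<rho>..r}. \<omega> s = d"
  then obtain s where s: "\<rho> \<le> s" "s \<le> r" "\<omega> s = d" by auto
  show "\<forall>j::nat. \<exists>p\<in>\<rat> \<inter> {0..}. \<bar>\<omega> (min r (\<rho> + p)) - d\<bar> < 1 / Suc j"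
  proof
    fix j :: nat
    have "continuous_on {\<rho>..r} \<omega>" by (rule paths_continuous[OF \<omega> r(1)])
    then obtain \<delta> where \<delta>: "0 < \<delta>" "\<And>x. x \<in> {\<rho>..r} \<Longrightarrow> dist x s < \<delta> \<Longrightarrow> dist (\<omega> x) (\<omega> s) < 1 / Suc j"
      unfolding continuous_on_iff using s
        by (metis atLeastAtMost_iff of_nat_0_less_iff zero_less_Suc zero_less_divide_1_iff)
    obtain p where p: "p \<in> \<rat>" "s - \<rho> < p" "p < s - \<rho> + \<delta>"
      using Rats_dense_in_real[of "s - \<rho>" "s - \<rho> + \<delta>"] \<delta>(1) by auto
    have "\<bar>\<omega> (min r (\<rho> + p)) - d\<bar> < 1 / Suc j"
      using \<delta>(2)[of "min r (\<rho> + p)"] p s r by (auto simp: dist_real_def)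
    then show "\<exists>p\<in>\<rat> \<inter> {0..}. \<bar>\<omega> (min r (\<rho> + p)) - d\<bar> < 1 / Suc j" using p s by (intro bexI[of _ p]) auto
  qed
next
  assume *: "\<forall>j::nat. \<exists>p\<in>\<rat> \<inter> {0..}. \<bar>\<omega> (min r (\<rho> + p)) - d\<bar> < 1 / Suc j"
  have "continuous_on {\<rho>..r} (\<lambda>s. \<bar>\<omega> s - d\<bar>)"
    by (intro continuous_intros paths_continuous[OF \<omega> r(1)])
  then obtain s where s: "s \<in> {\<rho>..r}" "\<And>x. x \<in> {\<rho>..r} \<Longrightarrow> \<bar>\<omega> s - d\<bar> \<le> \<bar>\<omega> x - d\<bar>"
    using continuous_attains_inf[OF compact_Icc, of \<rho> r "\<lambda>s. \<bar>\<omega> s - d\<bar>"] r by auto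
  have "\<bar>\<omega> s - d\<bar> \<le> 0"
  proof (rule ccontr)
    assume "\<not> ?thesis"
    then obtain j :: nat where j: "1 / Suc j < \<bar>\<omega> s - d\<bar>" using reals_Archimedean[of "\<bar>\<omega> s - d\<bar>"]
      by (auto simp: inverse_eq_divide)
    obtain p where "p \<in> \<rat> \<inter> {0..}" "\<bar>\<omega> (min r (\<rho> + p)) - d\<bar> < 1 / Suc j" using * by blast
    then show False using j s(2)[of "min r (\<rho> + p)"] r by auto
  qed
  then show "\<exists>s\<in>{\<rho>..r}. \<omega> s = d" using s(1) by (intro bexI[of _ s]) auto
qed

lemma countable_dyadic: "countable (dyadic n)"
proof -
  have "dyadic n = range (\<lambda>k::int. of_int k / 2 ^ n)" by (auto simp: dyadic_def)
  then show ?thesis by simp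
qed

lemma lebesgue_time_Suc_le_iff:
  assumes \<omega>: "\<omega> \<in> paths" and r: "0 \<le> r" and \<rho>: "\<rho> = enn2real (min (lebesgue_time n \<omega> k) (ennreal r))"
  shows "lebesgue_time n \<omega> (Suc k) \<le> ennreal r \<longleftrightarrow>
    lebesgue_time n \<omega> k \<le> ennreal r \<and> (\<exists>d\<in>dyadic n. d \<noteq> \<omega> \<rho> \<and> (\<exists>s\<in>{\<rho>..r}. \<omega> s = d))"
proof (cases "lebesgue_time n \<omega> k \<le> ennreal r")
  case True
  then have fin: "lebesgue_time n \<omega> k < \<infinity>" by (simp add: le_less_trans)
  have \<rho>': "lebesgue_time n \<omega> k = ennreal \<rho>" "0 \<le> \<rho>" using True fin by (simp_all add: \<rho> min_absorb1)
  have "\<rho> \<le> r" using True \<rho>' r by simp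
  show ?thesis
  proof (rule lebesgue_time_Suc_cases[OF \<omega> \<rho>'], goal_cases)
    case 1
    then show ?thesis using True by (auto simp: top_unique)
  next
    case (2 s)
    have "(\<exists>d\<in>dyadic n. d \<noteq> \<omega> \<rho> \<and> (\<exists>s\<in>{\<rho>..r}. \<omega> s = d)) \<longleftrightarrow> s \<le> r"
    proof
      assume "\<exists>d\<in>dyadic n. d \<noteq> \<omega> \<rho> \<and> (\<exists>s\<in>{\<rho>..r}. \<omega> s = d)"
      then obtain s' where s': "\<omega> s' \<in> dyadic n - {\<omega> \<rho>}" "\<rho> \<le> s'" "s' \<le> r" by auto
      then have "s \<le> s'" using 2(4)[of s'] by (cases "s' < s") auto
      then show "s \<le> r" using s' by simp
    next
      assume "s \<le> r"
      then show "\<exists>d\<in>dyadic n. d \<noteq> \<omega> \<rho> \<and> (\<exists>s\<in>{\<rho>..r}. \<omega> s = d)"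
        using 2(1,3) by (intro bexI[of _ "\<omega> s"] conjI bexI[of _ s]) auto
    qed
    then show ?thesis using 2 True r by simp
  qed
next
  case False
  then show ?thesis using lebesgue_time_strict[OF \<omega>, of n k] by auto
qed

text \<open>
  The event that the next Lebesgue time has come by time \<open>t\<close> is a countable union over the grid
  points that may have been hit since the previous one.
\<close>

lemma lebesgue_time_stopping: "stopping_time path_filtration (\<lambda>\<omega>. lebesgue_time n \<omega> k)"
proof (induction k)
  case 0
  show ?case by (simp add: stopping_time_const)
next
  case (Suc k)
  show ?case
  proof
    fix t
    show "Measurable.pred (path_filtration t) (\<lambda>\<omega>. lebesgue_time n \<omega> (Suc k) \<le> t)"
    proof (cases t)
      case (real r)
      define \<rho> where "\<rho> \<omega> = enn2real (min (lebesgue_time n \<omega> k) t)" for \<omega>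
      have \<rho>_le: "0 \<le> \<rho> \<omega>" "\<rho> \<omega> \<le> r" for \<omega>
        using real by (auto simp: \<rho>_def intro!: enn2real_leI)
      have \<rho>_meas[measurable]: "\<rho> \<in> borel_measurable (path_filtration t)"
        unfolding \<rho>_def using stopping_time_min_measurable[OF Suc, of t] by measurable
      have v[measurable]: "(\<lambda>\<omega>. \<omega> (min r (\<rho> \<omega> + p))) \<in> borel_measurable (path_filtration t)" if "0 \<le> p" for p
      proof -
        have "(\<lambda>\<omega>. min r (\<rho> \<omega> + p)) \<in> borel_measurable (path_filtration t)" by measurable
        then show ?thesis
          using \<rho>_le real that by (intro value_at_random_time_measurable) (auto intro!: ennreal_leI)
      qed
      have v0[measurable]: "(\<lambda>\<omega>. \<omega> (\<rho> \<omega>)) \<in> borel_measurable (path_filtration t)"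
        using \<rho>_le real by (intro value_at_random_time_measurable \<rho>_meas) (auto intro!: ennreal_leI)
      have [measurable]: "Measurable.pred (path_filtration t) (\<lambda>\<omega>. lebesgue_time n \<omega> k \<le> t)"
        by (rule stopping_timeD[OF Suc])
      have "Measurable.pred (path_filtration t) (\<lambda>\<omega>. lebesgue_time n \<omega> k \<le> t \<and>
        (\<exists>d\<in>dyadic n. d \<noteq> \<omega> (\<rho> \<omega>) \<and> (\<forall>j::nat. \<exists>p\<in>\<rat> \<inter> {0..}. \<bar>\<omega> (min r (\<rho> \<omega> + p)) - d\<bar> < 1 / Suc j)))"
        by (intro pred_intros_logic measurable_pred_countable pred_intros_countable(1) countable_dyadic
            countable_Int1 countable_rat)
          measurable
      moreover have "lebesgue_time n \<omega> (Suc k) \<le> t \<longleftrightarrow> lebesgue_time n \<omega> k \<le> t \<and>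
        (\<exists>d\<in>dyadic n. d \<noteq> \<omega> (\<rho> \<omega>) \<and> (\<forall>j::nat. \<exists>p\<in>\<rat> \<inter> {0..}. \<bar>\<omega> (min r (\<rho> \<omega> + p)) - d\<bar> < 1 / Suc j))"
        if "\<omega> \<in> paths" for \<omega>
        using lebesgue_time_Suc_le_iff[OF that, of r "\<rho> \<omega>" n k] hits_level_iff[OF that \<rho>_le[of \<omega>]] real
        by (simp add: \<rho>_def)
      ultimately show ?thesis
        by (subst measurable_cong) (auto simp: path_filtration.space_F)
    qed simp
  qed
qed

text \<open>
  A position that was chosen at a coarse trading time may be used at a later fine one.
\<close>

lemma pre_sigma_after:
  assumes \<sigma>: "stopping_time path_filtration \<sigma>" and \<rho>: "stopping_time path_filtration \<rho>"
    and A: "A \<in> sets (path_filtration.pre_sigma \<sigma>)"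
  shows "{\<omega> \<in> A. \<sigma> \<omega> \<le> \<rho> \<omega>} \<in> sets (path_filtration.pre_sigma \<rho>)"
proof (rule path_filtration.sets_pre_sigmaI[OF \<rho>])
  fix t
  have sub: "A \<subseteq> paths" using sets.sets_into_space[OF A] by (simp add: path_filtration.space_pre_sigma)
  have [measurable]: "(\<lambda>\<omega>. min (\<sigma> \<omega>) t) \<in> borel_measurable (path_filtration t)"
    "(\<lambda>\<omega>. min (\<rho> \<omega>) t) \<in> borel_measurable (path_filtration t)"
    using stopping_time_min_measurable \<sigma> \<rho> by blast+
  have "{\<omega> \<in> {\<omega> \<in> A. \<sigma> \<omega> \<le> \<rho> \<omega>}. \<rho> \<omega> \<le> t} = {\<omega> \<in> A. \<sigma> \<omega> \<le> t} \<inter> {\<omega> \<in> space (path_filtration t). \<rho> \<omega> \<le> t}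
     \<inter> {\<omega> \<in> space (path_filtration t). min (\<sigma> \<omega>) t \<le> min (\<rho> \<omega>) t}"
    using sub by (auto simp: path_filtration.space_F min_def)
  also have "\<dots> \<in> sets (path_filtration t)"
  proof (intro sets.Int)
    show "{\<omega> \<in> A. \<sigma> \<omega> \<le> t} \<in> sets (path_filtration t)"
      by (rule path_filtration.sets_pre_sigmaD[OF \<sigma> A])
    show "{\<omega> \<in> space (path_filtration t). \<rho> \<omega> \<le> t} \<in> sets (path_filtration t)"
      using stopping_timeD[OF \<rho>, of t] by (simp add: pred_def)
    show "{\<omega> \<in> space (path_filtration t). min (\<sigma> \<omega>) t \<le> min (\<rho> \<omega>) t} \<in> sets (path_filtration t)"
      by (rule borel_measurable_le) measurable
  qed
  finally show "{\<omega> \<in> {\<omega> \<in> A. \<sigma> \<omega> \<le> \<rho> \<omega>}. \<rho> \<omega> \<le> t} \<in> sets (path_filtration t)" .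
qed

text \<open>
  Together with \<open>path_integral_refine\<close> this lets strategies on different partitions be moved to a
  common one.
\<close>

lemma active_position_measurable:
  assumes \<sigma>: "\<And>j. stopping_time path_filtration (\<sigma> j)" and \<rho>: "stopping_time path_filtration \<rho>"
    and P: "\<And>j. P j \<in> borel_measurable (path_filtration.pre_sigma (\<sigma> j))"
  shows "(\<lambda>\<omega>. active_position (\<lambda>j. \<sigma> j \<omega>) (\<lambda>j. P j \<omega>) (\<rho> \<omega>)) \<in> borel_measurable (path_filtration.pre_sigma \<rho>)"
proof -
  have started: "(\<lambda>\<omega>. if \<sigma> j \<omega> \<le> \<rho> \<omega> then P j \<omega> else 0) \<in> borel_measurable (path_filtration.pre_sigma \<rho>)" for j
  proof (rule measurableI)
    fix B :: "real set" assume B: "B \<in> sets borel"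
    let ?G = "path_filtration.pre_sigma \<rho>"
    have S: "space (path_filtration.pre_sigma (\<sigma> j)) \<in> sets (path_filtration.pre_sigma (\<sigma> j))"
      by (rule sets.top)
    have 1: "{\<omega> \<in> paths. \<sigma> j \<omega> \<le> \<rho> \<omega>} \<in> sets ?G"
      using pre_sigma_after[OF \<sigma> \<rho> S] by (simp add: path_filtration.space_pre_sigma)
    have 2: "{\<omega> \<in> P j -` B \<inter> space (path_filtration.pre_sigma (\<sigma> j)). \<sigma> j \<omega> \<le> \<rho> \<omega>} \<in> sets ?G"
      by (rule pre_sigma_after[OF \<sigma> \<rho> measurable_sets[OF P B]])
    have "(\<lambda>\<omega>. if \<sigma> j \<omega> \<le> \<rho> \<omega> then P j \<omega> else 0) -` B \<inter> space ?G =
      {\<omega> \<in> P j -` B \<inter> space (path_filtration.pre_sigma (\<sigma> j)). \<sigma> j \<omega> \<le> \<rho> \<omega>} \<union>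
      (if 0 \<in> B then space ?G - {\<omega> \<in> paths. \<sigma> j \<omega> \<le> \<rho> \<omega>} else {})"
      by (auto simp: path_filtration.space_pre_sigma split: if_splits)
    also have "\<dots> \<in> sets ?G" using 1 2 by auto
    finally show "(\<lambda>\<omega>. if \<sigma> j \<omega> \<le> \<rho> \<omega> then P j \<omega> else 0) -` B \<inter> space ?G \<in> sets ?G" .
  qed simp
  have [measurable]: "Measurable.pred (path_filtration.pre_sigma \<rho>) (\<lambda>\<omega>. \<rho> \<omega> < \<sigma> j \<omega>)" for j
    by (rule path_filtration.stopping_time_less[OF \<rho> \<sigma>])
  have "(\<lambda>\<omega>. (if \<sigma> j \<omega> \<le> \<rho> \<omega> then P j \<omega> else 0) * (if \<rho> \<omega> < \<sigma> (Suc j) \<omega> then 1 else 0))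
    \<in> borel_measurable (path_filtration.pre_sigma \<rho>)" for j
    using started[of j] by measurable
  also have "(\<lambda>\<omega>. (if \<sigma> j \<omega> \<le> \<rho> \<omega> then P j \<omega> else 0) * (if \<rho> \<omega> < \<sigma> (Suc j) \<omega> then 1 else 0)) =
     (\<lambda>\<omega>. P j \<omega> * indicator {\<sigma> j \<omega>..<\<sigma> (Suc j) \<omega>} (\<rho> \<omega>))" for j
    by (auto simp: indicator_def)
  finally show ?thesis unfolding active_position_def by measurable
qed

lemma known_later:
  fixes f :: "path \<Rightarrow> 'a::topological_space"
  assumes f: "f \<in> borel_measurable (path_filtration.pre_sigma (\<lambda>\<omega>. lebesgue_time n \<omega> j))" and "j \<le> k"
  shows "f \<in> borel_measurable (path_filtration.pre_sigma (\<lambda>\<omega>. lebesgue_time n \<omega> k))"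
proof -
  have "sets (path_filtration.pre_sigma (\<lambda>\<omega>. lebesgue_time n \<omega> j))
      \<subseteq> sets (path_filtration.pre_sigma (\<lambda>\<omega>. lebesgue_time n \<omega> k))"
    by (intro path_filtration.mono_pre_sigma lebesgue_time_stopping partition_mono[OF lebesgue_partition]
        assms(2))
  with measurable_sets[OF f] show ?thesis
    by (intro measurableI) (auto simp: path_filtration.space_pre_sigma)
qed

lemma skeleton_measurable:
  "j \<le> k \<Longrightarrow> (\<lambda>\<omega>. skeleton n \<omega> j) \<in> borel_measurable (path_filtration.pre_sigma (\<lambda>\<omega>. lebesgue_time n \<omega> k))"
  by (rule known_later[OF value_at_stopping_time_measurable[OF lebesgue_time_stopping]])

section \<open>Null sets from strategies on all levels\<close>

definition dyadic_integral :: "nat \<Rightarrow> (nat \<Rightarrow> path \<Rightarrow> real) \<Rightarrow> real \<Rightarrow> path \<Rightarrow> real" where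
  "dyadic_integral n P = simple_integral (\<lambda>k \<omega>. lebesgue_time n \<omega> k) P"

text \<open>
  A simple strategy with the Lebesgue times of level \<open>n\<close> as trading times. The bound is uniform in
  \<open>k\<close>, so that it survives the passage to a finer partition, where the index of the active position
  is random.
\<close>

definition dyadic_strategy :: "nat \<Rightarrow> (nat \<Rightarrow> path \<Rightarrow> real) \<Rightarrow> bool" where
  "dyadic_strategy n P \<longleftrightarrow>
     (\<forall>k. P k \<in> borel_measurable (path_filtration.pre_sigma (\<lambda>\<omega>. lebesgue_time n \<omega> k))) \<and>
     (\<exists>B. \<forall>k. \<forall>\<omega>\<in>paths. \<bar>P k \<omega>\<bar> \<le> B)"

lemma dyadic_integral_eq:
  "dyadic_integral n P t \<omega> = path_integral (lebesgue_time n \<omega>) (\<lambda>k. P k \<omega>) \<omega> t"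
  by (simp add: dyadic_integral_def simple_integral_eq)

definition refined_position :: "nat \<Rightarrow> (nat \<Rightarrow> path \<Rightarrow> real) \<Rightarrow> nat \<Rightarrow> nat \<Rightarrow> path \<Rightarrow> real" where
  "refined_position m P n k \<omega> = active_position (lebesgue_time m \<omega>) (\<lambda>j. P j \<omega>) (lebesgue_time n \<omega> k)"

lemma dyadic_strategy_refined:
  assumes "dyadic_strategy m P"
  shows "dyadic_strategy n (refined_position m P n)"
proof -
  obtain B where "\<And>k \<omega>. \<omega> \<in> paths \<Longrightarrow> \<bar>P k \<omega>\<bar> \<le> B" using assms unfolding dyadic_strategy_def by blast
  then have "\<bar>refined_position m P n k \<omega>\<bar> \<le> B" if "\<omega> \<in> paths" for k \<omega>
    unfolding refined_position_def using that
    by (intro active_position_bound[OF lebesgue_partition]) auto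
  moreover have "refined_position m P n k \<in> borel_measurable (path_filtration.pre_sigma (\<lambda>\<omega>. lebesgue_time n \<omega>
      k))" for k
    unfolding refined_position_def using assms unfolding dyadic_strategy_def
    by (intro active_position_measurable lebesgue_time_stopping) auto
  ultimately show ?thesis unfolding dyadic_strategy_def by blast
qed

lemma dyadic_integral_refined:
  assumes "\<omega> \<in> paths" "m \<le> n" "0 \<le> t"
  shows "dyadic_integral n (refined_position m P n) t \<omega> = dyadic_integral m P t \<omega>"
  unfolding dyadic_integral_eq refined_position_def
  by (rule path_integral_refine[OF lebesgue_partition[OF assms(1)] lebesgue_partition[OF assms(1)]
      lebesgue_times_nested[OF assms(1,2)] assms(3)])

lemma dyadic_strategy_sum:
  assumes "\<And>i. i \<in> I \<Longrightarrow> dyadic_strategy n (P i)"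
  shows "dyadic_strategy n (\<lambda>k \<omega>. \<Sum>i\<in>I. P i k \<omega>)"
proof (cases "finite I")
  case fin: True
  have "\<exists>B. \<forall>k. \<forall>\<omega>\<in>paths. \<bar>P i k \<omega>\<bar> \<le> B" if "i \<in> I" for i
    using assms[OF that] unfolding dyadic_strategy_def by blast
  then obtain B where "\<And>i k \<omega>. i \<in> I \<Longrightarrow> \<omega> \<in> paths \<Longrightarrow> \<bar>P i k \<omega>\<bar> \<le> B i" by metis
  then have "\<bar>\<Sum>i\<in>I. P i k \<omega>\<bar> \<le> (\<Sum>i\<in>I. B i)" if "\<omega> \<in> paths" for k \<omega>
    using that by (intro order_trans[OF sum_abs] sum_mono)
  then show ?thesis using assms fin unfolding dyadic_strategy_def by (auto intro!: borel_measurable_sum)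
next
  case False
  then show ?thesis unfolding dyadic_strategy_def by auto
qed

lemma dyadic_strategy_cmult:
  assumes "dyadic_strategy n P"
  shows "dyadic_strategy n (\<lambda>k \<omega>. c * P k \<omega>)"
proof -
  obtain B where B: "\<And>k \<omega>. \<omega> \<in> paths \<Longrightarrow> \<bar>P k \<omega>\<bar> \<le> B" using assms unfolding dyadic_strategy_def by blast
  have "\<bar>c * P k \<omega>\<bar> \<le> \<bar>c\<bar> * B" if "\<omega> \<in> paths" for k \<omega>
    using mult_left_mono[OF B[OF that], of "\<bar>c\<bar>"] by (simp add: abs_mult)
  then show ?thesis using assms unfolding dyadic_strategy_def by (auto intro!: borel_measurable_times)
qed

lemma dyadic_strategy_admissible:
  assumes P: "dyadic_strategy n P"
    and lb: "\<And>\<omega> t. \<omega> \<in> paths \<Longrightarrow> 0 \<le> t \<Longrightarrow> - c \<le> dyadic_integral n P t \<omega>"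
  shows "\<exists>H. admissible_strategy c H (\<lambda>k \<omega>. lebesgue_time n \<omega> k) P"
proof
  let ?\<tau> = "\<lambda>k \<omega>. lebesgue_time n \<omega> k"
  let ?H = "\<lambda>\<omega> t. \<Sum>k. P k \<omega> * indicator {?\<tau> k \<omega> <.. ?\<tau> (Suc k) \<omega>} (ennreal t)"
  have part: "time_partition (\<lambda>k. ?\<tau> k \<omega>)" if "\<omega> \<in> paths" for \<omega>
    by (rule lebesgue_partition[OF that])
  have "simple_strategy ?H ?\<tau> P"
    unfolding simple_strategy_def
    using part P lebesgue_time_stopping[of n] unfolding time_partition_def dyadic_strategy_def by blast
  then show "admissible_strategy c ?H ?\<tau> P"
    unfolding admissible_strategy_def using lb by (auto simp: dyadic_integral_def)
qed

definition superhedges :: "real \<Rightarrow> path set \<Rightarrow> bool" where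
  "superhedges c A \<longleftrightarrow> (\<exists>H \<tau> F. (\<forall>n::nat. admissible_strategy c (H n) (\<tau> n) (F n)) \<and>
     (\<forall>\<omega>\<in>paths. indicator A \<omega> \<le>
        Liminf at_top (\<lambda>t::real. liminf (\<lambda>n. ereal (c + simple_integral (\<tau> n) (F n) t \<omega>)))))"

lemma outer_price_eq: "outer_price A = Inf {c. 0 < c \<and> superhedges c A}"
  unfolding outer_price_def superhedges_def by simp

lemma superhedges_one: "superhedges 1 A"
proof -
  have zero: "dyadic_strategy 0 (\<lambda>_ _. 0)" by (auto simp: dyadic_strategy_def)
  have int: "simple_integral (\<lambda>k \<omega>. lebesgue_time 0 \<omega> k) (\<lambda>_ _. 0) t \<omega> = 0" for t \<omega>
    by (simp add: simple_integral_def)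
  obtain H where H: "admissible_strategy 1 H (\<lambda>k \<omega>. lebesgue_time 0 \<omega> k) (\<lambda>_ _. 0)"
    using dyadic_strategy_admissible[OF zero, of 1] int by (auto simp: dyadic_integral_def)
  show ?thesis
    unfolding superhedges_def
    by (rule exI[of _ "\<lambda>_. H"], rule exI[of _ "\<lambda>_ k \<omega>. lebesgue_time 0 \<omega> k"], rule exI[of _ "\<lambda>_ _ _. 0"])
       (auto simp: H int indicator_def Liminf_const)
qed

lemma outer_price_zero_iff: "outer_price A = 0 \<longleftrightarrow> (\<forall>\<epsilon>>0. \<exists>c>0. c \<le> \<epsilon> \<and> superhedges c A)"
proof
  assume *: "outer_price A = 0"
  have ne: "{c. 0 < c \<and> superhedges c A} \<noteq> {}" using superhedges_one[of A] zero_less_one by blast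
  show "\<forall>\<epsilon>>0. \<exists>c>0. c \<le> \<epsilon> \<and> superhedges c A"
    using cInf_lessD[OF ne] * unfolding outer_price_eq by (fastforce intro: less_imp_le)
next
  assume *: "\<forall>\<epsilon>>0. \<exists>c>0. c \<le> \<epsilon> \<and> superhedges c A"
  have ne: "{c. 0 < c \<and> superhedges c A} \<noteq> {}" using superhedges_one[of A] zero_less_one by blast
  show "outer_price A = 0"
    unfolding outer_price_eq
  proof (rule antisym[OF field_le_epsilon])
    fix \<epsilon> :: real assume "0 < \<epsilon>"
    then obtain c where "0 < c" "c \<le> \<epsilon>" "superhedges c A" using * by blast
    then have "Inf {c. 0 < c \<and> superhedges c A} \<le> c"
      by (intro cInf_lower bdd_belowI[of _ 0]) auto
    then show "Inf {c. 0 < c \<and> superhedges c A} \<le> 0 + \<epsilon>" using \<open>c \<le> \<epsilon>\<close> by simp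
  next
    show "0 \<le> Inf {c. 0 < c \<and> superhedges c A}" using ne by (intro cInf_greatest) auto
  qed
qed

lemma superhedges_mono:
  assumes "A \<subseteq> B" "superhedges c B"
  shows "superhedges c A"
proof -
  have "(indicator A \<omega> :: ereal) \<le> indicator B \<omega>" for \<omega> using assms(1) by (auto simp: indicator_def)
  note ind = this
  from assms(2) obtain H \<tau> F where "\<forall>n::nat. admissible_strategy c (H n) (\<tau> n) (F n)"
    and "\<forall>\<omega>\<in>paths. indicator B \<omega> \<le>
        Liminf at_top (\<lambda>t::real. liminf (\<lambda>n. ereal (c + simple_integral (\<tau> n) (F n) t \<omega>)))"
    unfolding superhedges_def by blast
  then show ?thesis
    unfolding superhedges_def
    by (intro exI[of _ H] exI[of _ \<tau>] exI[of _ F] conjI ballI) (auto intro: order_trans[OF ind])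
qed

lemma outer_price_zero_mono: "A \<subseteq> B \<Longrightarrow> outer_price B = 0 \<Longrightarrow> outer_price A = 0"
  unfolding outer_price_zero_iff by (meson superhedges_mono)

text \<open>
  The Borel-Cantelli lemma. On level \<open>m\<close> a strategy risks the amount \<open>2\<^sup>-\<^sup>m\<close>, and on a path in \<open>A\<close>
  its final capital is at least \<open>1\<close> for arbitrarily large \<open>m\<close>. Adding the strategies of the levels
  \<open>m\<^sub>0, \<dots>, n\<close> on the partition of level \<open>n\<close> costs at most \<open>2 \<cdot> 2\<^sup>-\<^sup>m\<^sup>0\<close>, and the sequence in \<open>n\<close> of
  these sums hedges \<open>A\<close>.
\<close>

theorem null_set_borel_cantelli:
  assumes Q: "\<And>m. dyadic_strategy m (Q m)"
    and lb: "\<And>m \<omega> t. \<omega> \<in> paths \<Longrightarrow> 0 \<le> t \<Longrightarrow> - (1 / 2 ^ m) \<le> dyadic_integral m (Q m) t \<omega>"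
    and win: "\<And>\<omega> m\<^sub>0. \<omega> \<in> A \<Longrightarrow> \<omega> \<in> paths \<Longrightarrow> \<exists>m\<ge>m\<^sub>0. \<forall>\<^sub>F t in at_top. 1 \<le> 1 / 2 ^ m + dyadic_integral m (Q m) t \<omega>"
  shows "outer_price A = 0"
  unfolding outer_price_zero_iff
proof (intro allI impI)
  fix \<epsilon> :: real assume \<epsilon>: "0 < \<epsilon>"
  obtain m0 :: nat where m0: "(1 / 2) ^ m0 < \<epsilon> / 2" using real_arch_pow_inv[of "\<epsilon> / 2" "1/2"] \<epsilon> by auto
  \<comment> \<open>The geometric series over the levels from \<open>m0\<close> on sums to \<open>c\<close>.\<close>
  define c :: real where "c = 2 * (1 / 2) ^ m0"
  have c: "0 < c" "c \<le> \<epsilon>" using m0 by (simp_all add: c_def)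
  define P where "P n k \<omega> = (\<Sum>m\<in>{m0..n}. refined_position m (Q m) n k \<omega>)" for n k \<omega>
  have P: "dyadic_strategy n (P n)" for n
    unfolding P_def by (intro dyadic_strategy_sum dyadic_strategy_refined Q)
  have int: "dyadic_integral n (P n) t \<omega> = (\<Sum>m\<in>{m0..n}. dyadic_integral m (Q m) t \<omega>)"
    if "\<omega> \<in> paths" "0 \<le> t" for n t \<omega>
    unfolding P_def dyadic_integral_eq path_integral_sum[OF lebesgue_partition[OF that(1)] that(2)]
    by (rule sum.cong[OF refl], subst (1 2) dyadic_integral_eq[symmetric])
       (auto intro!: dyadic_integral_refined that)
  have geo: "(\<Sum>m\<in>{m0..n}. (1 / 2) ^ m) \<le> c" for n :: nat
    using sum_gp[of "1/2::real" m0 n] by (auto simp: c_def split: if_splits)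
  have cap: "c + dyadic_integral n (P n) t \<omega> =
    (c - (\<Sum>m\<in>{m0..n}. (1 / 2) ^ m)) + (\<Sum>m\<in>{m0..n}. (1 / 2) ^ m + dyadic_integral m (Q m) t \<omega>)"
    if "\<omega> \<in> paths" "0 \<le> t" for n t \<omega>
    by (simp add: int[OF that] sum.distrib)
  have term_nonneg: "0 \<le> (1 / 2) ^ m + dyadic_integral m (Q m) t \<omega>" if "\<omega> \<in> paths" "0 \<le> t" for m t \<omega>
    using lb[OF that, of m] by (simp add: power_one_over)
  have nonneg: "0 \<le> c + dyadic_integral n (P n) t \<omega>" if "\<omega> \<in> paths" "0 \<le> t" for n t \<omega>
  proof -
    have "0 \<le> (\<Sum>m\<in>{m0..n}. (1 / 2) ^ m + dyadic_integral m (Q m) t \<omega>)"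
      by (rule sum_nonneg) (rule term_nonneg[OF that])
    then show ?thesis unfolding cap[OF that] using geo[of n] by linarith
  qed
  have "\<exists>H. admissible_strategy c H (\<lambda>k \<omega>. lebesgue_time n \<omega> k) (P n)" for n
  proof (rule dyadic_strategy_admissible[OF P])
    show "- c \<le> dyadic_integral n (P n) t \<omega>" if "\<omega> \<in> paths" "0 \<le> t" for t \<omega>
      using nonneg[OF that, of n] by linarith
  qed
  then obtain H where H: "\<And>n. admissible_strategy c (H n) (\<lambda>k \<omega>. lebesgue_time n \<omega> k) (P n)" by metis
  have "indicator A \<omega> \<le> Liminf at_top (\<lambda>t. liminf (\<lambda>n. ereal (c +
      simple_integral (\<lambda>k \<omega>. lebesgue_time n \<omega> k) (P n) t \<omega>)))"
    if \<omega>: "\<omega> \<in> paths" for \<omega>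
  proof (cases "\<omega> \<in> A")
    case True
    obtain m where m: "m0 \<le> m" "\<forall>\<^sub>F t in at_top. 1 \<le> 1 / 2 ^ m + dyadic_integral m (Q m) t \<omega>"
      using win[OF True \<omega>] by blast
    have "\<forall>\<^sub>F t in at_top. 1 \<le> liminf (\<lambda>n. ereal (c + dyadic_integral n (P n) t \<omega>))"
      using m(2) eventually_ge_at_top[of 0]
    proof eventually_elim
      case (elim t)
      have "1 \<le> c + dyadic_integral n (P n) t \<omega>" if "m \<le> n" for n
      proof -
        have "1 \<le> (1 / 2) ^ m + dyadic_integral m (Q m) t \<omega>" using elim(1) by (simp add: power_one_over)
        also have "\<dots> \<le> (\<Sum>m\<in>{m0..n}. (1 / 2) ^ m + dyadic_integral m (Q m) t \<omega>)"
          using that m(1) term_nonneg[OF \<omega> elim(2)] by (intro member_le_sum) auto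
        finally show ?thesis unfolding cap[OF \<omega> elim(2)] using geo[of n] by simp
      qed
      then show ?case
        by (intro Liminf_bounded) (auto simp: eventually_sequentially one_ereal_def intro!: exI[of _ m])
    qed
    then have "1 \<le> Liminf at_top (\<lambda>t. liminf (\<lambda>n. ereal (c + dyadic_integral n (P n) t \<omega>)))"
      by (rule Liminf_bounded)
    then show ?thesis using True by (simp add: dyadic_integral_def)
  next
    case False
    have "\<forall>\<^sub>F t in at_top. 0 \<le> liminf (\<lambda>n. ereal (c + dyadic_integral n (P n) t \<omega>))"
      using eventually_ge_at_top[of 0]
    proof eventually_elim
      case (elim t)
      then show ?case
        using nonneg \<omega>
        by (intro Liminf_bounded) auto
    qed
    then have "0 \<le> Liminf at_top (\<lambda>t. liminf (\<lambda>n. ereal (c + dyadic_integral n (P n) t \<omega>)))"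
      by (rule Liminf_bounded)
    then show ?thesis using False by (simp add: dyadic_integral_def)
  qed
  then have "superhedges c A"
    unfolding superhedges_def
    by (intro exI[of _ H] exI[of _ "\<lambda>n k \<omega>. lebesgue_time n \<omega> k"] exI[of _ P] conjI) (auto simp: H)
  then show "\<exists>c>0. c \<le> \<epsilon> \<and> superhedges c A" using c by blast
qed

section \<open>Exponential bets on the passages of an edge\<close>

text \<open>
  The walk is at \<open>w\<close> and has just passed the edge from \<open>w + e h\<close> to \<open>w\<close>, where \<open>e\<close> is \<open>1\<close> or \<open>-1\<close>.
  Indices below \<open>2\<close> are excluded since \<open>x\<^sub>0\<close> need not be a grid point.
\<close>

definition edge_visit :: "nat \<Rightarrow> real \<Rightarrow> real \<Rightarrow> path \<Rightarrow> nat \<Rightarrow> bool" where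
  "edge_visit n w e \<omega> k \<longleftrightarrow> 2 \<le> k \<and> lebesgue_time n \<omega> k < \<infinity> \<and>
     skeleton n \<omega> k = w \<and> skeleton n \<omega> (k - 1) = w + e / 2 ^ n"

text \<open>
  The capital, starting from \<open>1\<close>, of the investor who holds the multiple \<open>s 2\<^sup>n\<^sup>/\<^sup>2\<close> of it during
  the step after every passage of the edge. Trading stops for good once \<open>64\<^sup>n\<close> is reached; so a
  success is never lost, and the positions are bounded. Here \<open>s = \<plusminus>1\<close> selects the direction of the
  bet.
\<close>

primrec capital :: "nat \<Rightarrow> real \<Rightarrow> real \<Rightarrow> real \<Rightarrow> path \<Rightarrow> nat \<Rightarrow> real" where
  "capital n w e s \<omega> 0 = 1"
| "capital n w e s \<omega> (Suc k) = capital n w e s \<omega> k +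
     (if edge_visit n w e \<omega> k \<and> capital n w e s \<omega> k < 64 ^ n then s * sqrt (2 ^ n) * capital n w e s \<omega> k else
         0) *
     (skeleton n \<omega> (Suc k) - skeleton n \<omega> k)"

definition bet :: "nat \<Rightarrow> real \<Rightarrow> real \<Rightarrow> real \<Rightarrow> nat \<Rightarrow> path \<Rightarrow> real" where
  "bet n w e s k \<omega> =
     (if edge_visit n w e \<omega> k \<and> capital n w e s \<omega> k < 64 ^ n then s * sqrt (2 ^ n) * capital n w e s \<omega> k else
         0)"

lemma capital_Suc:
  "capital n w e s \<omega> (Suc k) = capital n w e s \<omega> k + bet n w e s k \<omega> * (skeleton n \<omega> (Suc k) - skeleton n \<omega> k)"
  by (simp add: bet_def)

declare capital.simps(2) [simp del]

lemma capital_eq_sum: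
  "capital n w e s \<omega> k = 1 + (\<Sum>i<k. bet n w e s i \<omega> * (skeleton n \<omega> (Suc i) - skeleton n \<omega> i))"
  by (induction k) (simp_all add: capital_Suc)

lemma two_le_sqrt: "2 \<le> n \<Longrightarrow> 2 \<le> sqrt (2 ^ n)"
  using power_increasing[of 2 n "2::real"] by (intro real_le_rsqrt) simp

lemma sqrt_power_div: "sqrt (2 ^ n) / 2 ^ n = 1 / sqrt (2 ^ n :: real)"
  by (simp add: field_simps)

text \<open>
  A move of at most the mesh size changes the capital by at most half; so it stays positive between
  the trading times as well.
\<close>

lemma bet_move_bound:
  assumes "2 \<le> n" "\<bar>s\<bar> \<le> 1" "0 \<le> capital n w e s \<omega> k" "\<bar>y\<bar> \<le> 1 / 2 ^ n"
  shows "\<bar>bet n w e s k \<omega> * y\<bar> \<le> capital n w e s \<omega> k / 2"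
proof -
  have "\<bar>bet n w e s k \<omega>\<bar> \<le> \<bar>s\<bar> * (sqrt (2 ^ n) * capital n w e s \<omega> k)"
    using assms(3) by (simp add: bet_def abs_mult)
  also have "\<dots> \<le> 1 * (sqrt (2 ^ n) * capital n w e s \<omega> k)"
    using assms(2,3) by (intro mult_right_mono) auto
  finally have "\<bar>bet n w e s k \<omega> * y\<bar> \<le> (sqrt (2 ^ n) * capital n w e s \<omega> k) * (1 / 2 ^ n)"
    unfolding abs_mult using assms(3,4) by (intro mult_mono) auto
  also have "\<dots> = capital n w e s \<omega> k * (sqrt (2 ^ n) / 2 ^ n)" by simp
  also have "\<dots> = capital n w e s \<omega> k * (1 / sqrt (2 ^ n))" unfolding sqrt_power_div ..
  also have "\<dots> \<le> capital n w e s \<omega> k * (1 / 2)"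
    using two_le_sqrt[OF assms(1)] assms(3) by (intro mult_left_mono) (auto simp: field_simps)
  finally show ?thesis by simp
qed

lemma lebesgue_time_finite_mono:
  assumes "\<omega> \<in> paths" "lebesgue_time n \<omega> k < \<infinity>" "j \<le> k"
  shows "lebesgue_time n \<omega> j < \<infinity>"
  using partition_mono[OF lebesgue_partition[OF assms(1)] assms(3)] assms(2) by (rule le_less_trans)

lemma capital_pos:
  assumes "2 \<le> n" "\<bar>s\<bar> \<le> 1" "\<omega> \<in> paths" "lebesgue_time n \<omega> k < \<infinity>"
  shows "0 < capital n w e s \<omega> k"
  using assms(4)
proof (induction k)
  case (Suc k)
  then have pos: "0 < capital n w e s \<omega> k" using lebesgue_time_finite_mono[OF assms(3)] by simp
  then have "\<bar>bet n w e s k \<omega> * (skeleton n \<omega> (Suc k) - skeleton n \<omega> k)\<bar> \<le> capital n w e s \<omega> k / 2"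
    using skeleton_step_le[OF assms(3) Suc.prems] by (intro bet_move_bound assms) auto
  then show ?case using pos unfolding capital_Suc by linarith
qed simp

lemma bet_integral:
  assumes "\<omega> \<in> paths" "0 \<le> t" "lebesgue_time n \<omega> k \<le> ennreal t" "ennreal t \<le> lebesgue_time n \<omega> (Suc k)"
  shows "dyadic_integral n (bet n w e s) t \<omega> = capital n w e s \<omega> k - 1 +
      bet n w e s k \<omega> * (\<omega> t - skeleton n \<omega> k)"
  unfolding dyadic_integral_eq
  by (subst path_integral_local[OF lebesgue_partition[OF assms(1)] assms(2-4)]) (simp add: capital_eq_sum)

lemma bet_integral_ge:
  assumes "2 \<le> n" "\<bar>s\<bar> \<le> 1" "\<omega> \<in> paths" "0 \<le> t"
  shows "- 1 \<le> dyadic_integral n (bet n w e s) t \<omega>"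
proof -
  obtain k where k: "lebesgue_time n \<omega> k \<le> ennreal t" "ennreal t < lebesgue_time n \<omega> (Suc k)"
    using partition_index[OF lebesgue_partition[OF assms(3)] assms(4)] .
  have pos: "0 < capital n w e s \<omega> k" using k(1) by (intro capital_pos assms) (simp add: le_less_trans)
  then have "\<bar>bet n w e s k \<omega> * (\<omega> t - skeleton n \<omega> k)\<bar> \<le> capital n w e s \<omega> k / 2"
    using k by (intro bet_move_bound assms oscillation_le_mesh) auto
  then show ?thesis using pos k assms by (subst bet_integral[of _ _ _ k]) auto
qed

lemma capital_frozen:
  assumes "64 ^ n \<le> capital n w e s \<omega> k" "k \<le> j"
  shows "capital n w e s \<omega> j = capital n w e s \<omega> k"
  using assms(2,1) by (induction j rule: dec_induct) (auto simp: capital_Suc bet_def)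

lemma bet_integral_frozen:
  assumes "\<omega> \<in> paths" "lebesgue_time n \<omega> k \<le> ennreal t" "64 ^ n \<le> capital n w e s \<omega> k" "0 \<le> t"
  shows "dyadic_integral n (bet n w e s) t \<omega> = capital n w e s \<omega> k - 1"
proof -
  obtain j where j: "lebesgue_time n \<omega> j \<le> ennreal t" "ennreal t < lebesgue_time n \<omega> (Suc j)"
    using partition_index[OF lebesgue_partition[OF assms(1)] assms(4)] .
  have "k \<le> j"
  proof (rule ccontr)
    assume "\<not> k \<le> j"
    then have "lebesgue_time n \<omega> (Suc j) \<le> lebesgue_time n \<omega> k"
      by (intro partition_mono[OF lebesgue_partition[OF assms(1)]]) auto
    then show False using j(2) assms(2) by (meson leD order_trans)
  qed
  then have "capital n w e s \<omega> j = capital n w e s \<omega> k" by (rule capital_frozen[OF assms(3)])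
  moreover then have "bet n w e s j \<omega> = 0" using assms(3) by (simp add: bet_def)
  ultimately show ?thesis using j assms by (subst bet_integral[of _ _ _ j]) auto
qed

lemma edge_visit_measurable:
  assumes "j \<le> k"
  shows "Measurable.pred (path_filtration.pre_sigma (\<lambda>\<omega>. lebesgue_time n \<omega> k)) (\<lambda>\<omega>. edge_visit n w e \<omega> j)"
proof -
  let ?G = "path_filtration.pre_sigma (\<lambda>\<omega>. lebesgue_time n \<omega> k)"
  have [measurable]: "(\<lambda>\<omega>. skeleton n \<omega> j) \<in> borel_measurable ?G"
      "(\<lambda>\<omega>. skeleton n \<omega> (j - 1)) \<in> borel_measurable ?G"
    using assms by (intro skeleton_measurable; simp)+
  have [measurable]: "(\<lambda>\<omega>. lebesgue_time n \<omega> j) \<in> borel_measurable ?G"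
    by (rule known_later[OF path_filtration.measurable_stopping_time_pre_sigma[OF lebesgue_time_stopping]
        assms])
  show ?thesis unfolding edge_visit_def by measurable
qed

lemma capital_measurable:
  "j \<le> k \<Longrightarrow> (\<lambda>\<omega>. capital n w e s \<omega> j) \<in> borel_measurable (path_filtration.pre_sigma (\<lambda>\<omega>. lebesgue_time n \<omega> k))"
proof (induction j)
  case (Suc j)
  have [measurable]: "(\<lambda>\<omega>. capital n w e s \<omega> j) \<in> borel_measurable (path_filtration.pre_sigma (\<lambda>\<omega>.
      lebesgue_time n \<omega> k))"
    using Suc by simp
  have [measurable]: "Measurable.pred (path_filtration.pre_sigma (\<lambda>\<omega>. lebesgue_time n \<omega> k)) (\<lambda>\<omega>. edge_visit n
      w e \<omega> j)"
    using Suc.prems by (intro edge_visit_measurable) simp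
  have [measurable]: "(\<lambda>\<omega>. skeleton n \<omega> j) \<in> borel_measurable (path_filtration.pre_sigma (\<lambda>\<omega>. lebesgue_time n
      \<omega> k))"
    "(\<lambda>\<omega>. skeleton n \<omega> (Suc j)) \<in> borel_measurable (path_filtration.pre_sigma (\<lambda>\<omega>. lebesgue_time n \<omega> k))"
    using Suc.prems by (intro skeleton_measurable; simp)+
  show ?case unfolding capital.simps(2) by measurable
qed simp

lemma dyadic_strategy_bet:
  assumes "2 \<le> n" "\<bar>s\<bar> \<le> 1"
  shows "dyadic_strategy n (bet n w e s)"
  unfolding dyadic_strategy_def
proof (intro conjI allI)
  fix k
  have [measurable]: "(\<lambda>\<omega>. capital n w e s \<omega> k) \<in> borel_measurable (path_filtration.pre_sigma (\<lambda>\<omega>.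
      lebesgue_time n \<omega> k))"
    by (rule capital_measurable) simp
  have [measurable]: "Measurable.pred (path_filtration.pre_sigma (\<lambda>\<omega>. lebesgue_time n \<omega> k)) (\<lambda>\<omega>. edge_visit n
      w e \<omega> k)"
    by (rule edge_visit_measurable) simp
  have "bet n w e s k = (\<lambda>\<omega>. if edge_visit n w e \<omega> k \<and> capital n w e s \<omega> k < 64 ^ n then s * sqrt (2 ^ n) *
      capital n w e s \<omega> k else 0)"
    by (auto simp: bet_def)
  also have "\<dots> \<in> borel_measurable (path_filtration.pre_sigma (\<lambda>\<omega>. lebesgue_time n \<omega> k))" by measurable
  finally show "bet n w e s k \<in> borel_measurable (path_filtration.pre_sigma (\<lambda>\<omega>. lebesgue_time n \<omega> k))" .
next
  have "\<bar>bet n w e s k \<omega>\<bar> \<le> 1 * sqrt (2 ^ n) * 64 ^ n" if "\<omega> \<in> paths" for k \<omega>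
  proof (cases "edge_visit n w e \<omega> k \<and> capital n w e s \<omega> k < 64 ^ n")
    case True
    then have "0 < capital n w e s \<omega> k" by (intro capital_pos assms that) (simp add: edge_visit_def)
    then have "\<bar>bet n w e s k \<omega>\<bar> = \<bar>s\<bar> * sqrt (2 ^ n) * capital n w e s \<omega> k" using True
      by (simp add: bet_def abs_mult)
    also have "\<dots> \<le> 1 * sqrt (2 ^ n) * 64 ^ n"
      using assms True \<open>0 < capital n w e s \<omega> k\<close> by (intro mult_mono) auto
    finally show ?thesis .
  next
    case False
    then have "bet n w e s k \<omega> = 0" unfolding bet_def by (rule if_not_P)
    then show ?thesis by simp
  qed
  then show "\<exists>B. \<forall>k. \<forall>\<omega>\<in>paths. \<bar>bet n w e s k \<omega>\<bar> \<le> B" by blast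
qed

text \<open>
  The gain of the same bets with unit positions; it is what the analysis of local times needs, while
  the capital is what can be kept above a bound.
\<close>

definition edge_gain :: "nat \<Rightarrow> real \<Rightarrow> real \<Rightarrow> path \<Rightarrow> nat \<Rightarrow> real" where
  "edge_gain n w e \<omega> k = (\<Sum>i<k. if edge_visit n w e \<omega> i then skeleton n \<omega> (Suc i) - skeleton n \<omega> i else 0)"

definition edge_count :: "nat \<Rightarrow> real \<Rightarrow> real \<Rightarrow> path \<Rightarrow> nat \<Rightarrow> real" where
  "edge_count n w e \<omega> k = (\<Sum>i<k. if edge_visit n w e \<omega> i then 1 else 0)"

text \<open>
  Sum up \<open>ln (1 + z) \<ge> z - 2 z\<^sup>2\<close> over the bets, where \<open>z\<^sup>2 = 2\<^sup>-\<^sup>n\<close> for each of them.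
\<close>

lemma ln_capital_ge:
  assumes n: "2 \<le> n" and s: "\<bar>s\<bar> = 1" and \<omega>: "\<omega> \<in> paths"
    and fin: "lebesgue_time n \<omega> k < \<infinity>"
    and active: "\<And>i. i < k \<Longrightarrow> capital n w e s \<omega> i < 64 ^ n"
  shows "s * sqrt (2 ^ n) * edge_gain n w e \<omega> k - 2 * edge_count n w e \<omega> k / 2 ^ n \<le> ln (capital n w e s \<omega> k)"
  using fin active
proof (induction k)
  case 0
  then show ?case by (simp add: edge_gain_def edge_count_def)
next
  case (Suc k)
  have fink: "lebesgue_time n \<omega> k < \<infinity>" using lebesgue_time_finite_mono[OF \<omega> Suc.prems(1)] by simp
  have IH: "s * sqrt (2 ^ n) * edge_gain n w e \<omega> k - 2 * edge_count n w e \<omega> k / 2 ^ n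
      \<le> ln (capital n w e s \<omega> k)"
    using Suc fink by simp
  show ?case
  proof (cases "edge_visit n w e \<omega> k")
    case False
    then show ?thesis using IH by (simp add: edge_gain_def edge_count_def capital_Suc bet_def)
  next
    case True
    define d where "d = skeleton n \<omega> (Suc k) - skeleton n \<omega> k"
    define z where "z = s * sqrt (2 ^ n) * d"
    have pos: "0 < capital n w e s \<omega> k" using s by (intro capital_pos n \<omega> fink) simp
    have "\<bar>d\<bar> = 1 / 2 ^ n"
      unfolding d_def using True by (intro skeleton_step \<omega> Suc.prems(1)) (simp add: edge_visit_def)
    then have absz: "\<bar>z\<bar> = 1 / sqrt (2 ^ n)" using s sqrt_power_div[of n] by (simp add: z_def abs_mult)
    then have z2: "z\<^sup>2 = 1 / 2 ^ n" by (metis power2_abs power_one_over real_sqrt_pow2 zero_le_numeral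
        zero_le_power)
    have "\<bar>z\<bar> \<le> 1 / 2" unfolding absz using two_le_sqrt[OF n] by (simp add: field_simps)
    then have "\<bar>ln (1 + z) - z\<bar> \<le> 2 * z\<^sup>2" by (rule abs_ln_one_plus_x_minus_x_bound)
    then have lnz: "z - 2 / 2 ^ n \<le> ln (1 + z)" unfolding z2 by linarith
    have "0 < 1 + z" using \<open>\<bar>z\<bar> \<le> 1 / 2\<close> by linarith
    have "capital n w e s \<omega> (Suc k) = capital n w e s \<omega> k * (1 + z)"
      using True Suc.prems(2)[of k] by (simp add: capital_Suc bet_def z_def d_def algebra_simps)
    then have "ln (capital n w e s \<omega> (Suc k)) = ln (capital n w e s \<omega> k) + ln (1 + z)"
      using pos \<open>0 < 1 + z\<close> by (simp add: ln_mult_pos)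
    moreover have "edge_gain n w e \<omega> (Suc k) = edge_gain n w e \<omega> k + d" using True
      by (simp add: edge_gain_def d_def)
    moreover have "edge_count n w e \<omega> (Suc k) = edge_count n w e \<omega> k + 1" using True
      by (simp add: edge_count_def)
    ultimately show ?thesis using IH lnz by (simp add: z_def algebra_simps add_divide_distrib)
  qed
qed

text \<open>
  The typical property from which everything else is deduced. It depends on neither \<open>T\<close>, \<open>\<alpha>\<close> nor
  \<open>p\<close>, so one null set serves the whole theorem.
\<close>

definition concentrated :: "path \<Rightarrow> bool" where
  "concentrated \<omega> \<longleftrightarrow> (\<exists>n\<^sub>0. \<forall>n\<ge>n\<^sub>0. \<forall>w\<in>dyadic n. \<bar>w\<bar> \<le> real n \<longrightarrow> (\<forall>e\<in>{-1, 1}. \<forall>k. lebesgue_time n \<omega> k < \<infinity> \<longrightarrow>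
     \<bar>edge_gain n w e \<omega> k\<bar> \<le> (64 * real n + 2 * edge_count n w e \<omega> k / 2 ^ n) / sqrt (2 ^ n)))"

lemma large_gain_large_capital:
  assumes n: "2 \<le> n" and \<omega>: "\<omega> \<in> paths" and fin: "lebesgue_time n \<omega> k < \<infinity>"
    and gain: "(64 * real n + 2 * edge_count n w e \<omega> k / 2 ^ n) / sqrt (2 ^ n) < \<bar>edge_gain n w e \<omega> k\<bar>"
  shows "\<exists>s\<in>{-1,1}. \<exists>j. lebesgue_time n \<omega> j < \<infinity> \<and> 64 ^ n \<le> capital n w e s \<omega> j"
proof (rule ccontr)
  assume neg: "\<not> ?thesis"
  \<comment> \<open>Bet in the direction in which the gain is positive.\<close>
  define s where "s = (if 0 \<le> edge_gain n w e \<omega> k then 1 else -1 :: real)"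
  have s: "s \<in> {-1, 1}" "\<bar>s\<bar> = 1" by (auto simp: s_def)
  have small: "capital n w e s \<omega> j < 64 ^ n" if "j \<le> k" for j
    using neg s(1) lebesgue_time_finite_mono[OF \<omega> fin that] by (meson not_le)
  have "64 * real n + 2 * edge_count n w e \<omega> k / 2 ^ n < \<bar>edge_gain n w e \<omega> k\<bar> * sqrt (2 ^ n)"
    using gain by (simp add: pos_divide_less_eq)
  also have "\<dots> = s * sqrt (2 ^ n) * edge_gain n w e \<omega> k" by (simp add: s_def)
  finally have "64 * real n < ln (capital n w e s \<omega> k)"
    using ln_capital_ge[OF n s(2) \<omega> fin, of w e] small by fastforce
  also have "\<dots> \<le> ln (64 ^ n)"
    using small[of k] capital_pos[OF n _ \<omega> fin, of s w e] s(2) by (subst ln_le_cancel_iff) auto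
  also have "\<dots> = real n * ln 64" by (simp add: ln_realpow)
  \<comment> \<open>The crude bound \<open>ln 64 \<le> 64\<close> explains the constant in \<open>concentrated\<close>.\<close>
  also have "\<dots> \<le> real n * 64" using ln_le_minus_one[of "64::real"] by (intro mult_left_mono) auto
  finally show False by simp
qed

lemma finite_bounded_dyadic:
  "finite {w \<in> dyadic n. \<bar>w\<bar> \<le> real n}" "card {w \<in> dyadic n. \<bar>w\<bar> \<le> real n} \<le> 2 * (n * 2 ^ n) + 1"
proof -
  let ?f = "\<lambda>k::int. of_int k / 2 ^ n :: real"
  have sub: "{w \<in> dyadic n. \<bar>w\<bar> \<le> real n} \<subseteq> ?f ` {- int (n * 2 ^ n)..int (n * 2 ^ n)}"
  proof
    fix w assume "w \<in> {w \<in> dyadic n. \<bar>w\<bar> \<le> real n}"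
    then obtain k :: int where k: "w = of_int k / 2 ^ n" "\<bar>w\<bar> \<le> real n" by (auto simp: dyadic_def)
    have "\<bar>of_int k :: real\<bar> = \<bar>w\<bar> * 2 ^ n" unfolding k(1) by simp
    also have "\<dots> \<le> real n * 2 ^ n" using k(2) by (intro mult_right_mono) auto
    finally have "\<bar>of_int k :: real\<bar> \<le> real (n * 2 ^ n)" by simp
    then have "k \<in> {- int (n * 2 ^ n)..int (n * 2 ^ n)}" by (auto simp del: of_nat_mult)
    then show "w \<in> ?f ` {- int (n * 2 ^ n)..int (n * 2 ^ n)}" using k(1) by blast
  qed
  show "finite {w \<in> dyadic n. \<bar>w\<bar> \<le> real n}" by (rule finite_subset[OF sub]) simp
  have "card {w \<in> dyadic n. \<bar>w\<bar> \<le> real n} \<le> card (?f ` {- int (n * 2 ^ n)..int (n * 2 ^ n)})"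
    by (rule card_mono[OF _ sub]) simp
  also have "\<dots> \<le> card {- int (n * 2 ^ n)..int (n * 2 ^ n)}" by (rule card_image_le) simp
  also have "\<dots> = 2 * (n * 2 ^ n) + 1" unfolding card_atLeastAtMost_int by linarith
  finally show "card {w \<in> dyadic n. \<bar>w\<bar> \<le> real n} \<le> 2 * (n * 2 ^ n) + 1" .
qed

text \<open>
  On level \<open>m \<ge> 2\<close> there are at most \<open>12 \<cdot> 4\<^sup>m\<close> edges and directions of betting, so that each of the
  bets can be given the initial capital \<open>64\<^sup>-\<^sup>m\<close> at a total cost of at most \<open>2\<^sup>-\<^sup>m\<close>; a bet that
  succeeds pays \<open>1\<close>.
\<close>

theorem typical_concentrated: "typical concentrated"
proof -
  let ?b = "\<lambda>m i. bet m (fst i) (fst (snd i)) (snd (snd i))"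
  define I where "I m = (if m < 2 then {} else {w \<in> dyadic m. \<bar>w\<bar> \<le> real m} \<times> {-1, 1 :: real} \<times> {-1,
      1 :: real})" for m
  define Q where "Q m k \<omega> = (\<Sum>i\<in>I m. 1 / 64 ^ m * ?b m i k \<omega>)" for m k \<omega>
  have I: "2 \<le> m" "\<bar>snd (snd i)\<bar> \<le> 1" if "i \<in> I m" for i m
    using that by (auto simp: I_def split: if_splits)
  have finI: "finite (I m)" for m using finite_bounded_dyadic(1)[of m] by (simp add: I_def)
  have cardI: "real (card (I m)) / 64 ^ m \<le> 1 / 2 ^ m" for m
  proof (cases "m < 2")
    case False
    have "card (I m) \<le> (2 * (m * 2 ^ m) + 1) * 4"
      using False finite_bounded_dyadic(2)[of m] by (simp add: I_def card_cartesian_product)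
    also have "\<dots> \<le> 12 * 4 ^ m"
    proof -
      have "m * 2 ^ m \<le> 2 ^ m * 2 ^ m" by (intro mult_right_mono) (auto intro: less_imp_le less_exp)
      also have "\<dots> = (4 :: nat) ^ m" by (simp flip: power_mult_distrib)
      finally have "m * 2 ^ m \<le> 4 ^ m" .
      moreover have "(2 * a + 1) * 4 \<le> 12 * b" if "a \<le> b" "1 \<le> b" for a b :: nat using that by simp
      ultimately show ?thesis by (metis one_le_numeral one_le_power)
    qed
    also have "\<dots> \<le> 8 ^ m * 4 ^ m" using power_increasing[of 2 m "8::nat"] False by (intro mult_right_mono) auto
    also have "\<dots> = 32 ^ m" by (simp flip: power_mult_distrib)
    finally have "real (card (I m)) \<le> 32 ^ m" by (metis of_nat_le_iff of_nat_numeral of_nat_power)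
    then have "real (card (I m)) / 64 ^ m \<le> 32 ^ m / 64 ^ m" by (simp add: divide_right_mono)
    also have "\<dots> = 1 / 2 ^ m" by (simp flip: power_divide add: power_one_over[symmetric])
    finally show ?thesis .
  qed (simp add: I_def)
  have int: "dyadic_integral m (Q m) t \<omega> =
    (\<Sum>i\<in>I m. 1 / 64 ^ m * dyadic_integral m (?b m i) t \<omega>)"
    if "\<omega> \<in> paths" "0 \<le> t" for m t \<omega>
    unfolding dyadic_integral_eq Q_def path_integral_sum[OF lebesgue_partition[OF that(1)] that(2)]
      path_integral_cmult[OF lebesgue_partition[OF that(1)] that(2)] ..
  have cap: "(\<Sum>i\<in>I m. 1 / 64 ^ m * (1 + dyadic_integral m (?b m i) t \<omega>))
      \<le> 1 / 2 ^ m + dyadic_integral m (Q m) t \<omega>"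
    if "\<omega> \<in> paths" "0 \<le> t" for m t \<omega>
    using cardI[of m] by (simp add: int[OF that] distrib_left sum.distrib)
  have term_nonneg: "0 \<le> 1 / 64 ^ m * (1 + dyadic_integral m (?b m i) t \<omega>)"
    if "\<omega> \<in> paths" "0 \<le> t" "i \<in> I m" for m t \<omega> i
    using bet_integral_ge[OF I[OF that(3)] that(1,2), of "fst i" "fst (snd i)"]
      by (intro mult_nonneg_nonneg) auto
  show ?thesis
    unfolding typical_def
  proof (rule null_set_borel_cantelli[of Q])
    show "dyadic_strategy m (Q m)" for m
    proof -
      have "dyadic_strategy m (\<lambda>k \<omega>. \<Sum>i\<in>I m. 1 / 64 ^ m * ?b m i k \<omega>)"
        using I by (intro dyadic_strategy_sum dyadic_strategy_cmult dyadic_strategy_bet) blast+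
      then show ?thesis by (simp add: Q_def[abs_def])
    qed
    show "- (1 / 2 ^ m) \<le> dyadic_integral m (Q m) t \<omega>" if "\<omega> \<in> paths" "0 \<le> t" for m t \<omega>
    proof -
      have "0 \<le> (\<Sum>i\<in>I m. 1 / 64 ^ m * (1 + dyadic_integral m (?b m i) t \<omega>))"
        by (rule sum_nonneg) (rule term_nonneg[OF that])
      then show ?thesis using cap[OF that, of m] by linarith
    qed
    fix \<omega> and m0 :: nat assume \<omega>: "\<omega> \<in> {\<omega> \<in> paths. \<not> concentrated \<omega>}" "\<omega> \<in> paths"
    then obtain n w e k where nwek: "max m0 2 \<le> n" "w \<in> dyadic n" "\<bar>w\<bar> \<le> real n" "e \<in> {-1, 1}"
        "lebesgue_time n \<omega> k < \<infinity>"
      "(64 * real n + 2 * edge_count n w e \<omega> k / 2 ^ n) / sqrt (2 ^ n) < \<bar>edge_gain n w e \<omega> k\<bar>"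
      unfolding concentrated_def mem_Collect_eq by (meson not_le)
    then have n: "2 \<le> n" by simp
    obtain s j where s: "s \<in> {-1, 1}" "lebesgue_time n \<omega> j < \<infinity>" "64 ^ n \<le> capital n w e s \<omega> j"
      using large_gain_large_capital[OF n \<omega>(2) nwek(5,6)] by blast
    define r where "r = enn2real (lebesgue_time n \<omega> j)"
    have r: "lebesgue_time n \<omega> j = ennreal r" "0 \<le> r" using s(2) by (simp_all add: r_def)
    have "\<forall>\<^sub>F t in at_top. 1 \<le> 1 / 2 ^ n + dyadic_integral n (Q n) t \<omega>"
      using eventually_ge_at_top[of r]
    proof eventually_elim
      case (elim t)
      have t: "0 \<le> t" using elim r by simp
      have mem: "(w, e, s) \<in> I n" using nwek s n by (auto simp: I_def)
      have "1 + dyadic_integral n (bet n w e s) t \<omega> = capital n w e s \<omega> j"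
        using bet_integral_frozen[OF \<omega>(2) _ s(3) t] r elim by (simp add: ennreal_leI)
      then have "1 \<le> 1 / 64 ^ n * (1 + dyadic_integral n (bet n w e s) t \<omega>)" using s(3) by simp
      also have "\<dots> \<le> (\<Sum>i\<in>I n. 1 / 64 ^ n * (1 + dyadic_integral n (?b n i) t \<omega>))"
        using member_le_sum[OF mem _ finI, of "\<lambda>i. 1 / 64 ^ n * (1 + dyadic_integral n (?b n i) t \<omega>)"]
          term_nonneg[OF \<omega>(2) t] by auto
      also have "\<dots> \<le> 1 / 2 ^ n + dyadic_integral n (Q n) t \<omega>" by (rule cap[OF \<omega>(2) t])
      finally show ?case .
    qed
    then show "\<exists>m\<ge>m0. \<forall>\<^sub>F t in at_top. 1 \<le> 1 / 2 ^ m + dyadic_integral m (Q m) t \<omega>"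
      using nwek(1) by (intro exI[of _ n]) auto
  qed
qed

section \<open>Tanaka's formula and the comparison of levels\<close>

text \<open>
  Their integer indices differ by one; so one of them is even.
\<close>

lemma grid_neighbour_coarse:
  assumes "a \<in> dyadic (Suc m)" "b \<in> dyadic (Suc m)" "a \<notin> dyadic m" "\<bar>a - b\<bar> = 1 / 2 ^ Suc m"
  shows "b \<in> dyadic m"
proof -
  obtain i j :: int where ij: "a = of_int i / 2 ^ Suc m" "b = of_int j / 2 ^ Suc m"
    using assms(1,2) unfolding dyadic_def by blast
  have even: "of_int k / 2 ^ Suc m \<in> dyadic m" if "even k" for k :: int
  proof -
    from that obtain l where "k = 2 * l" by (auto elim: evenE)
    then have "of_int k / 2 ^ Suc m = (of_int l / 2 ^ m :: real)" by simp
    then show ?thesis unfolding dyadic_def by blast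
  qed
  have "odd i" using even assms(3) ij(1) by blast
  have "\<bar>a - b\<bar> = \<bar>of_int (i - j)\<bar> / 2 ^ Suc m" by (simp add: ij diff_divide_distrib[symmetric])
  then have "\<bar>real_of_int (i - j)\<bar> = 1" using assms(4) by simp
  then have "\<bar>i - j\<bar> = 1" by (metis of_int_abs of_int_eq_1_iff)
  then have "even j" using \<open>odd i\<close> by presburger
  then show ?thesis using even ij(2) by blast
qed

lemma tanaka_identity:
  "indicator (between a b) u * \<bar>b - u\<bar> = max (u - b) 0 - max (u - a) 0 + of_bool (a < u) * (b - a)"
      for u :: real
  by (auto simp: between_def indicator_def max_def)

lemma discrete_local_time_local:
  assumes "time_partition \<pi>" "0 \<le> t" "\<pi> j \<le> ennreal t" "ennreal t \<le> \<pi> (Suc j)"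
  shows "discrete_local_time \<pi> \<omega> t u =
    (\<Sum>i<j. indicator (between (\<omega> (enn2real (\<pi> i))) (\<omega> (enn2real (\<pi> (Suc i))))) u * \<bar>\<omega> (enn2real (\<pi> (Suc i))) -
        u\<bar>)
     + indicator (between (\<omega> (enn2real (\<pi> j))) (\<omega> t)) u * \<bar>\<omega> t - u\<bar>"
proof -
  let ?g = "\<lambda>j. if \<pi> j < \<infinity> then
        indicator (between (stopped_value \<omega> (\<pi> j) t) (stopped_value \<omega> (\<pi> (Suc j)) t)) u *
          \<bar>stopped_value \<omega> (\<pi> (Suc j)) t - u\<bar>
      else 0"
  have "discrete_local_time \<pi> \<omega> t u = sum ?g {..j}"
    unfolding discrete_local_time_def
  proof (rule suminf_finite)
    fix k assume "k \<notin> {..j}"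
    then have "ennreal t \<le> \<pi> k" "ennreal t \<le> \<pi> (Suc k)"
      using assms(4) partition_mono[OF assms(1), of "Suc j" k] partition_mono[OF assms(1), of "Suc j" "Suc k"]
      by auto
    then show "?g k = 0" using assms(2) by (simp add: stopped_value_after between_def)
  qed simp
  also have "\<dots> = sum ?g {..<j} + ?g j" by (simp add: lessThan_Suc_atMost[symmetric])
  also have "?g j = indicator (between (\<omega> (enn2real (\<pi> j))) (\<omega> t)) u * \<bar>\<omega> t - u\<bar>"
    using assms by (simp add: stopped_value_after stopped_value_before le_less_trans)
  also have "sum ?g {..<j} =
    (\<Sum>i<j. indicator (between (\<omega> (enn2real (\<pi> i))) (\<omega> (enn2real (\<pi> (Suc i))))) u * \<bar>\<omega> (enn2real (\<pi> (Suc i))) -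
        u\<bar>)"
  proof (rule sum.cong[OF refl])
    fix i assume "i \<in> {..<j}"
    then have "\<pi> i \<le> ennreal t" "\<pi> (Suc i) \<le> ennreal t"
      using assms(3) partition_mono[OF assms(1), of i j] partition_mono[OF assms(1), of "Suc i" j]
      by auto
    then show "?g i = indicator (between (\<omega> (enn2real (\<pi> i))) (\<omega> (enn2real (\<pi> (Suc i))))) u * \<bar>\<omega> (enn2real (\<pi>
        (Suc i))) - u\<bar>"
      by (simp add: stopped_value_before le_less_trans)
  qed
  finally show ?thesis .
qed

text \<open>
  The integral \<open>I\<^sup>n\<^sub>t(u)\<close> of the introduction, that is, the one in Tanaka's formula.
\<close>

definition level_integral :: "nat \<Rightarrow> path \<Rightarrow> real \<Rightarrow> real \<Rightarrow> real" where
  "level_integral n \<omega> t u = path_integral (lebesgue_time n \<omega>) (\<lambda>k. of_bool (skeleton n \<omega> k < u)) \<omega> t"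

text \<open>
  Sum \<open>tanaka_identity\<close> over the steps; the first two terms telescope.
\<close>

theorem discrete_tanaka:
  assumes "\<omega> \<in> paths" "0 \<le> t"
  shows "dyadic_local_time n \<omega> t u = max (u - \<omega> t) 0 - max (u - \<omega> 0) 0 + level_integral n \<omega> t u"
proof -
  let ?x = "skeleton n \<omega>"
  note part = lebesgue_partition[OF assms(1), of n]
  obtain k where k: "lebesgue_time n \<omega> k \<le> ennreal t" "ennreal t < lebesgue_time n \<omega> (Suc k)"
    using partition_index[OF part assms(2)] .
  have "dyadic_local_time n \<omega> t u = (\<Sum>i<k. max (u - ?x (Suc i)) 0 - max (u - ?x i) 0) +
     (max (u - \<omega> t) 0 - max (u - ?x k) 0) + level_integral n \<omega> t u"
    using k unfolding level_integral_def
    by (subst path_integral_local[OF part assms(2) k(1)], simp,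
        subst discrete_local_time_local[OF part assms(2) k(1)], simp)
       (simp add: tanaka_identity sum.distrib)
  also have "(\<Sum>i<k. max (u - ?x (Suc i)) 0 - max (u - ?x i) 0) = max (u - ?x k) 0 - max (u - \<omega> 0) 0"
    by (subst sum_lessThan_telescope) simp
  finally show ?thesis by simp
qed

lemma partial_local_time_le:
  assumes "\<omega> \<in> paths" "0 \<le> t" "lebesgue_time n \<omega> k \<le> ennreal t" "ennreal t < lebesgue_time n \<omega> (Suc k)"
  shows "(\<Sum>i<k. indicator (between (skeleton n \<omega> i) (skeleton n \<omega> (Suc i))) u * \<bar>skeleton n \<omega> (Suc i) - u\<bar>)
    \<le> dyadic_local_time n \<omega> t u"
  using assms by (subst discrete_local_time_local[OF lebesgue_partition[OF assms(1)] assms(2,3)]) auto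

lemma dyadic_local_time_nonneg:
  assumes "\<omega> \<in> paths" "0 \<le> t"
  shows "0 \<le> dyadic_local_time n \<omega> t u"
proof -
  obtain k where k: "lebesgue_time n \<omega> k \<le> ennreal t" "ennreal t < lebesgue_time n \<omega> (Suc k)"
    using partition_index[OF lebesgue_partition[OF assms(1)] assms(2)] .
  have "0 \<le> (\<Sum>i<k. indicator (between (skeleton n \<omega> i) (skeleton n \<omega> (Suc i))) u * \<bar>skeleton n \<omega> (Suc i) - u\<bar>)"
    by (intro sum_nonneg) auto
  then show ?thesis using partial_local_time_le[OF assms k] by (rule order_trans)
qed

lemma sum_shift_le:
  fixes F G :: "nat \<Rightarrow> real"
  assumes "F 0 = 0" "\<And>i. Suc i < k \<Longrightarrow> F (Suc i) \<le> G i" "\<And>i. 0 \<le> G i"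
  shows "(\<Sum>i<k. F i) \<le> (\<Sum>i<k. G i)"
proof (cases k)
  case (Suc l)
  have "(\<Sum>i<Suc l. F i) = (\<Sum>i<l. F (Suc i))" using assms(1)
    by (simp add: sum.lessThan_Suc_shift del: sum.lessThan_Suc)
  also have "\<dots> \<le> (\<Sum>i<l. G i)" using assms(2) Suc by (intro sum_mono) auto
  also have "\<dots> \<le> (\<Sum>i<Suc l. G i)" using assms(3) by simp
  finally show ?thesis using Suc by simp
qed simp

text \<open>
  A downward passage of the edge below \<open>u\<close> contributes \<open>h\<close> to the local time at \<open>u\<close>. Upward passages
  alternate with downward ones, so their number is larger by at most one; another one is lost to a
  first step that crosses \<open>u\<close> from a point off the grid.
\<close>

lemma edge_count_le:
  assumes \<omega>: "\<omega> \<in> paths" and t: "0 \<le> t"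
    and k: "lebesgue_time n \<omega> k \<le> ennreal t" "ennreal t < lebesgue_time n \<omega> (Suc k)" and u: "u \<in> dyadic n"
  shows edge_count_down_le: "edge_count n (u - 1 / 2 ^ n) 1 \<omega> k / 2 ^ n \<le> dyadic_local_time n \<omega> t u + 2 / 2 ^ n"
    and edge_count_up_le: "edge_count n u (- 1) \<omega> k / 2 ^ n \<le> dyadic_local_time n \<omega> t u + 2 / 2 ^ n"
proof -
  let ?x = "skeleton n \<omega>" and ?h = "1 / 2 ^ n :: real"
  define G where "G i = indicator (between (?x i) (?x (Suc i))) u * \<bar>?x (Suc i) - u\<bar>" for i
  have G0: "0 \<le> G i" for i by (simp add: G_def)
  have L: "(\<Sum>i<k. G i) \<le> dyadic_local_time n \<omega> t u"
    unfolding G_def by (rule partial_local_time_le[OF \<omega> t k])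
  have fin: "lebesgue_time n \<omega> i < \<infinity>" if "i \<le> k" for i
    using lebesgue_time_finite_mono[OF \<omega> _ that] k(1) by (simp add: le_less_trans)
  have "edge_count n (u - ?h) 1 \<omega> k / 2 ^ n = (\<Sum>i<k. (if edge_visit n (u - ?h) 1 \<omega> i then 1 else 0) / 2 ^ n)"
    by (simp add: edge_count_def sum_divide_distrib)
  also have "\<dots> \<le> (\<Sum>i<k. G i)"
    by (intro sum_shift_le G0) (auto simp: edge_visit_def G_def between_def)
  finally show "edge_count n (u - 1 / 2 ^ n) 1 \<omega> k / 2 ^ n \<le> dyadic_local_time n \<omega> t u + 2 / 2 ^ n"
    using L by (simp add: add_increasing2)
  have "edge_count n u (- 1) \<omega> k \<le> (\<Sum>i<k. of_bool (?x i < u \<and> u \<le> ?x (Suc i)))"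
    unfolding edge_count_def by (intro sum_shift_le) (auto simp: edge_visit_def)
  also have "\<dots> = (\<Sum>i<k. of_bool (u \<le> ?x (Suc i)) - of_bool (u \<le> ?x i)) + (\<Sum>i<k. of_bool (?x (Suc i) < u \<and> u
      \<le> ?x i))"
    unfolding sum.distrib[symmetric] by (intro sum.cong) auto
  also have "(\<Sum>i<k. of_bool (u \<le> ?x (Suc i)) - of_bool (u \<le> ?x i) :: real) \<le> 1"
    by (subst sum_lessThan_telescope) auto
  also have "(\<Sum>i<k. of_bool (?x (Suc i) < u \<and> u \<le> ?x i)) \<le> (\<Sum>i<k. of_bool (i = 0) + 2 ^ n * G i)"
  proof (intro sum_mono)
    fix i assume i: "i \<in> {..<k}"
    show "of_bool (?x (Suc i) < u \<and> u \<le> ?x i) \<le> of_bool (i = 0) + 2 ^ n * G i"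
    proof (cases "0 < i \<and> ?x (Suc i) < u \<and> u \<le> ?x i")
      case True
      have "?x (Suc i) \<in> dyadic n" using i by (intro skeleton_in_dyadic[OF \<omega>] fin) auto
      then have "?h \<le> \<bar>?x (Suc i) - u\<bar>" using True u by (intro dyadic_separated) auto
      moreover have "u \<in> between (?x i) (?x (Suc i))" using True by (auto simp: between_def)
      ultimately have "?h \<le> G i" by (simp add: G_def)
      then show ?thesis using True by (simp add: field_simps)
    next
      case False
      then show ?thesis using G0[of i] by auto
    qed
  qed
  also have "\<dots> \<le> 1 + 2 ^ n * (\<Sum>i<k. G i)"
  proof -
    have "(\<Sum>i<k. of_bool (i = 0)) \<le> (1 :: real)"
      by (cases k) (simp_all add: sum.lessThan_Suc_shift del: sum.lessThan_Suc)
    then show ?thesis unfolding sum.distrib sum_distrib_left by linarith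
  qed
  finally have "edge_count n u (- 1) \<omega> k \<le> 2 + 2 ^ n * (\<Sum>i<k. G i)" by simp
  also have "\<dots> \<le> 2 + 2 ^ n * dyadic_local_time n \<omega> t u" using L by simp
  finally show "edge_count n u (- 1) \<omega> k / 2 ^ n \<le> dyadic_local_time n \<omega> t u + 2 / 2 ^ n"
    by (simp add: field_simps)
qed

text \<open>
  If the position agrees with a combination of edge bets on all completed steps but the first two,
  then so does its integral up to \<open>3 h\<close>: there are two exceptional steps and the running one.
\<close>

lemma path_integral_edges:
  assumes \<omega>: "\<omega> \<in> paths" and t: "0 \<le> t"
    and k: "lebesgue_time n \<omega> k \<le> ennreal t" "ennreal t < lebesgue_time n \<omega> (Suc k)"
    and f: "\<And>i. \<bar>f i\<bar> \<le> 1"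
    and edges: "\<And>i. 2 \<le> i \<Longrightarrow> i < k \<Longrightarrow> f i = a * of_bool (edge_visit n w e \<omega> i) +
        b * of_bool (edge_visit n w' e' \<omega> i)"
  shows "\<bar>path_integral (lebesgue_time n \<omega>) f \<omega> t\<bar> \<le> \<bar>a * edge_gain n w e \<omega> k + b * edge_gain n w' e' \<omega> k\<bar> +
      3 / 2 ^ n"
proof -
  let ?x = "skeleton n \<omega>" and ?h = "1 / 2 ^ n :: real"
  let ?r = "\<lambda>i. f i - a * of_bool (edge_visit n w e \<omega> i) - b * of_bool (edge_visit n w' e' \<omega> i)"
  have fin: "lebesgue_time n \<omega> i < \<infinity>" if "i \<le> k" for i
    using lebesgue_time_finite_mono[OF \<omega> _ that] k(1) by (simp add: le_less_trans)
  have gain: "edge_gain n w e \<omega> k = (\<Sum>i<k. of_bool (edge_visit n w e \<omega> i) * (?x (Suc i) - ?x i))" for w e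
    unfolding edge_gain_def by (intro sum.cong) auto
  have eq: "(\<Sum>i<k. f i * (?x (Suc i) - ?x i)) =
    a * edge_gain n w e \<omega> k + b * edge_gain n w' e' \<omega> k + (\<Sum>i<k. ?r i * (?x (Suc i) - ?x i))"
    unfolding gain sum_distrib_left sum.distrib[symmetric] by (intro sum.cong) (auto simp: algebra_simps)
  have "\<bar>\<Sum>i<k. ?r i * (?x (Suc i) - ?x i)\<bar> \<le> (\<Sum>i<k. if i < 2 then ?h else 0)"
  proof (intro order_trans[OF sum_abs] sum_mono)
    fix i assume i: "i \<in> {..<k}"
    show "\<bar>?r i * (?x (Suc i) - ?x i)\<bar> \<le> (if i < 2 then ?h else 0)"
    proof (cases "i < 2")
      case True
      then have "\<not> edge_visit n w e \<omega> i" "\<not> edge_visit n w' e' \<omega> i" by (auto simp: edge_visit_def)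
      moreover have "\<bar>f i * (?x (Suc i) - ?x i)\<bar> \<le> 1 * ?h"
        unfolding abs_mult using i f[of i] fin[of "Suc i"] by (intro mult_mono skeleton_step_le[OF \<omega>]) auto
      ultimately show ?thesis using True by simp
    next
      case False
      then show ?thesis using edges[of i] i by simp
    qed
  qed
  also have "\<dots> \<le> 2 * ?h"
  proof -
    have "{i\<in>{..<k}. i < 2} \<subseteq> {0, 1}" by auto
    then have "card {i\<in>{..<k}. i < 2} \<le> card {0, 1 :: nat}" by (intro card_mono) auto
    then have "real (card {i\<in>{..<k}. i < 2}) * ?h \<le> 2 * ?h" by (intro mult_right_mono) auto
    moreover have "(\<Sum>i<k. if i < 2 then ?h else 0) = (\<Sum>i\<in>{i\<in>{..<k}. i < 2}. ?h)"
      by (rule sum.inter_filter[symmetric]) simp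
    ultimately show ?thesis unfolding sum_constant by simp
  qed
  finally have 1: "\<bar>\<Sum>i<k. ?r i * (?x (Suc i) - ?x i)\<bar> \<le> 2 * ?h" .
  have 2: "\<bar>f k * (\<omega> t - ?x k)\<bar> \<le> 1 * ?h"
    unfolding abs_mult using k f[of k] by (intro mult_mono oscillation_le_mesh[OF \<omega> t]) auto
  have "path_integral (lebesgue_time n \<omega>) f \<omega> t = (\<Sum>i<k. f i * (?x (Suc i) - ?x i)) + f k * (\<omega> t - ?x k)"
    using k by (intro path_integral_local[OF lebesgue_partition[OF \<omega>] t]) auto
  moreover have "3 / 2 ^ n = 3 * ?h" by simp
  ultimately show ?thesis using 1 2 unfolding eq by linarith
qed

text \<open>
  A coarse grid point is recorded on the coarse level as soon as it is visited, and by
  \<open>grid_neighbour_coarse\<close> the fine walk visits one at least at every second step.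
\<close>

lemma coarse_position_at_fine_time:
  assumes \<omega>: "\<omega> \<in> paths" and i: "2 \<le> i" and fin: "lebesgue_time (Suc m) \<omega> i < \<infinity>"
  shows "active_position (lebesgue_time m \<omega>) (\<lambda>j. g (skeleton m \<omega> j)) (lebesgue_time (Suc m) \<omega> i) =
    g (if skeleton (Suc m) \<omega> i \<in> dyadic m then skeleton (Suc m) \<omega> i else skeleton (Suc m) \<omega> (i - 1))"
proof -
  let ?n = "Suc m"
  note pm = lebesgue_partition[OF \<omega>, of m] and pn = lebesgue_partition[OF \<omega>, of ?n]
  define r where "r = enn2real (lebesgue_time ?n \<omega> i)"
  have r: "lebesgue_time ?n \<omega> i = ennreal r" "0 \<le> r" using fin by (simp_all add: r_def)
  obtain j where j: "lebesgue_time m \<omega> j \<le> ennreal r" "ennreal r < lebesgue_time m \<omega> (Suc j)"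
    using partition_index[OF pm r(2)] .
  have "active_position (lebesgue_time m \<omega>) (\<lambda>j. g (skeleton m \<omega> j)) (lebesgue_time ?n \<omega> i)
      = g (skeleton m \<omega> j)"
    using active_position_eq[OF pm] j r(1) by auto
  moreover have "skeleton m \<omega> j = (if skeleton ?n \<omega> i \<in> dyadic m then skeleton ?n \<omega> i else skeleton ?n \<omega> (i -
      1))"
  proof (cases "skeleton ?n \<omega> i \<in> dyadic m")
    case True
    then show ?thesis using no_dyadic_hit[OF \<omega> r(2) j] by (auto simp: r_def)
  next
    case False
    obtain l where l: "i = Suc l" "0 < l" using i by (cases i) auto
    have finl: "lebesgue_time ?n \<omega> l < \<infinity>" using lebesgue_time_finite_mono[OF \<omega> fin] l by simp
    have "skeleton ?n \<omega> l \<in> dyadic m"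
    proof (rule grid_neighbour_coarse)
      show "skeleton ?n \<omega> i \<in> dyadic ?n" using i by (intro skeleton_in_dyadic[OF \<omega> fin]) simp
      show "skeleton ?n \<omega> l \<in> dyadic ?n" by (rule skeleton_in_dyadic[OF \<omega> finl l(2)])
      show "\<bar>skeleton ?n \<omega> i - skeleton ?n \<omega> l\<bar> = 1 / 2 ^ ?n"
        using skeleton_step[OF \<omega> _ l(2), of ?n] fin unfolding l(1) by blast
    qed (rule False)
    moreover have "skeleton ?n \<omega> l \<notin> dyadic m - {skeleton m \<omega> j}"
    proof -
      have "lebesgue_time m \<omega> j < \<infinity>" using j(1) by (simp add: le_less_trans)
      then obtain q where q: "lebesgue_time ?n \<omega> q = lebesgue_time m \<omega> j"
        using lebesgue_times_nested[OF \<omega>, of m ?n j] by auto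
      have "q \<noteq> i"
      proof
        assume "q = i"
        then have eq: "lebesgue_time m \<omega> j = lebesgue_time ?n \<omega> i" using q by simp
        have "0 < lebesgue_time ?n \<omega> i" using partition_strict[OF pn, of 0 i] i by simp
        then have "0 < j" using eq by (cases j) auto
        then have "skeleton m \<omega> j \<in> dyadic m" using eq fin by (intro skeleton_in_dyadic[OF \<omega>]) auto
        then show False using eq False by simp
      qed
      moreover have "\<not> i < q" using partition_strict[OF pn, of i q] fin q j(1) r(1) by auto
      ultimately have "q \<le> l" using l by simp
      then have le: "lebesgue_time m \<omega> j \<le> lebesgue_time ?n \<omega> l" using partition_mono[OF pn, of q l] q by simp
      have less: "lebesgue_time ?n \<omega> l < lebesgue_time m \<omega> (Suc j)"
        using partition_mono[OF pn, of l i] j(2) l r(1) by (auto intro: le_less_trans)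
      show ?thesis using le less finl by (intro no_dyadic_hit[OF \<omega>]) auto
    qed
    ultimately show ?thesis using False l by auto
  qed
  ultimately show ?thesis by simp
qed

text \<open>
  Let \<open>v\<close> be the grid point at or just above \<open>u\<close>, and \<open>v - h\<close> its lower neighbour. Grid points lie
  below \<open>u\<close> exactly if they lie below \<open>v\<close>. After the first two steps the two positions differ only
  if the walk is at a point off the coarse grid and its predecessor is on the other side of \<open>u\<close>.
  Then these two points are \<open>v\<close> and \<open>v - h\<close>, and \<open>w\<close> is the one of them that is off the coarse grid.
\<close>

lemma consecutive_levels:
  assumes \<omega>: "\<omega> \<in> paths" and t: "0 \<le> t"
    and k: "lebesgue_time (Suc m) \<omega> k \<le> ennreal t" "ennreal t < lebesgue_time (Suc m) \<omega> (Suc k)"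
  shows "\<exists>w\<in>dyadic (Suc m). \<exists>e\<in>{-1, 1}.
    \<bar>level_integral (Suc m) \<omega> t u - level_integral m \<omega> t u\<bar> \<le> \<bar>edge_gain (Suc m) w e \<omega> k\<bar> + 3 / 2 ^ Suc m \<and>
    edge_count (Suc m) w e \<omega> k / 2 ^ Suc m \<le> dyadic_local_time (Suc m) \<omega> t (dyadic_ceiling (Suc m) u) +
        2 / 2 ^ Suc m"
proof -
  let ?n = "Suc m"
  let ?x = "skeleton ?n \<omega>" and ?h = "1 / 2 ^ Suc m :: real" and ?v = "dyadic_ceiling ?n u"
  \<comment> \<open>The end point of the edge is the one of \<open>v\<close> and \<open>v - h\<close> that is off the coarse grid.\<close>
  define w where "w = (if ?v \<in> dyadic m then ?v - ?h else ?v)"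
  define e where "e = (if ?v \<in> dyadic m then 1 else -1 :: real)"
  define f where "f i = of_bool (?x i < u) - active_position (lebesgue_time m \<omega>) (\<lambda>j. of_bool (skeleton m \<omega> j
      < u)) (lebesgue_time ?n \<omega> i)" for i
  have v: "?v \<in> dyadic ?n" by (rule dyadic_ceiling_in)
  have w: "w \<in> dyadic ?n" using v dyadic_add_mesh[OF v] by (simp add: w_def)
  have fin: "lebesgue_time ?n \<omega> i < \<infinity>" if "i \<le> k" for i
    using lebesgue_time_finite_mono[OF \<omega> _ that] k(1) by (simp add: le_less_trans)
  have wm: "w \<notin> dyadic m"
  proof
    assume *: "w \<in> dyadic m"
    then have "?v \<in> dyadic m" by (auto simp: w_def split: if_splits)
    then have "1 / 2 ^ m \<le> \<bar>?v - w\<bar>" using * by (intro dyadic_separated) (auto simp: w_def)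
    then show False using \<open>?v \<in> dyadic m\<close> by (simp add: w_def field_simps)
  qed
  have edges: "f i = e * of_bool (edge_visit ?n w e \<omega> i) + 0 * of_bool (edge_visit ?n w e \<omega> i)" if i: "2 \<le> i"
      "i < k" for i
  proof -
    obtain l where l: "i = Suc l" "0 < l" using i by (cases i) auto
    have xi: "?x i \<in> dyadic ?n" and xl: "?x l \<in> dyadic ?n"
      using skeleton_in_dyadic[OF \<omega>, of ?n] fin i l by auto
    have step: "\<bar>?x i - ?x l\<bar> = ?h" using skeleton_step[OF \<omega>, of ?n l] fin[of i] i l by simp
    have sv: "?x i = ?v \<or> ?h \<le> \<bar>?x i - ?v\<bar>" "?x l = ?v \<or> ?h \<le> \<bar>?x l - ?v\<bar>"
      using dyadic_separated[OF xi v] dyadic_separated[OF xl v] by auto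
    have f: "f i = of_bool (?x i < ?v) - of_bool ((if ?x i \<in> dyadic m then ?x i else ?x l) < ?v)"
      unfolding f_def using coarse_position_at_fine_time[OF \<omega> i(1) fin, of "\<lambda>y. of_bool (y < u)"] i l
        dyadic_less_ceiling_iff[OF xi, of u] dyadic_less_ceiling_iff[OF xl, of u] by simp
    have ev: "edge_visit ?n w e \<omega> i \<longleftrightarrow> ?x i = w \<and> ?x l = w + e * ?h"
      using i l fin[of i] by (simp add: edge_visit_def)
    show ?thesis
    proof (cases "?x i \<in> dyadic m")
      case True
      then have "?x i \<noteq> w" using wm by auto
      then show ?thesis using True f ev by simp
    next
      case xim: False
      have xlm: "?x l \<in> dyadic m" by (rule grid_neighbour_coarse[OF xi xl xim step])
      show ?thesis
      proof (cases "?v \<in> dyadic m")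
        case True
        then have "?x i \<noteq> ?v" using xim by auto
        then have "f i = of_bool (?x i = ?v - ?h \<and> ?x l = ?v)"
          using f xim sv step by (auto simp: abs_if split: if_splits)
        then show ?thesis using ev True by (simp add: w_def e_def)
      next
        case False
        then have "?x l \<noteq> ?v" using xlm by auto
        then have "f i = - of_bool (?x i = ?v \<and> ?x l = ?v - ?h)"
          using f xim sv step by (auto simp: abs_if split: if_splits)
        then show ?thesis using ev False by (simp add: w_def e_def)
      qed
    qed
  qed
  have f1: "\<bar>f i\<bar> \<le> 1" for i
  proof (cases "lebesgue_time ?n \<omega> i = \<infinity>")
    case True
    then show ?thesis using active_position_top by (simp add: f_def)
  next
    case False
    define r where "r = enn2real (lebesgue_time ?n \<omega> i)"
    have r: "lebesgue_time ?n \<omega> i = ennreal r" "0 \<le> r" using False by (simp_all add: r_def less_top)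
    obtain j where j: "lebesgue_time m \<omega> j \<le> ennreal r" "ennreal r < lebesgue_time m \<omega> (Suc j)"
      using partition_index[OF lebesgue_partition[OF \<omega>] r(2)] .
    show ?thesis using active_position_eq[OF lebesgue_partition[OF \<omega>] j] r(1) by (simp add: f_def)
  qed
  have "level_integral ?n \<omega> t u - level_integral m \<omega> t u = path_integral (lebesgue_time ?n \<omega>) f \<omega> t"
    unfolding f_def path_integral_diff[OF lebesgue_partition[OF \<omega>] t] level_integral_def
    by (subst path_integral_refine[OF lebesgue_partition[OF \<omega>] lebesgue_partition[OF \<omega>]
        lebesgue_times_nested[OF \<omega>] t]) auto
  also have "\<bar>\<dots>\<bar> \<le> \<bar>e * edge_gain ?n w e \<omega> k + 0 * edge_gain ?n w e \<omega> k\<bar> + 3 / 2 ^ ?n"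
    by (rule path_integral_edges[OF \<omega> t k f1 edges])
  also have "\<bar>e * edge_gain ?n w e \<omega> k + 0 * edge_gain ?n w e \<omega> k\<bar> = \<bar>edge_gain ?n w e \<omega> k\<bar>"
    by (simp add: abs_mult e_def)
  finally have 1: "\<bar>level_integral ?n \<omega> t u - level_integral m \<omega> t u\<bar> \<le> \<bar>edge_gain ?n w e \<omega> k\<bar> + 3 / 2 ^ ?n" .
  have "edge_count ?n w e \<omega> k / 2 ^ ?n \<le> dyadic_local_time ?n \<omega> t ?v + 2 / 2 ^ ?n"
    using edge_count_le[OF \<omega> t k v] unfolding w_def e_def by (cases "?v \<in> dyadic m") simp_all
  moreover have "e \<in> {-1, 1}" by (simp add: e_def)
  ultimately show ?thesis using 1 by (intro bexI[OF _ w] bexI[of _ e] conjI)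
qed

text \<open>
  The difference is the integral of the position that is held while the walk is at \<open>u\<close>, and the walk
  arrives there from above or from below.
\<close>

lemma neighbouring_levels:
  assumes \<omega>: "\<omega> \<in> paths" and t: "0 \<le> t"
    and k: "lebesgue_time n \<omega> k \<le> ennreal t" "ennreal t < lebesgue_time n \<omega> (Suc k)" and u: "u \<in> dyadic n"
  shows "\<bar>level_integral n \<omega> t (u + 1 / 2 ^ n) - level_integral n \<omega> t u\<bar>
    \<le> \<bar>edge_gain n u 1 \<omega> k\<bar> + \<bar>edge_gain n u (-1) \<omega> k\<bar> + 3 / 2 ^ n"
proof -
  let ?x = "skeleton n \<omega>" and ?h = "1 / 2 ^ n :: real"
  define f where "f i = of_bool (?x i < u + ?h) - (of_bool (?x i < u) :: real)" for i
  have fin: "lebesgue_time n \<omega> i < \<infinity>" if "i \<le> k" for i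
    using lebesgue_time_finite_mono[OF \<omega> _ that] k(1) by (simp add: le_less_trans)
  have edges: "f i = 1 * of_bool (edge_visit n u 1 \<omega> i) + 1 * of_bool (edge_visit n u (-1) \<omega> i)" if i: "2 \<le> i"
      "i < k" for i
  proof -
    obtain l where l: "i = Suc l" "0 < l" using i by (cases i) auto
    have xi: "?x i \<in> dyadic n" using skeleton_in_dyadic[OF \<omega>, of n] fin i by auto
    have step: "\<bar>?x i - ?x l\<bar> = ?h" using skeleton_step[OF \<omega>, of n l] fin[of i] i l by simp
    have sv: "?x i = u \<or> ?h \<le> \<bar>?x i - u\<bar>" using dyadic_separated[OF xi u] by auto
    have h: "0 < ?h" by simp
    have ev: "edge_visit n u e \<omega> i \<longleftrightarrow> ?x i = u \<and> ?x l = u + e * ?h" for e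
      using i l fin[of i] by (simp add: edge_visit_def)
    have "?x i < u + ?h \<longleftrightarrow> ?x i < u \<or> ?x i = u" using sv h by (smt (verit))
    then have "f i = of_bool (?x i = u)" by (auto simp: f_def)
    also have "\<dots> = of_bool (?x i = u \<and> ?x l = u + ?h) + of_bool (?x i = u \<and> ?x l = u - ?h)"
      using step h by (auto simp: abs_if split: if_splits)
    finally show ?thesis unfolding ev by simp
  qed
  have "level_integral n \<omega> t (u + ?h) - level_integral n \<omega> t u = path_integral (lebesgue_time n \<omega>) f \<omega> t"
    unfolding f_def path_integral_diff[OF lebesgue_partition[OF \<omega>] t] level_integral_def ..
  also have "\<bar>\<dots>\<bar> \<le> \<bar>1 * edge_gain n u 1 \<omega> k + 1 * edge_gain n u (-1) \<omega> k\<bar> + 3 / 2 ^ n"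
    by (rule path_integral_edges[OF \<omega> t k _ edges]) (auto simp: f_def)
  finally show ?thesis by (simp add: abs_if split: if_splits)
qed

text \<open>
  Only the starting point of the walk can separate \<open>u\<close> from the next grid point.
\<close>

lemma level_integral_ceiling:
  assumes \<omega>: "\<omega> \<in> paths" and t: "0 \<le> t"
  shows "\<bar>level_integral n \<omega> t (dyadic_ceiling n u) - level_integral n \<omega> t u\<bar> \<le> 3 / 2 ^ n"
proof -
  let ?x = "skeleton n \<omega>" and ?v = "dyadic_ceiling n u"
  define f where "f i = of_bool (?x i < ?v) - (of_bool (?x i < u) :: real)" for i
  obtain k where k: "lebesgue_time n \<omega> k \<le> ennreal t" "ennreal t < lebesgue_time n \<omega> (Suc k)"
    using partition_index[OF lebesgue_partition[OF \<omega>] t] .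
  have fin: "lebesgue_time n \<omega> i < \<infinity>" if "i \<le> k" for i
    using lebesgue_time_finite_mono[OF \<omega> _ that] k(1) by (simp add: le_less_trans)
  have edges: "f i = 0 * of_bool (edge_visit n u 1 \<omega> i) + 0 * of_bool (edge_visit n u (-1) \<omega> i)" if i: "2 \<le> i"
      "i < k" for i
    using dyadic_less_ceiling_iff[OF skeleton_in_dyadic[OF \<omega> fin], of i u] i by (simp add: f_def)
  have "level_integral n \<omega> t ?v - level_integral n \<omega> t u = path_integral (lebesgue_time n \<omega>) f \<omega> t"
    unfolding f_def path_integral_diff[OF lebesgue_partition[OF \<omega>] t] level_integral_def ..
  also have "\<bar>\<dots>\<bar> \<le> \<bar>0 * edge_gain n u 1 \<omega> k + 0 * edge_gain n u (-1) \<omega> k\<bar> + 3 / 2 ^ n"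
    by (rule path_integral_edges[OF \<omega> t k _ edges]) (auto simp: f_def)
  finally show ?thesis by simp
qed

section \<open>Self-bounding estimates along a concentrated path\<close>

lemma path_bounded:
  assumes "\<omega> \<in> paths"
  obtains K where "0 \<le> K" "\<And>s. s \<in> {0..T} \<Longrightarrow> \<bar>\<omega> s\<bar> \<le> K"
proof -
  have "bounded (\<omega> ` {0..T})"
    by (intro compact_imp_bounded compact_continuous_image paths_continuous[OF assms]) auto
  then obtain K where "0 < K" "\<And>x. x \<in> \<omega> ` {0..T} \<Longrightarrow> norm x \<le> K" unfolding bounded_pos by blast
  then show ?thesis using that[of K] by auto
qed

lemma skeleton_bounded:
  assumes "\<And>s. s \<in> {0..T} \<Longrightarrow> \<bar>\<omega> s\<bar> \<le> K" "lebesgue_time n \<omega> k \<le> ennreal t" "t \<in> {0..T}"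
  shows "\<bar>skeleton n \<omega> k\<bar> \<le> K"
  using assms by (intro assms(1)) (auto intro: order_trans enn2real_leI)

lemma local_time_bounded:
  assumes \<omega>: "\<omega> \<in> paths" and T: "0 < T"
  shows "\<exists>B. \<forall>t\<in>{0..T}. \<forall>u. \<bar>dyadic_local_time n \<omega> t u\<bar> \<le> B"
proof -
  obtain K where K: "0 \<le> K" "\<And>s. s \<in> {0..T} \<Longrightarrow> \<bar>\<omega> s\<bar> \<le> K" using path_bounded[OF \<omega>] by blast
  note part = lebesgue_partition[OF \<omega>, of n]
  obtain J where J: "lebesgue_time n \<omega> J \<le> ennreal T" "ennreal T < lebesgue_time n \<omega> (Suc J)"
    using partition_index[OF part] T by (metis less_imp_le)
  have "\<bar>dyadic_local_time n \<omega> t u\<bar> \<le> 2 * K + (real J * (2 * K) + 2 * K)" if t: "t \<in> {0..T}" for t u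
  proof -
    have t0: "0 \<le> t" using t by simp
    obtain k where k: "lebesgue_time n \<omega> k \<le> ennreal t" "ennreal t < lebesgue_time n \<omega> (Suc k)"
      using partition_index[OF part t0] .
    have "k \<le> J"
    proof (rule ccontr)
      assume "\<not> k \<le> J"
      then have "lebesgue_time n \<omega> (Suc J) \<le> lebesgue_time n \<omega> k" by (intro partition_mono[OF part]) auto
      also have "\<dots> \<le> ennreal T" using k(1) t by (auto intro: order_trans ennreal_leI)
      finally show False using J(2) by simp
    qed
    let ?x = "skeleton n \<omega>"
    have x: "\<bar>?x i\<bar> \<le> K" if "i \<le> k" for i
      using partition_mono[OF part that] k(1) t by (intro skeleton_bounded[OF K(2)]) (auto intro: order_trans)
    have "\<bar>level_integral n \<omega> t u\<bar> \<le> \<bar>\<Sum>i<k. of_bool (?x i < u) * (?x (Suc i) - ?x i)\<bar> +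
        \<bar>of_bool (?x k < u) * (\<omega> t - ?x k)\<bar>"
      unfolding level_integral_def using k
      by (subst path_integral_local[OF part t0 k(1)]) (auto intro: abs_triangle_ineq)
    also have "\<bar>\<Sum>i<k. of_bool (?x i < u) * (?x (Suc i) - ?x i)\<bar> \<le> (\<Sum>i<k. 2 * K)"
    proof (intro order_trans[OF sum_abs] sum_mono)
      fix i assume "i \<in> {..<k}"
      then show "\<bar>of_bool (?x i < u) * (?x (Suc i) - ?x i)\<bar> \<le> 2 * K" using x[of i] x[of "Suc i"] K(1) by auto
    qed
    also have "\<dots> \<le> real J * (2 * K)" using \<open>k \<le> J\<close> K(1) by (simp add: mult_right_mono)
    also have "\<bar>of_bool (?x k < u) * (\<omega> t - ?x k)\<bar> \<le> 2 * K" using x[of k] K(2)[OF t] K(1) by auto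
    finally have "\<bar>level_integral n \<omega> t u\<bar> \<le> real J * (2 * K) + 2 * K" by simp
    moreover have "\<bar>max (u - \<omega> t) 0 - max (u - \<omega> 0) 0\<bar> \<le> 2 * K"
      using K(2)[OF t] K(2)[of 0] T by (auto simp: max_def abs_if split: if_splits)
    ultimately show ?thesis unfolding discrete_tanaka[OF \<omega> t0] by linarith
  qed
  then show ?thesis by blast
qed

text \<open>
  A discrete Gronwall lemma.
\<close>

lemma bounded_of_perturbed_recursion:
  fixes a \<delta> :: "nat \<Rightarrow> real"
  assumes rec: "\<And>m. N \<le> m \<Longrightarrow> a (Suc m) \<le> (1 + \<delta> m) * a m" and a: "\<And>m. 0 \<le> a m"
    and \<delta>: "\<And>m. 0 \<le> \<delta> m" "summable \<delta>"
  shows "\<exists>B. \<forall>m. a m \<le> B"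
proof -
  have grow: "a m \<le> a N * exp (\<Sum>i<m. \<delta> i)" if "N \<le> m" for m
    using that
  proof (induction m rule: dec_induct)
    case base
    have "1 \<le> exp (\<Sum>i<N. \<delta> i)" using \<delta>(1) by (simp add: sum_nonneg)
    then show ?case using mult_left_mono[OF _ a[of N]] by fastforce
  next
    case (step m)
    have "a (Suc m) \<le> (1 + \<delta> m) * a m" using rec step by simp
    also have "\<dots> \<le> exp (\<delta> m) * (a N * exp (\<Sum>i<m. \<delta> i))"
      using step \<delta>(1)[of m] a by (intro mult_mono exp_ge_add_one_self) auto
    also have "\<dots> = a N * exp (\<Sum>i<Suc m. \<delta> i)" by (simp add: exp_add algebra_simps)
    finally show ?case .
  qed
  have "a m \<le> a N * exp (suminf \<delta>) + (\<Sum>i<N. a i)" for m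
  proof (cases "N \<le> m")
    case True
    have "a m \<le> a N * exp (\<Sum>i<m. \<delta> i)" by (rule grow[OF True])
    also have "\<dots> \<le> a N * exp (suminf \<delta>)"
      using \<delta> a by (intro mult_left_mono) (auto intro: sum_le_suminf)
    finally show ?thesis using a by (simp add: add_increasing2 sum_nonneg)
  next
    case False
    then have "a m \<le> (\<Sum>i<N. a i)" using a by (intro member_le_sum) auto
    then show ?thesis using a by (simp add: add_increasing)
  qed
  then show ?thesis by blast
qed

text \<open>
  The restriction to \<open>|w| \<le> n\<close> disappears for large \<open>n\<close>, because a path does not reach the other
  edges by time \<open>T\<close>.
\<close>

lemma edge_gain_le_of_concentrated:
  assumes \<omega>: "\<omega> \<in> paths" and conc: "concentrated \<omega>" and T: "0 < T"
  obtains N where "\<And>n w e k t. N \<le> n \<Longrightarrow> w \<in> dyadic n \<Longrightarrow> e \<in> {-1, 1} \<Longrightarrow> t \<in> {0..T} \<Longrightarrow>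
    lebesgue_time n \<omega> k \<le> ennreal t \<Longrightarrow>
    \<bar>edge_gain n w e \<omega> k\<bar> \<le> (64 * real n + 2 * edge_count n w e \<omega> k / 2 ^ n) / sqrt (2 ^ n)"
proof -
  obtain K where K: "0 \<le> K" "\<And>s. s \<in> {0..T} \<Longrightarrow> \<bar>\<omega> s\<bar> \<le> K" using path_bounded[OF \<omega>] by blast
  obtain K' :: nat where K': "K \<le> real K'" using real_arch_simple by blast
  from conc obtain n0 where n0: "\<And>n w e k. n0 \<le> n \<Longrightarrow> w \<in> dyadic n \<Longrightarrow> \<bar>w\<bar> \<le> real n \<Longrightarrow> e \<in> {-1, 1}
      \<Longrightarrow> lebesgue_time n \<omega> k < \<infinity> \<Longrightarrow>
     \<bar>edge_gain n w e \<omega> k\<bar> \<le> (64 * real n + 2 * edge_count n w e \<omega> k / 2 ^ n) / sqrt (2 ^ n)"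
    unfolding concentrated_def by blast
  show ?thesis
  proof (rule that[of "max n0 K'"])
    fix n w and e :: real and k t assume *: "max n0 K' \<le> n" "w \<in> dyadic n" "e \<in> {-1, 1}" "t \<in> {0..T}"
        "lebesgue_time n \<omega> k \<le> ennreal t"
    show "\<bar>edge_gain n w e \<omega> k\<bar> \<le> (64 * real n + 2 * edge_count n w e \<omega> k / 2 ^ n) / sqrt (2 ^ n)"
    proof (cases "\<bar>w\<bar> \<le> real n")
      case True
      then show ?thesis using * by (intro n0) (auto simp: le_less_trans)
    next
      case False
      have "\<not> edge_visit n w e \<omega> i" if "i < k" for i
      proof
        assume "edge_visit n w e \<omega> i"
        then have "skeleton n \<omega> i = w" by (simp add: edge_visit_def)
        moreover have "lebesgue_time n \<omega> i \<le> ennreal t"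
          using partition_mono[OF lebesgue_partition[OF \<omega>], of i k n] that *(5) by simp
        then have "\<bar>skeleton n \<omega> i\<bar> \<le> K" using skeleton_bounded[of T \<omega> K n i t] K(2) *(4) by blast
        moreover have "real K' \<le> real n" using *(1) by simp
        ultimately show False using False K' by linarith
      qed
      then have "edge_gain n w e \<omega> k = 0" unfolding edge_gain_def by (intro sum.neutral) auto
      moreover have "0 \<le> edge_count n w e \<omega> k" unfolding edge_count_def by (intro sum_nonneg) auto
      ultimately show ?thesis by simp
    qed
  qed
qed

lemma summable_linear_geometric: "\<bar>x\<bar> < 1 \<Longrightarrow> summable (\<lambda>n. (real n + 1) * x ^ n)"
  using geometric_deriv_sums[of x] by (auto simp: sums_iff algebra_simps)

lemma inverse_sqrt_power: "1 / sqrt (2 ^ n) = (1 / sqrt 2) ^ n"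
  by (simp add: real_sqrt_power power_one_over)

lemma inverse_pow2_le: "1 / 2 ^ n \<le> 1 / sqrt (2 ^ n :: real)"
proof -
  have "(2 ^ n :: real) \<le> (2 ^ n)\<^sup>2" by (intro self_le_power) auto
  then have "sqrt (2 ^ n) \<le> (2 ^ n :: real)" by (intro real_le_lsqrt) auto
  then show ?thesis by (intro divide_left_mono) auto
qed

text \<open>
  The number of passages is bounded by the local time itself, so that the supremum \<open>A\<close> of the local
  times appears on both sides of the estimate for consecutive levels, but with a small factor on the
  finer level. This gives a recursion for \<open>A\<close> with summable perturbations, and once \<open>A\<close> is bounded
  the two other estimates follow.
\<close>

theorem local_time_rough_estimates:
  assumes \<omega>: "\<omega> \<in> paths" and conc: "concentrated \<omega>" and T: "0 < T"
  obtains B N where "0 \<le> B"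
    "\<And>n t u. t \<in> {0..T} \<Longrightarrow> \<bar>dyadic_local_time n \<omega> t u\<bar> \<le> B"
    "\<And>m t u. N \<le> m \<Longrightarrow> t \<in> {0..T} \<Longrightarrow>
       \<bar>dyadic_local_time (Suc m) \<omega> t u - dyadic_local_time m \<omega> t u\<bar>
           \<le> B * (real (Suc m) * (1 / sqrt 2) ^ Suc m)"
    "\<And>n t u. N \<le> n \<Longrightarrow> t \<in> {0..T} \<Longrightarrow> u \<in> dyadic n \<Longrightarrow>
       \<bar>level_integral n \<omega> t (u + 1 / 2 ^ n) - level_integral n \<omega> t u\<bar> \<le> B * (real n * (1 / sqrt 2) ^ n)"
proof -
  define A where "A n = (SUP p \<in> {0..T} \<times> (UNIV :: real set). dyadic_local_time n \<omega> (fst p) (snd p))" for n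
  define q :: "nat \<Rightarrow> real" where "q n = (1 / sqrt 2) ^ n" for n
  have q0: "0 < q n" for n by (simp add: q_def)
  have qs: "1 / sqrt (2 ^ n) = q n" for n by (simp add: q_def inverse_sqrt_power)
  have hq: "1 / 2 ^ n \<le> q n" for n using inverse_pow2_le[of n] qs by simp
  have bdd: "bdd_above ((\<lambda>p. dyadic_local_time n \<omega> (fst p) (snd p)) ` ({0..T} \<times> UNIV))" for n
  proof -
    obtain B where "\<forall>t\<in>{0..T}. \<forall>u. \<bar>dyadic_local_time n \<omega> t u\<bar> \<le> B" using local_time_bounded[OF \<omega> T] by blast
    then show ?thesis by (intro bdd_aboveI[of _ B]) (auto simp: abs_le_iff)
  qed
  have L_le: "dyadic_local_time n \<omega> t u \<le> A n" if "t \<in> {0..T}" for n t u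
    unfolding A_def using cSUP_upper[OF _ bdd, of "(t, u)" n] that by simp
  have L_ge: "0 \<le> dyadic_local_time n \<omega> t u" if "t \<in> {0..T}" for n t u
    using that by (intro dyadic_local_time_nonneg[OF \<omega>]) auto
  have A0: "0 \<le> A n" for n using L_ge[of T n 0] L_le[of T n 0] T by simp
  obtain N where N: "\<And>n w e k t. N \<le> n \<Longrightarrow> w \<in> dyadic n \<Longrightarrow> e \<in> {-1, 1} \<Longrightarrow> t \<in> {0..T} \<Longrightarrow>
    lebesgue_time n \<omega> k \<le> ennreal t \<Longrightarrow>
    \<bar>edge_gain n w e \<omega> k\<bar> \<le> (64 * real n + 2 * edge_count n w e \<omega> k / 2 ^ n) / sqrt (2 ^ n)"
    using edge_gain_le_of_concentrated[OF \<omega> conc T] by blast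
  have gain: "\<bar>edge_gain n w e \<omega> k\<bar> \<le> (64 * real n + 4 + 2 * A n) * q n"
    if "N \<le> n" "w \<in> dyadic n" "e \<in> {-1, 1}" "t \<in> {0..T}" "lebesgue_time n \<omega> k \<le> ennreal t"
      "edge_count n w e \<omega> k / 2 ^ n \<le> dyadic_local_time n \<omega> t v + 2 / 2 ^ n" for n w e k t v
  proof -
    have "2 / 2 ^ n \<le> (2::real)" by (simp add: field_simps)
    then have "edge_count n w e \<omega> k / 2 ^ n \<le> A n + 2" using that(6) L_le[OF that(4), of n v] by linarith
    then have "64 * real n + 2 * edge_count n w e \<omega> k / 2 ^ n \<le> 64 * real n + 4 + 2 * A n" by simp
    then have "(64 * real n + 2 * edge_count n w e \<omega> k / 2 ^ n) / sqrt (2 ^ n)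
        \<le> (64 * real n + 4 + 2 * A n) / sqrt (2 ^ n)"
      by (intro divide_right_mono) auto
    also have "\<dots> = (64 * real n + 4 + 2 * A n) * q n" by (simp flip: qs)
    finally show ?thesis using N[OF that(1-5)] by linarith
  qed
  have succ: "\<bar>dyadic_local_time (Suc m) \<omega> t u - dyadic_local_time m \<omega> t u\<bar>
      \<le> (64 * real (Suc m) + 7 + 2 * A (Suc m)) * q (Suc m)"
    if "N \<le> m" "t \<in> {0..T}" for m t u
  proof -
    have t0: "0 \<le> t" using that by simp
    obtain k where k: "lebesgue_time (Suc m) \<omega> k \<le> ennreal t" "ennreal t < lebesgue_time (Suc m) \<omega> (Suc k)"
      using partition_index[OF lebesgue_partition[OF \<omega>] t0] .
    obtain w e where we: "w \<in> dyadic (Suc m)" "e \<in> {-1, 1}"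
      "\<bar>level_integral (Suc m) \<omega> t u - level_integral m \<omega> t u\<bar> \<le> \<bar>edge_gain (Suc m) w e \<omega> k\<bar> + 3 / 2 ^ Suc m"
      "edge_count (Suc m) w e \<omega> k / 2 ^ Suc m \<le> dyadic_local_time (Suc m) \<omega> t (dyadic_ceiling (Suc m) u) +
          2 / 2 ^ Suc m"
      using consecutive_levels[OF \<omega> t0 k, of u] by blast
    have "\<bar>edge_gain (Suc m) w e \<omega> k\<bar> \<le> (64 * real (Suc m) + 4 + 2 * A (Suc m)) * q (Suc m)"
      using that by (intro gain[OF _ we(1,2) that(2) k(1) we(4)]) auto
    moreover have "3 / 2 ^ Suc m \<le> 3 * q (Suc m)" using hq[of "Suc m"] by simp
    ultimately have "\<bar>level_integral (Suc m) \<omega> t u - level_integral m \<omega> t u\<bar>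
        \<le> (64 * real (Suc m) + 7 + 2 * A (Suc m)) * q (Suc m)"
      using we(3) by (simp add: algebra_simps del: power_Suc of_nat_Suc)
    then show ?thesis unfolding discrete_tanaka[OF \<omega> t0] by simp
  qed
  define \<delta> where "\<delta> m = 4 * q (Suc m) + 2 * q (Suc m) * (64 * real (Suc m) + 7)" for m
  have rec: "A (Suc m) + 1 \<le> (1 + \<delta> m) * (A m + 1)" if m: "max N 4 \<le> m" for m
  proof -
    define Q where "Q = q (Suc m)"
    define D where "D = 64 * real (Suc m) + 7"
    have Q: "0 < Q" "Q \<le> 1 / 4"
    proof -
      have "sqrt 2 ^ 4 \<le> sqrt 2 ^ Suc m" using m by (intro power_increasing) auto
      also have "sqrt 2 ^ 4 = (4 :: real)" by (simp add: power4_eq_xxxx)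
      finally show "Q \<le> 1 / 4" unfolding Q_def q_def power_one_over by (intro divide_left_mono) auto
    qed (simp add: Q_def q0)
    have "D \<ge> 0" by (simp add: D_def)
    have "A (Suc m) \<le> A m + (D + 2 * A (Suc m)) * Q"
      unfolding A_def[of "Suc m"]
    proof (rule cSUP_least)
      fix p assume "p \<in> {0..T} \<times> (UNIV :: real set)"
      then have p: "fst p \<in> {0..T}" by auto
      show "dyadic_local_time (Suc m) \<omega> (fst p) (snd p)
          \<le> A m + (D + 2 * (SUP p \<in> {0..T} \<times> (UNIV :: real set). dyadic_local_time (Suc m) \<omega> (fst p) (snd p)))
          * Q"
        using succ[OF _ p, of m "snd p"] m L_le[OF p, of m "snd p"]
          unfolding Q_def D_def A_def[of "Suc m", symmetric]
        by (simp del: of_nat_Suc)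
    qed (use T in auto)
    then have 1: "A (Suc m) * (1 - 2 * Q) \<le> A m + D * Q" by (simp add: algebra_simps)
    \<comment> \<open>This solves the inequality for \<open>A (Suc m)\<close>, which is also on its right-hand side.\<close>
    have 2: "1 \<le> (1 + 4 * Q) * (1 - 2 * Q)" using Q by (simp add: algebra_simps)
    have "A (Suc m) \<le> A (Suc m) * ((1 + 4 * Q) * (1 - 2 * Q))" using mult_left_mono[OF 2 A0[of "Suc m"]] by simp
    also have "\<dots> = (1 + 4 * Q) * (A (Suc m) * (1 - 2 * Q))" by simp
    also have "\<dots> \<le> (1 + 4 * Q) * (A m + D * Q)" using 1 Q by (intro mult_left_mono) auto
    also have "\<dots> \<le> (1 + 4 * Q) * A m + 2 * (D * Q)"
      using mult_right_mono[of "1 + 4 * Q" 2 "D * Q"] Q \<open>D \<ge> 0\<close> by (simp add: distrib_left)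
    finally have "A (Suc m) + 1 \<le> (1 + 4 * Q) * A m + 2 * (D * Q) + 1" by simp
    also have "\<dots> \<le> (1 + (4 * Q + 2 * Q * D)) * (A m + 1)"
      using Q \<open>D \<ge> 0\<close> A0[of m] by (simp add: algebra_simps)
    finally show ?thesis by (simp add: \<delta>_def Q_def D_def)
  qed
  have "summable \<delta>"
  proof (rule summable_comparison_test_ev)
    have x: "\<bar>1 / sqrt 2 :: real\<bar> < 1" by simp
    \<comment> \<open>Here \<open>146 = 4 + 2 \<cdot> (64 + 7)\<close>.\<close>
    show "summable (\<lambda>m. 146 * ((real m + 1) * (1 / sqrt 2) ^ m))"
      by (intro summable_mult summable_linear_geometric x)
    have "norm (\<delta> m) \<le> 146 * ((real m + 1) * (1 / sqrt 2) ^ m)" for m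
    proof -
      have "q (Suc m) \<le> (1 / sqrt 2) ^ m" unfolding q_def by (intro power_decreasing) auto
      then have "\<delta> m \<le> (4 + 2 * (64 * real (Suc m) + 7)) * (1 / sqrt 2) ^ m"
        unfolding \<delta>_def using mult_left_mono[of "q (Suc m)" "(1 / sqrt 2) ^ m"
            "4 + 2 * (64 * real (Suc m) + 7)"]
        by (simp add: algebra_simps)
      also have "\<dots> \<le> (146 * (real m + 1)) * (1 / sqrt 2) ^ m" by (intro mult_right_mono) auto
      finally show ?thesis using q0[of "Suc m"] by (simp add: \<delta>_def algebra_simps)
    qed
    then show "\<forall>\<^sub>F m in sequentially. norm (\<delta> m) \<le> 146 * ((real m + 1) * (1 / sqrt 2) ^ m)" by simp
  qed
  then obtain B where B: "\<And>m. A m + 1 \<le> B"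
    using bounded_of_perturbed_recursion[of "max N 4" "\<lambda>m. A m + 1" \<delta>, OF rec] A0 q0
    by (force simp: \<delta>_def less_imp_le)
  have B0: "1 \<le> B" using B[of 0] A0[of 0] by simp
  show ?thesis
  proof (rule that[of "200 * B" "max N 1"])
    show "0 \<le> 200 * B" using B0 by simp
    show "\<bar>dyadic_local_time n \<omega> t u\<bar> \<le> 200 * B" if "t \<in> {0..T}" for n t u
      using L_le[OF that, of n u] L_ge[OF that, of n u] B[of n] B0 by simp
    \<comment> \<open>Everything is absorbed into a multiple of \<open>n\<close>; the constants are generous.\<close>
    have coeff: "64 * real n + 7 + 2 * A n \<le> 80 * B * real n" if "1 \<le> n" for n
    proof -
      have n1: "1 \<le> real n" using that by simp
      have "64 * real n + 7 + 2 * A n \<le> 64 * real n + 7 * real n + 2 * B * real n"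
        using n1 B[of n] B0 mult_left_mono[OF n1, of "2 * B"] by linarith
      also have "\<dots> \<le> 80 * B * real n" using B0 n1 mult_right_mono[OF B0, of "real n"] by simp
      finally show ?thesis .
    qed
    show "\<bar>dyadic_local_time (Suc m) \<omega> t u - dyadic_local_time m \<omega> t u\<bar>
        \<le> 200 * B * (real (Suc m) * (1 / sqrt 2) ^ Suc m)"
      if "max N 1 \<le> m" "t \<in> {0..T}" for m t u
    proof -
      have "\<bar>dyadic_local_time (Suc m) \<omega> t u - dyadic_local_time m \<omega> t u\<bar>
          \<le> (64 * real (Suc m) + 7 + 2 * A (Suc m)) * q (Suc m)"
        using that by (intro succ) auto
      also have "\<dots> \<le> (200 * B * real (Suc m)) * q (Suc m)"
      proof (intro mult_right_mono)
        have "0 \<le> B * real (Suc m)" using B0 by simp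
        then show "64 * real (Suc m) + 7 + 2 * A (Suc m) \<le> 200 * B * real (Suc m)"
          using coeff[of "Suc m"] unfolding mult.assoc by linarith
      qed (use q0[of "Suc m"] in simp)
      finally show ?thesis by (simp add: q_def)
    qed
    show "\<bar>level_integral n \<omega> t (u + 1 / 2 ^ n) - level_integral n \<omega> t u\<bar>
        \<le> 200 * B * (real n * (1 / sqrt 2) ^ n)"
      if n: "max N 1 \<le> n" and t: "t \<in> {0..T}" and u: "u \<in> dyadic n" for n t u
    proof -
      have t0: "0 \<le> t" using t by simp
      obtain k where k: "lebesgue_time n \<omega> k \<le> ennreal t" "ennreal t < lebesgue_time n \<omega> (Suc k)"
        using partition_index[OF lebesgue_partition[OF \<omega>] t0] .
      have g1: "\<bar>edge_gain n u 1 \<omega> k\<bar> \<le> (64 * real n + 4 + 2 * A n) * q n"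
        using n edge_count_down_le[OF \<omega> t0 k dyadic_add_mesh(1)[OF u]] by (intro gain[OF _ u _ t k(1)]) auto
      have g2: "\<bar>edge_gain n u (-1) \<omega> k\<bar> \<le> (64 * real n + 4 + 2 * A n) * q n"
        using n edge_count_up_le[OF \<omega> t0 k u] by (intro gain[OF _ u _ t k(1)]) auto
      have "\<bar>level_integral n \<omega> t (u + 1 / 2 ^ n) - level_integral n \<omega> t u\<bar>
          \<le> 2 * ((64 * real n + 4 + 2 * A n) * q n) + 3 * q n"
        using neighbouring_levels[OF \<omega> t0 k u] g1 g2 hq[of n] by simp
      also have "\<dots> \<le> 2 * ((64 * real n + 7 + 2 * A n) * q n)" using q0[of n] by (simp add: algebra_simps)
      also have "\<dots> \<le> 2 * ((80 * B * real n) * q n)"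
        using coeff[of n] n q0[of n] by (intro mult_left_mono mult_right_mono) auto
      also have "\<dots> \<le> 200 * B * (real n * q n)" using B0 q0[of n] by simp
      finally show ?thesis by (simp add: q_def)
    qed
  qed
qed

text \<open>
  The factor \<open>n\<close> is absorbed by passing from the exponent \<open>1/2\<close> to \<open>\<beta>\<close>, and the finitely many levels
  before the estimates take effect by enlarging the constant.
\<close>

lemma local_time_estimates:
  assumes \<omega>: "\<omega> \<in> paths" and conc: "concentrated \<omega>" and T: "0 < T" and \<beta>: "0 < \<beta>" "\<beta> < 1 / 2"
  obtains C where "0 < C"
    "\<And>n t u. t \<in> {0..T} \<Longrightarrow> \<bar>dyadic_local_time n \<omega> t u\<bar> \<le> C"
    "\<And>n t u. t \<in> {0..T} \<Longrightarrow>
       \<bar>dyadic_local_time (Suc n) \<omega> t u - dyadic_local_time n \<omega> t u\<bar> \<le> C * (2 powr - \<beta>) ^ n"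
    "\<And>n t u. t \<in> {0..T} \<Longrightarrow> u \<in> dyadic n \<Longrightarrow>
       \<bar>level_integral n \<omega> t (u + 1 / 2 ^ n) - level_integral n \<omega> t u\<bar> \<le> C * (2 powr - \<beta>) ^ n"
proof -
  define \<rho> :: real where "\<rho> = 2 powr - \<beta>"
  have \<rho>: "0 < \<rho>" "\<rho> < 1" using \<beta> by (simp_all add: \<rho>_def powr_less_one)
  define x where "x = (1 / sqrt 2) / \<rho>"
  have sq: "1 / sqrt 2 = (2::real) powr (- 1/2)" by (simp add: powr_minus powr_half_sqrt field_simps)
  have "x = 2 powr (\<beta> - 1 / 2)" unfolding x_def \<rho>_def sq by (simp flip: powr_diff add: algebra_simps)
  then have x: "\<bar>x\<bar> < 1" using \<beta> by (simp add: powr_less_one)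
  have "Bseq (\<lambda>n. (real n + 1) * x ^ n)"
    using summable_LIMSEQ_zero[OF summable_linear_geometric[OF x]]
      by (auto intro: convergent_imp_Bseq convergentI)
  then obtain D where D: "0 < D" "\<And>n. \<bar>(real n + 1) * x ^ n\<bar> \<le> D" by (auto elim: BseqE)
  have geo: "real n * (1 / sqrt 2) ^ n \<le> D * \<rho> ^ n" for n
  proof -
    have eq: "(1 / sqrt 2) ^ n = x ^ n * \<rho> ^ n" using \<rho>(1) by (simp add: x_def flip: power_mult_distrib)
    have "real n * (1 / sqrt 2) ^ n \<le> (real n + 1) * (1 / sqrt 2) ^ n" by (intro mult_right_mono) auto
    also have "\<dots> \<le> D * \<rho> ^ n"
      unfolding eq using D(2)[of n] \<rho>(1) by (simp add: mult.assoc[symmetric] mult_right_mono abs_le_iff)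
    finally show ?thesis .
  qed
  obtain B N where B: "0 \<le> B"
    "\<And>n t u. t \<in> {0..T} \<Longrightarrow> \<bar>dyadic_local_time n \<omega> t u\<bar> \<le> B"
    "\<And>m t u. N \<le> m \<Longrightarrow> t \<in> {0..T} \<Longrightarrow>
       \<bar>dyadic_local_time (Suc m) \<omega> t u - dyadic_local_time m \<omega> t u\<bar>
           \<le> B * (real (Suc m) * (1 / sqrt 2) ^ Suc m)"
    "\<And>n t u. N \<le> n \<Longrightarrow> t \<in> {0..T} \<Longrightarrow> u \<in> dyadic n \<Longrightarrow>
       \<bar>level_integral n \<omega> t (u + 1 / 2 ^ n) - level_integral n \<omega> t u\<bar> \<le> B * (real n * (1 / sqrt 2) ^ n)"
    using local_time_rough_estimates[OF \<omega> conc T] by metis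
  obtain K where K: "0 \<le> K" "\<And>s. s \<in> {0..T} \<Longrightarrow> \<bar>\<omega> s\<bar> \<le> K" using path_bounded[OF \<omega>] by blast
  have I_le: "\<bar>level_integral n \<omega> t u\<bar> \<le> B + 2 * K" if "t \<in> {0..T}" for n t u
  proof -
    have "\<bar>max (u - \<omega> t) 0 - max (u - \<omega> 0) 0\<bar> \<le> 2 * K"
      using K(2)[OF that] K(2)[of 0] T by (auto simp: max_def abs_if split: if_splits)
    moreover have "dyadic_local_time n \<omega> t u = max (u - \<omega> t) 0 - max (u - \<omega> 0) 0 + level_integral n \<omega> t u"
      using that by (intro discrete_tanaka[OF \<omega>]) auto
    ultimately show ?thesis using B(2)[OF that, of n u] by linarith
  qed
  \<comment> \<open>The third summand takes care of the levels below \<open>N\<close>.\<close>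
  define C where "C = B * D + B + 2 * (B + 2 * K) / \<rho> ^ N + 1"
  have C: "0 < C" "B \<le> C" "B * D \<le> C" "2 * (B + 2 * K) / \<rho> ^ N \<le> C"
    using B(1) D(1) K(1) \<rho>(1) by (simp_all add: C_def add_nonneg_pos)
  have small: "2 * (B + 2 * K) \<le> C * \<rho> ^ n" if "n \<le> N" for n
  proof -
    have "2 * (B + 2 * K) \<le> C * \<rho> ^ N" using C(4) \<rho>(1) by (simp add: field_simps)
    also have "\<dots> \<le> C * \<rho> ^ n" using C(1) \<rho> that by (intro mult_left_mono power_decreasing) auto
    finally show ?thesis .
  qed
  show ?thesis
  proof (rule that[OF C(1)], unfold \<rho>_def[symmetric])
    show "\<bar>dyadic_local_time n \<omega> t u\<bar> \<le> C" if "t \<in> {0..T}" for n t u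
      using B(2)[OF that, of n u] C(2) by simp
    show "\<bar>dyadic_local_time (Suc n) \<omega> t u - dyadic_local_time n \<omega> t u\<bar> \<le> C * \<rho> ^ n" if t: "t \<in> {0..T}"
        for n t u
    proof (cases "N \<le> n")
      case True
      have "\<bar>dyadic_local_time (Suc n) \<omega> t u - dyadic_local_time n \<omega> t u\<bar>
          \<le> B * (real (Suc n) * (1 / sqrt 2) ^ Suc n)"
        by (rule B(3)[OF True t])
      also have "\<dots> \<le> B * (D * \<rho> ^ Suc n)" by (rule mult_left_mono[OF geo B(1)])
      also have "\<dots> \<le> B * D * \<rho> ^ n"
        using \<rho> B(1) D(1) power_Suc_le_self[of \<rho> n] by (simp add: mult.assoc mult_left_mono del: power_Suc)
      also have "\<dots> \<le> C * \<rho> ^ n" using C(3) \<rho>(1) by (intro mult_right_mono) auto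
      finally show ?thesis .
    next
      case False
      then show ?thesis using B(2)[OF t, of "Suc n" u] B(2)[OF t, of n u] small[of n] K(1) by simp
    qed
    show "\<bar>level_integral n \<omega> t (u + 1 / 2 ^ n) - level_integral n \<omega> t u\<bar> \<le> C * \<rho> ^ n"
      if t: "t \<in> {0..T}" and u: "u \<in> dyadic n" for n t u
    proof (cases "N \<le> n")
      case True
      have "\<bar>level_integral n \<omega> t (u + 1 / 2 ^ n) - level_integral n \<omega> t u\<bar> \<le> B * (real n * (1 / sqrt 2) ^ n)"
        by (rule B(4)[OF True t u])
      also have "\<dots> \<le> B * (D * \<rho> ^ n)" using geo B(1) by (intro mult_left_mono) auto
      also have "\<dots> \<le> C * \<rho> ^ n" using C(3) \<rho>(1) by (simp add: mult_right_mono flip: mult.assoc)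
      finally show ?thesis .
    next
      case False
      then show ?thesis using I_le[OF t, of n u] I_le[OF t, of n "u + 1 / 2 ^ n"] small[of n] K(1) by simp
    qed
  qed
qed

section \<open>The limit and its Hoelder regularity\<close>

lemma geometric_increments:
  fixes f :: "nat \<Rightarrow> real"
  assumes step: "\<And>n. \<bar>f (Suc n) - f n\<bar> \<le> C * \<rho> ^ n" and \<rho>: "0 < \<rho>" "\<rho> < 1" and C: "0 \<le> C" and "m \<le> n"
  shows "\<bar>f n - f m\<bar> \<le> C / (1 - \<rho>) * \<rho> ^ m"
proof -
  have "\<bar>f n - f m\<bar> \<le> C / (1 - \<rho>) * (\<rho> ^ m - \<rho> ^ n)"
    using \<open>m \<le> n\<close>
  proof (induction n rule: dec_induct)
    case (step n)
    have "C / (1 - \<rho>) * (\<rho> ^ n - \<rho> ^ Suc n) = C * \<rho> ^ n" using \<rho> by (simp add: field_simps)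
    then have "C / (1 - \<rho>) * (\<rho> ^ m - \<rho> ^ Suc n) = C / (1 - \<rho>) * (\<rho> ^ m - \<rho> ^ n) + C * \<rho> ^ n"
      by (simp add: right_diff_distrib)
    then show ?case using step.IH assms(1)[of n] by linarith
  qed simp
  also have "\<dots> \<le> C / (1 - \<rho>) * \<rho> ^ m" using \<rho> C by (intro mult_left_mono) auto
  finally show ?thesis .
qed

lemma geometric_increments_limit:
  fixes f :: "nat \<Rightarrow> real"
  assumes step: "\<And>n. \<bar>f (Suc n) - f n\<bar> \<le> C * \<rho> ^ n" and \<rho>: "0 < \<rho>" "\<rho> < 1" and C: "0 \<le> C"
  shows "f \<longlonglongrightarrow> lim f" "\<bar>f m - lim f\<bar> \<le> C / (1 - \<rho>) * \<rho> ^ m"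
proof -
  have "summable (\<lambda>n. f (Suc n) - f n)"
  proof (rule summable_comparison_test_ev)
    show "summable (\<lambda>n. C * \<rho> ^ n)" using \<rho> by (intro summable_mult summable_geometric) simp
  qed (use step in auto)
  then have "convergent (\<lambda>n. \<Sum>i<n. f (Suc i) - f i)" by (simp add: summable_iff_convergent)
  then have "convergent (\<lambda>n. f n - f 0)" by (simp add: sum_lessThan_telescope)
  then have "convergent (\<lambda>n. f 0 + (f n - f 0))" by (intro convergent_add convergent_const)
  then show lim: "f \<longlonglongrightarrow> lim f" by (simp add: convergent_LIMSEQ_iff)
  have "\<bar>lim f - f m\<bar> \<le> C / (1 - \<rho>) * \<rho> ^ m"
  proof (rule tendsto_upperbound)
    show "(\<lambda>n. \<bar>f n - f m\<bar>) \<longlonglongrightarrow> \<bar>lim f - f m\<bar>" by (intro tendsto_intros lim)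
    show "\<forall>\<^sub>F n in sequentially. \<bar>f n - f m\<bar> \<le> C / (1 - \<rho>) * \<rho> ^ m"
      using eventually_ge_at_top[of m] by eventually_elim (rule geometric_increments[OF assms])
  qed simp
  then show "\<bar>f m - lim f\<bar> \<le> C / (1 - \<rho>) * \<rho> ^ m" by (simp add: abs_minus_commute)
qed

text \<open>
  The scale \<open>m\<close> on which two points at distance \<open>d\<close> should be compared.
\<close>

lemma dyadic_scale:
  fixes d \<beta> :: real
  assumes d: "0 < d" "d \<le> 1" and \<beta>: "0 < \<beta>" "\<beta> \<le> 1"
  obtains m :: nat where "1 / 2 ^ Suc m < d" "d \<le> 1 / 2 ^ m" "(2 powr - \<beta>) ^ m \<le> 2 * d powr \<beta>"
proof -
  define m where "m = nat \<lfloor>- log 2 d\<rfloor>"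
  have "0 \<le> - log 2 d" using d by (simp add: log_le_zero_cancel_iff)
  then have m: "real m \<le> - log 2 d" "- log 2 d < real m + 1" unfolding m_def by linarith+
  have pow: "1 / 2 ^ k = 2 powr (- real k)" for k :: nat by (simp add: powr_minus powr_realpow divide_inverse)
  have dd: "d = 2 powr (log 2 d)" using d by simp
  have lo: "1 / 2 ^ Suc m < d" unfolding pow using m(2) by (subst dd) (simp del: powr_log_cancel)
  have hi: "d \<le> 1 / 2 ^ m" unfolding pow using m(1) by (subst dd) (simp del: powr_log_cancel)
  have "(2 powr - \<beta>) ^ m = (2 powr - \<beta>) powr real m" by (simp add: powr_realpow)
  also have "\<dots> = (2 powr - real m) powr \<beta>" by (simp add: powr_powr mult.commute)
  also have "\<dots> = (1 / 2 ^ m) powr \<beta>" by (simp only: pow)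
  also have "\<dots> \<le> (2 * d) powr \<beta>" using lo \<beta> d by (intro powr_mono2) (auto simp: field_simps)
  also have "\<dots> = 2 powr \<beta> * d powr \<beta>" using d by (simp add: powr_mult)
  also have "\<dots> \<le> 2 powr 1 * d powr \<beta>" using \<beta> by (intro mult_right_mono powr_mono) auto
  finally have "(2 powr - \<beta>) ^ m \<le> 2 * d powr \<beta>" by simp
  then show ?thesis using that lo hi by blast
qed

lemma dyadic_ceiling_mono: "u \<le> v \<Longrightarrow> dyadic_ceiling n u \<le> dyadic_ceiling n v"
  unfolding dyadic_ceiling_def by (intro divide_right_mono) (auto intro!: ceiling_mono mult_right_mono)

lemma dyadic_ceiling_neighbour:
  assumes "u \<le> v" "v \<le> u + 1 / 2 ^ n"
  shows "dyadic_ceiling n v = dyadic_ceiling n u \<or> dyadic_ceiling n v = dyadic_ceiling n u + 1 / 2 ^ n"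
proof -
  have "v * 2 ^ n \<le> u * 2 ^ n + 1" "u * 2 ^ n \<le> v * 2 ^ n" using assms by (simp_all add: field_simps)
  then have "\<lceil>v * 2 ^ n\<rceil> = \<lceil>u * 2 ^ n\<rceil> \<or> \<lceil>v * 2 ^ n\<rceil> = \<lceil>u * 2 ^ n\<rceil> + 1" by linarith
  then show ?thesis unfolding dyadic_ceiling_def by (auto simp: add_divide_distrib)
qed

text \<open>
  Two heights at distance at most \<open>2\<^sup>-\<^sup>m\<close> are at most one grid step apart on level \<open>m\<close>, and passing
  from level \<open>m\<close> to a finer one costs a geometric sum that is dominated by its first term.
\<close>

lemma level_integral_scale:
  assumes \<omega>: "\<omega> \<in> paths" and t: "0 \<le> t" and \<beta>: "0 < \<beta>" "\<beta> < 1 / 2" and C: "0 < C"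
    and succ: "\<And>n u. \<bar>dyadic_local_time (Suc n) \<omega> t u - dyadic_local_time n \<omega> t u\<bar> \<le> C * (2 powr - \<beta>) ^ n"
    and near: "\<And>n u. u \<in> dyadic n \<Longrightarrow>
       \<bar>level_integral n \<omega> t (u + 1 / 2 ^ n) - level_integral n \<omega> t u\<bar> \<le> C * (2 powr - \<beta>) ^ n"
    and mn: "m \<le> n" and uv: "\<bar>u - v\<bar> \<le> 1 / 2 ^ m"
  shows "\<bar>level_integral n \<omega> t u - level_integral n \<omega> t v\<bar>
      \<le> (2 * (C / (1 - 2 powr - \<beta>)) + C + 6) * (2 powr - \<beta>) ^ m"
proof -
  define \<rho> :: real where "\<rho> = 2 powr - \<beta>"
  have \<rho>: "0 < \<rho>" "\<rho> < 1" using \<beta> by (simp_all add: \<rho>_def powr_less_one)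
  have half: "1 / 2 \<le> \<rho>"
  proof -
    have "2 powr (- 1) \<le> \<rho>" unfolding \<rho>_def using \<beta> by (intro powr_mono) auto
    then show ?thesis by (simp add: powr_minus)
  qed
  have h: "1 / 2 ^ m \<le> \<rho> ^ m" using power_mono[OF half, of m] by (simp add: power_one_over)
  have levels: "\<bar>level_integral n \<omega> t u - level_integral m \<omega> t u\<bar> \<le> C / (1 - \<rho>) * \<rho> ^ m" for u
    using geometric_increments[of "\<lambda>n. dyadic_local_time n \<omega> t u" C \<rho> m n] succ[of _ u] \<rho> C mn
    unfolding discrete_tanaka[OF \<omega> t] by (simp add: \<rho>_def)
  have main: "\<bar>level_integral m \<omega> t v - level_integral m \<omega> t u\<bar> \<le> C * \<rho> ^ m + 6 / 2 ^ m" if "u \<le> v"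
      "v \<le> u + 1 / 2 ^ m" for u v
  proof -
    have "\<bar>level_integral m \<omega> t (dyadic_ceiling m v) - level_integral m \<omega> t (dyadic_ceiling m u)\<bar> \<le> C * \<rho> ^ m"
      using dyadic_ceiling_neighbour[OF that] near[OF dyadic_ceiling_in, of m u] C \<rho> by (auto simp: \<rho>_def)
    then show ?thesis using level_integral_ceiling[OF \<omega> t, of m u] level_integral_ceiling[OF \<omega> t, of m v]
      by linarith
  qed
  have "\<bar>level_integral m \<omega> t u - level_integral m \<omega> t v\<bar> \<le> C * \<rho> ^ m + 6 / 2 ^ m"
    using main[of u v] main[of v u] uv by (cases "u \<le> v") (auto simp: abs_minus_commute)
  moreover have "6 / 2 ^ m \<le> 6 * \<rho> ^ m" using h by simp
  moreover have "(2 * (C / (1 - \<rho>)) + C + 6) * \<rho> ^ m = 2 * (C / (1 - \<rho>) * \<rho> ^ m) + C * \<rho> ^ m + 6 * \<rho> ^ m"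
    by (simp add: distrib_right)
  ultimately show ?thesis using levels[of u] levels[of v] unfolding \<rho>_def[symmetric] by linarith
qed

lemma one_le_powr_of_ge: "1 \<le> d \<Longrightarrow> 0 \<le> \<beta> \<Longrightarrow> 1 \<le> d powr (\<beta>::real)"
  using powr_mono[of 0 \<beta> d] by simp

definition limit_local_time :: "path \<Rightarrow> real \<Rightarrow> real \<Rightarrow> real" where
  "limit_local_time \<omega> t u = lim (\<lambda>n. dyadic_local_time n \<omega> t u)"

text \<open>
  The bound for \<open>level_integral\<close> is restricted to distances of at least the mesh size, below which
  the step function \<open>I\<^sup>n\<close> jumps; it is uniform in \<open>n\<close>. In the limit the restriction disappears.
\<close>

theorem holder_estimates:
  assumes \<omega>: "\<omega> \<in> paths" and conc: "concentrated \<omega>" and T: "0 < T" and \<beta>: "0 < \<beta>" "\<beta> < 1 / 2"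
  obtains C where "0 < C"
    "\<And>t u. t \<in> {0..T} \<Longrightarrow> (\<lambda>n. dyadic_local_time n \<omega> t u) \<longlonglongrightarrow> limit_local_time \<omega> t u"
    "\<And>n t u. t \<in> {0..T} \<Longrightarrow> \<bar>dyadic_local_time n \<omega> t u - limit_local_time \<omega> t u\<bar> \<le> C * (2 powr - \<beta>) ^ n"
    "\<And>t u. t \<in> {0..T} \<Longrightarrow> \<bar>limit_local_time \<omega> t u\<bar> \<le> C"
    "\<And>n t u v. t \<in> {0..T} \<Longrightarrow> 1 / 2 ^ n \<le> \<bar>u - v\<bar> \<Longrightarrow>
       \<bar>level_integral n \<omega> t u - level_integral n \<omega> t v\<bar> \<le> C * \<bar>u - v\<bar> powr \<beta>"
    "\<And>t u v. t \<in> {0..T} \<Longrightarrow> \<bar>limit_local_time \<omega> t u - limit_local_time \<omega> t v\<bar> \<le> C * \<bar>u - v\<bar> powr \<beta>"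
proof -
  define \<rho> :: real where "\<rho> = 2 powr - \<beta>"
  have \<rho>: "0 < \<rho>" "\<rho> < 1" using \<beta> by (simp_all add: \<rho>_def powr_less_one)
  obtain C where C: "0 < C"
    "\<And>n t u. t \<in> {0..T} \<Longrightarrow> \<bar>dyadic_local_time n \<omega> t u\<bar> \<le> C"
    "\<And>n t u. t \<in> {0..T} \<Longrightarrow>
       \<bar>dyadic_local_time (Suc n) \<omega> t u - dyadic_local_time n \<omega> t u\<bar> \<le> C * (2 powr - \<beta>) ^ n"
    "\<And>n t u. t \<in> {0..T} \<Longrightarrow> u \<in> dyadic n \<Longrightarrow>
       \<bar>level_integral n \<omega> t (u + 1 / 2 ^ n) - level_integral n \<omega> t u\<bar> \<le> C * (2 powr - \<beta>) ^ n"
    using local_time_estimates[OF \<omega> conc T \<beta>] by metis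
  obtain K where K: "0 \<le> K" "\<And>s. s \<in> {0..T} \<Longrightarrow> \<bar>\<omega> s\<bar> \<le> K" using path_bounded[OF \<omega>] by blast
  define E where "E = 2 * (C / (1 - \<rho>)) + C + 6"
  have "0 \<le> C / (1 - \<rho>)" using C(1) \<rho> by simp
  then have E: "0 < E" "C \<le> E" "C / (1 - \<rho>) \<le> E" using C(1) unfolding E_def by linarith+
  define D where "D = 2 * E + 2 * (C + 2 * K) + 4 * K + 2"
  have D: "0 < D" "E \<le> D" using E K(1) C(1) by (simp_all add: D_def)
  let ?f = "\<lambda>t u. max (u - \<omega> t) 0 - max (u - \<omega> 0) 0"
  have f: "\<bar>?f t u\<bar> \<le> 2 * K" "\<bar>?f t u - ?f t v\<bar> \<le> 2 * \<bar>u - v\<bar>" if "t \<in> {0..T}" for t u v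
    using K(2)[OF that] K(2)[of 0] T by (auto simp: max_def abs_if split: if_splits)
  have lim: "(\<lambda>n. dyadic_local_time n \<omega> t u) \<longlonglongrightarrow> limit_local_time \<omega> t u"
    "\<bar>dyadic_local_time n \<omega> t u - limit_local_time \<omega> t u\<bar> \<le> C / (1 - \<rho>) * \<rho> ^ n" if "t \<in> {0..T}" for n t u
    using geometric_increments_limit[of "\<lambda>n. dyadic_local_time n \<omega> t u" C \<rho>] C(1) C(3)[OF that, of _ u] \<rho>
    unfolding limit_local_time_def \<rho>_def[symmetric] by auto
  have I: "\<bar>level_integral n \<omega> t u - level_integral n \<omega> t v\<bar> \<le> (2 * E + 2 * (C + 2 * K)) * \<bar>u - v\<bar> powr \<beta>"
    if t: "t \<in> {0..T}" and uv: "1 / 2 ^ n \<le> \<bar>u - v\<bar>" for n t u v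
  proof (cases "\<bar>u - v\<bar> \<le> 1")
    case True
    have t0: "0 \<le> t" using t by simp
    have pos: "0 < \<bar>u - v\<bar>" using uv by (rule less_le_trans[rotated]) simp
    obtain m :: nat where m: "1 / 2 ^ Suc m < \<bar>u - v\<bar>" "\<bar>u - v\<bar> \<le> 1 / 2 ^ m"
        "(2 powr - \<beta>) ^ m \<le> 2 * \<bar>u - v\<bar> powr \<beta>"
      using dyadic_scale[OF pos True \<beta>(1)] \<beta>(2) by auto
    have "1 / 2 ^ n \<le> (1 / 2 ^ m :: real)" using uv m(2) by linarith
    then have "m \<le> n" by (simp add: field_simps)
    have "\<bar>level_integral n \<omega> t u - level_integral n \<omega> t v\<bar> \<le> E * (2 powr - \<beta>) ^ m"
      using level_integral_scale[OF \<omega> t0 \<beta> C(1) C(3)[OF t] C(4)[OF t] \<open>m \<le> n\<close> m(2)] by (simp add: E_def \<rho>_def)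
    also have "\<dots> \<le> E * (2 * \<bar>u - v\<bar> powr \<beta>)" using m(3) E by (intro mult_left_mono) auto
    also have "\<dots> \<le> (2 * E + 2 * (C + 2 * K)) * \<bar>u - v\<bar> powr \<beta>" using C(1) K(1) by (simp add: distrib_right)
    finally show ?thesis .
  next
    case False
    have I_le: "\<bar>level_integral n \<omega> t u\<bar> \<le> C + 2 * K" for u
    proof -
      have "dyadic_local_time n \<omega> t u = ?f t u + level_integral n \<omega> t u" using t
        by (intro discrete_tanaka[OF \<omega>]) auto
      then show ?thesis using C(2)[OF t, of n u] f(1)[OF t, of u] by linarith
    qed
    have "\<bar>level_integral n \<omega> t u - level_integral n \<omega> t v\<bar> \<le> (C + 2 * K) + (C + 2 * K)"
      by (intro order_trans[OF abs_triangle_ineq4] add_mono I_le)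
    also have "\<dots> = (2 * (C + 2 * K)) * 1" by simp
    also have "\<dots> \<le> (2 * E + 2 * (C + 2 * K)) * \<bar>u - v\<bar> powr \<beta>"
      using one_le_powr_of_ge[of "\<bar>u - v\<bar>" \<beta>] False \<beta> E C(1) K(1) by (intro mult_mono) auto
    finally show ?thesis .
  qed
  have fh: "\<bar>?f t u - ?f t v\<bar> \<le> (4 * K + 2) * \<bar>u - v\<bar> powr \<beta>" if t: "t \<in> {0..T}" for t u v
  proof (cases "\<bar>u - v\<bar> \<le> 1")
    case True
    have "\<bar>u - v\<bar> powr 1 \<le> \<bar>u - v\<bar> powr \<beta>" using True \<beta> by (intro powr_mono') auto
    then have "\<bar>?f t u - ?f t v\<bar> \<le> 2 * \<bar>u - v\<bar> powr \<beta>" using f(2)[OF t, of u v] by simp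
    also have "\<dots> \<le> (4 * K + 2) * \<bar>u - v\<bar> powr \<beta>" using K(1) by (intro mult_right_mono) auto
    finally show ?thesis .
  next
    case False
    have "\<bar>?f t u - ?f t v\<bar> \<le> 2 * K + 2 * K"
      by (intro order_trans[OF abs_triangle_ineq4] add_mono f(1)[OF t])
    also have "\<dots> = (4 * K) * 1" by simp
    also have "\<dots> \<le> (4 * K + 2) * \<bar>u - v\<bar> powr \<beta>"
      using one_le_powr_of_ge[of "\<bar>u - v\<bar>" \<beta>] False \<beta> K(1) by (intro mult_mono) auto
    finally show ?thesis .
  qed
  show ?thesis
  proof (rule that[OF D(1)])
    fix t u :: real assume t: "t \<in> {0..T}"
    show "(\<lambda>n. dyadic_local_time n \<omega> t u) \<longlonglongrightarrow> limit_local_time \<omega> t u" by (rule lim(1)[OF t])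
    have "\<bar>limit_local_time \<omega> t u\<bar> \<le> C"
    proof (rule tendsto_upperbound)
      show "(\<lambda>n. \<bar>dyadic_local_time n \<omega> t u\<bar>) \<longlonglongrightarrow> \<bar>limit_local_time \<omega> t u\<bar>" by (intro tendsto_intros lim(1)[OF t])
    qed (use C(2)[OF t] in auto)
    then show "\<bar>limit_local_time \<omega> t u\<bar> \<le> D" using E(2) D(2) by simp
  next
    fix n and t u :: real assume t: "t \<in> {0..T}"
    have "\<bar>dyadic_local_time n \<omega> t u - limit_local_time \<omega> t u\<bar> \<le> C / (1 - \<rho>) * \<rho> ^ n" by (rule lim(2)[OF t])
    also have "\<dots> \<le> D * \<rho> ^ n" using E(3) D(2) \<rho> by (intro mult_right_mono) auto
    finally show "\<bar>dyadic_local_time n \<omega> t u - limit_local_time \<omega> t u\<bar> \<le> D * (2 powr - \<beta>) ^ n"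
      by (simp add: \<rho>_def)
  next
    fix n and t u v :: real assume t: "t \<in> {0..T}" and uv: "1 / 2 ^ n \<le> \<bar>u - v\<bar>"
    have "\<bar>level_integral n \<omega> t u - level_integral n \<omega> t v\<bar> \<le> (2 * E + 2 * (C + 2 * K)) * \<bar>u - v\<bar> powr \<beta>"
      by (rule I[OF t uv])
    also have "\<dots> \<le> D * \<bar>u - v\<bar> powr \<beta>" using K(1) by (intro mult_right_mono) (auto simp: D_def)
    finally show "\<bar>level_integral n \<omega> t u - level_integral n \<omega> t v\<bar> \<le> D * \<bar>u - v\<bar> powr \<beta>" .
  next
    fix t u v :: real assume t: "t \<in> {0..T}"
    have t0: "0 \<le> t" using t by simp
    show "\<bar>limit_local_time \<omega> t u - limit_local_time \<omega> t v\<bar> \<le> D * \<bar>u - v\<bar> powr \<beta>"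
    proof (cases "u = v")
      case False
      then have "0 < \<bar>u - v\<bar>" by simp
      then obtain N :: nat where N: "(1 / 2) ^ N < \<bar>u - v\<bar>" using real_arch_pow_inv[of "\<bar>u - v\<bar>" "1/2"] by auto
      show ?thesis
      proof (rule tendsto_upperbound)
        show "(\<lambda>n. \<bar>dyadic_local_time n \<omega> t u - dyadic_local_time n \<omega> t v\<bar>) \<longlonglongrightarrow> \<bar>limit_local_time \<omega> t u -
            limit_local_time \<omega> t v\<bar>"
          by (intro tendsto_intros lim(1)[OF t])
        show "\<forall>\<^sub>F n in sequentially. \<bar>dyadic_local_time n \<omega> t u - dyadic_local_time n \<omega> t v\<bar>
            \<le> D * \<bar>u - v\<bar> powr \<beta>"
          using eventually_ge_at_top[of N]
        proof eventually_elim
          case (elim n)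
          have "(1 / 2) ^ n \<le> (1 / 2 :: real) ^ N" using elim by (intro power_decreasing) auto
          then have "1 / 2 ^ n \<le> \<bar>u - v\<bar>" using N by (simp add: power_one_over)
          note I' = I[OF t this]
          have "dyadic_local_time n \<omega> t u - dyadic_local_time n \<omega> t v =
            (?f t u - ?f t v) + (level_integral n \<omega> t u - level_integral n \<omega> t v)"
            unfolding discrete_tanaka[OF \<omega> t0] by simp
          also have "\<bar>\<dots>\<bar> \<le> (4 * K + 2) * \<bar>u - v\<bar> powr \<beta> + (2 * E + 2 * (C + 2 * K)) * \<bar>u - v\<bar> powr \<beta>"
            by (intro order_trans[OF abs_triangle_ineq] add_mono fh[OF t] I')
          also have "\<dots> = D * \<bar>u - v\<bar> powr \<beta>" by (simp add: D_def algebra_simps)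
          finally show ?case .
        qed
      qed simp
    qed simp
  qed
qed

section \<open>Uniform bounds for the p-variation\<close>

text \<open>
  If an increasing function \<open>\<phi>\<close> controls the \<open>p\<close>-th powers of the increments, then the sums
  telescope.
\<close>

lemma p_variation_le_increasing:
  assumes p: "1 \<le> p" and step: "\<And>u v. u \<le> v \<Longrightarrow> \<bar>g v - g u\<bar> powr p \<le> \<phi> v - \<phi> u"
    and \<phi>: "\<And>u. 0 \<le> \<phi> u" "\<And>u. \<phi> u \<le> R"
  shows "p_variation p g \<le> ennreal (R powr (1 / p))"
  unfolding p_variation_def
proof (rule SUP_least, clarify)
  fix m :: nat and u :: "nat \<Rightarrow> real" assume m: "1 \<le> m" and u: "strict_mono_on {0..m} u"
  have "(\<Sum>k=1..m. \<bar>g (u k) - g (u (k - 1))\<bar> powr p) \<le> (\<Sum>k=1..m. \<phi> (u k) - \<phi> (u (k - 1)))"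
  proof (intro sum_mono step)
    fix k assume "k \<in> {1..m}"
    then show "u (k - 1) \<le> u k" by (intro less_imp_le strict_mono_onD[OF u]) auto
  qed
  also have "\<dots> = \<phi> (u m) - \<phi> (u 0)" using sum_telescope''[of 0 m "\<lambda>k. \<phi> (u k)"] by simp
  also have "\<dots> \<le> R" using \<phi>[of "u m"] \<phi>[of "u 0"] by linarith
  finally show "ennreal ((\<Sum>k=1..m. \<bar>g (u k) - g (u (k - 1))\<bar> powr p) powr (1 / p)) \<le> ennreal (R powr (1 / p))"
    using p by (intro ennreal_leI powr_mono2 sum_nonneg) auto
qed

lemma powr_sum3_le:
  fixes a b c :: real
  assumes "0 \<le> p"
  shows "\<bar>a + b + c\<bar> powr p \<le> 3 powr p * (\<bar>a\<bar> powr p + \<bar>b\<bar> powr p + \<bar>c\<bar> powr p)"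
proof -
  define M where "M = max \<bar>a\<bar> (max \<bar>b\<bar> \<bar>c\<bar>)"
  have "\<bar>a + b + c\<bar> powr p \<le> (3 * M) powr p" using assms by (intro powr_mono2) (auto simp: M_def)
  also have "\<dots> = 3 powr p * M powr p" by (rule powr_mult)
  also have "M powr p \<le> \<bar>a\<bar> powr p + \<bar>b\<bar> powr p + \<bar>c\<bar> powr p"
    unfolding M_def max_def by (auto simp: add_nonneg_nonneg)
  finally show ?thesis by simp
qed

text \<open>
  The increments of the explicit part of Tanaka's formula are dominated by those of the projection
  to \<open>[-K, K]\<close>, which is increasing and bounded.
\<close>

lemma hinge_difference_le_clipped:
  fixes a b u v K :: real
  assumes "u \<le> v" "\<bar>a\<bar> \<le> K" "\<bar>b\<bar> \<le> K"
  shows "\<bar>(max (v - a) 0 - max (v - b) 0) - (max (u - a) 0 - max (u - b) 0)\<bar>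
      \<le> max (- K) (min K v) - max (- K) (min K u)"
  using assms by (smt (verit) max_def min_def)

text \<open>
  Split the local time into the explicit part of Tanaka's formula, the first step of the walk, and
  the remaining part \<open>I\<close> of the integral. Each of them has a bounded increasing control of the
  \<open>p\<close>-th powers of its increments. For \<open>I\<close> this is the Hoelder bound with exponent \<open>1/p\<close>: since the
  walk is on the grid from its first step on, \<open>I(u)\<close> depends only on the grid point next above \<open>u\<close>,
  so only distances at or above the mesh size occur.
\<close>

theorem local_time_p_variation:
  assumes \<omega>: "\<omega> \<in> paths" and conc: "concentrated \<omega>" and T: "0 < T" and p: "2 < p"
  shows "(SUP n. sup_p_variation T p (dyadic_local_time n \<omega>)) < \<infinity>"
proof -
  define \<beta> where "\<beta> = 1 / p"
  have \<beta>: "0 < \<beta>" "\<beta> < 1 / 2" "\<beta> * p = 1" using p by (simp_all add: \<beta>_def field_simps)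
  obtain C where C: "0 < C"
    "\<And>n t u v. t \<in> {0..T} \<Longrightarrow> 1 / 2 ^ n \<le> \<bar>u - v\<bar> \<Longrightarrow>
       \<bar>level_integral n \<omega> t u - level_integral n \<omega> t v\<bar> \<le> C * \<bar>u - v\<bar> powr \<beta>"
    using holder_estimates[OF \<omega> conc T \<beta>(1,2)] by metis
  obtain K0 where K0: "0 \<le> K0" "\<And>s. s \<in> {0..T} \<Longrightarrow> \<bar>\<omega> s\<bar> \<le> K0" using path_bounded[OF \<omega>] by blast
  \<comment> \<open>One unit more than the path needs, so that projecting a height to \<open>[-K,
      K]\<close> never moves it across a value of the path.\<close>
  define K where "K = K0 + 1"
  have K: "0 < K" using K0(1) by (simp add: K_def)
  define c where "c u = max (- K) (min K u)" for u :: real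
  have c: "- K \<le> c u" "c u \<le> K" "u \<le> v \<Longrightarrow> c u \<le> c v" for u v using K by (auto simp: c_def)
  define R where "R = 3 powr p * ((2 * K) powr (p - 1) * (2 * K) + 3 powr p + (C + 3) powr p * (2 * K + 2))"
  have "p_variation p (dyadic_local_time n \<omega> t) \<le> ennreal (R powr (1 / p))" if t: "t \<in> {0..T}" for n t
  proof -
    have t0: "0 \<le> t" using t by simp
    note part = lebesgue_partition[OF \<omega>, of n]
    let ?x = "skeleton n \<omega>" and ?h = "1 / 2 ^ n :: real"
    define f where "f u = max (u - \<omega> t) 0 - max (u - \<omega> 0) 0" for u
    \<comment> \<open>The increment of the path over its first step, which may start off the grid.\<close>
    define \<Delta> where "\<Delta> = path_integral (lebesgue_time n \<omega>) (\<lambda>i. of_bool (i = 0)) \<omega> t"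
    define I where "I u = path_integral (lebesgue_time n \<omega>) (\<lambda>i. of_bool (i \<noteq> 0) * of_bool (?x i < u)) \<omega> t"
        for u
    have level: "level_integral n \<omega> t u = of_bool (\<omega> 0 < u) * \<Delta> + I u" for u
    proof -
      have "level_integral n \<omega> t u - I u = path_integral (lebesgue_time n \<omega>) (\<lambda>i. of_bool (\<omega> 0 < u) * of_bool
          (i = 0)) \<omega> t"
        unfolding level_integral_def I_def path_integral_diff[OF part t0, symmetric]
        by (intro path_integral_cong[OF part t0]) auto
      then show ?thesis unfolding \<Delta>_def path_integral_cmult[OF part t0] by simp
    qed
    have L: "dyadic_local_time n \<omega> t u = f u + of_bool (\<omega> 0 < u) * \<Delta> + I u" for u
      unfolding discrete_tanaka[OF \<omega> t0] level f_def by simp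
    obtain k where k: "lebesgue_time n \<omega> k \<le> ennreal t" "ennreal t < lebesgue_time n \<omega> (Suc k)"
      using partition_index[OF part t0] .
    have "\<bar>\<Delta>\<bar> \<le> \<bar>0 * edge_gain n 0 0 \<omega> k + 0 * edge_gain n 0 0 \<omega> k\<bar> + 3 / 2 ^ n"
      unfolding \<Delta>_def by (intro path_integral_edges[OF \<omega> t0 k]) auto
    then have \<Delta>: "\<bar>\<Delta>\<bar> \<le> 3 * ?h" by simp
    have fstep: "\<bar>f v - f u\<bar> \<le> c v - c u" if "u \<le> v" for u v
    proof -
      have "\<bar>\<omega> t\<bar> \<le> K" "\<bar>\<omega> 0\<bar> \<le> K" using K0(2)[OF t] K0(2)[of 0] T by (simp_all add: K_def)
      then show ?thesis unfolding f_def c_def by (rule hinge_difference_le_clipped[OF that])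
    qed
    have f_powr: "\<bar>f v - f u\<bar> powr p \<le> (2 * K) powr (p - 1) * (c v + K) - (2 * K) powr (p - 1) * (c u + K)"
        if "u \<le> v" for u v
    proof -
      have "\<bar>f v - f u\<bar> powr p \<le> (c v - c u) powr p" using fstep[OF that] p by (intro powr_mono2) auto
      also have "\<dots> = (c v - c u) powr (p - 1) * (c v - c u)"
        using powr_mult_base[of "c v - c u" "p - 1"] c(3)[OF that] by (simp add: mult.commute)
      also have "\<dots> \<le> (2 * K) powr (p - 1) * (c v - c u)"
      proof (rule mult_right_mono)
        have "c v - c u \<le> 2 * K" using c(1)[of u] c(2)[of v] by linarith
        then show "(c v - c u) powr (p - 1) \<le> (2 * K) powr (p - 1)" using c(3)[OF that] p
          by (intro powr_mono2) auto
      qed (use c(3)[OF that] in simp)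
      finally show ?thesis by (simp add: right_diff_distrib distrib_left)
    qed
    have \<Delta>_powr: "\<bar>of_bool (\<omega> 0 < v) * \<Delta> - of_bool (\<omega> 0 < u) * \<Delta>\<bar> powr p
        \<le> 3 powr p * of_bool (\<omega> 0 < v) - 3 powr p * of_bool (\<omega> 0 < u)"
      if "u \<le> v" for u v
    proof -
      have "?h \<le> 1" by (simp add: field_simps)
      then have "\<bar>\<Delta>\<bar> \<le> 3" using \<Delta> by linarith
      then have "\<bar>\<Delta>\<bar> powr p \<le> 3 powr p" using p by (intro powr_mono2) auto
      then show ?thesis using that by auto
    qed
    have I_ceil: "I u = I (dyadic_ceiling n (c u))" for u
      unfolding I_def
    proof (intro path_integral_cong[OF part t0])
      fix i assume i: "lebesgue_time n \<omega> i \<le> ennreal t"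
      have fin: "lebesgue_time n \<omega> i < \<infinity>" using i by (simp add: le_less_trans)
      have "\<bar>?x i\<bar> \<le> K0" by (rule skeleton_bounded[of T, OF _ i t]) (rule K0(2))
      then have *: "?x i < c u \<longleftrightarrow> ?x i < u" unfolding c_def K_def by auto
      show "of_bool (i \<noteq> 0) * of_bool (?x i < u) = (of_bool (i \<noteq> 0) * of_bool (?x i < dyadic_ceiling n (c u))
          :: real)"
        using dyadic_less_ceiling_iff[OF skeleton_in_dyadic[OF \<omega> fin], of "c u"] * by (cases "i = 0") auto
    qed
    have grid: "\<bar>I v - I u\<bar> powr p \<le> (C + 3) powr p * (v - u)" if uv: "u \<in> dyadic n" "v \<in> dyadic n" "u \<le> v"
        for u v
    proof (cases "u = v")
      case False
      have h: "?h \<le> \<bar>v - u\<bar>" using dyadic_separated[OF uv(2,1)] False by simp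
      have "?h \<le> ?h powr \<beta>" using powr_mono'[of \<beta> 1 ?h] \<beta> by (simp add: field_simps)
      also have "\<dots> \<le> \<bar>v - u\<bar> powr \<beta>" using h \<beta> by (intro powr_mono2) auto
      finally have hb: "?h \<le> \<bar>v - u\<bar> powr \<beta>" .
      have "\<bar>I v - I u\<bar> \<le> \<bar>level_integral n \<omega> t v - level_integral n \<omega> t u\<bar> + \<bar>\<Delta>\<bar>"
        unfolding level by auto
      also have "\<dots> \<le> C * \<bar>v - u\<bar> powr \<beta> + 3 * \<bar>v - u\<bar> powr \<beta>"
        using C(2)[OF t h] \<Delta> hb by linarith
      finally have "\<bar>I v - I u\<bar> \<le> (C + 3) * \<bar>v - u\<bar> powr \<beta>" by (simp add: distrib_right)
      then have "\<bar>I v - I u\<bar> powr p \<le> ((C + 3) * \<bar>v - u\<bar> powr \<beta>) powr p" using p by (intro powr_mono2) auto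
      also have "\<dots> = (C + 3) powr p * (v - u)" using C(1) \<beta> uv(3) by (simp add: powr_mult powr_powr)
      finally show ?thesis .
    qed simp
    define \<phi> where "\<phi> u = 3 powr p * ((2 * K) powr (p - 1) * (c u + K) + 3 powr p * of_bool (\<omega> 0 < u) +
      (C + 3) powr p * (dyadic_ceiling n (c u) + K))" for u
    show ?thesis
    proof (rule p_variation_le_increasing)
      show "1 \<le> p" using p by simp
      show "\<bar>dyadic_local_time n \<omega> t v - dyadic_local_time n \<omega> t u\<bar> powr p \<le> \<phi> v - \<phi> u" if uv: "u \<le> v" for u v
      proof -
        have I_powr: "\<bar>I v - I u\<bar> powr p \<le> (C + 3) powr p * (dyadic_ceiling n (c v) - dyadic_ceiling n (c u))"
          unfolding I_ceil[of u] I_ceil[of v] by (intro grid dyadic_ceiling_in dyadic_ceiling_mono c(3) uv)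
        have "dyadic_local_time n \<omega> t v - dyadic_local_time n \<omega> t u =
          (f v - f u) + (of_bool (\<omega> 0 < v) * \<Delta> - of_bool (\<omega> 0 < u) * \<Delta>) + (I v - I u)" unfolding L by simp
        then have "\<bar>dyadic_local_time n \<omega> t v - dyadic_local_time n \<omega> t u\<bar> powr p \<le>
          3 powr p * (\<bar>f v - f u\<bar> powr p + \<bar>of_bool (\<omega> 0 < v) * \<Delta> - of_bool (\<omega> 0 < u) * \<Delta>\<bar> powr p +
              \<bar>I v - I u\<bar> powr p)"
          using powr_sum3_le[of p] p by simp
        also have "\<dots> \<le> 3 powr p * (((2 * K) powr (p - 1) * (c v + K) - (2 * K) powr (p - 1) * (c u + K)) +
          (3 powr p * of_bool (\<omega> 0 < v) - 3 powr p * of_bool (\<omega> 0 < u)) +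
          (C + 3) powr p * (dyadic_ceiling n (c v) - dyadic_ceiling n (c u)))"
          by (intro mult_left_mono add_mono f_powr[OF uv] \<Delta>_powr[OF uv] I_powr) simp
        also have "\<dots> = \<phi> v - \<phi> u" by (simp add: \<phi>_def algebra_simps)
        finally show ?thesis .
      qed
      fix u
      have ceil: "0 \<le> dyadic_ceiling n (c u) + K" "dyadic_ceiling n (c u) + K \<le> 2 * K + 2"
      proof -
        have "?h \<le> 1" by (simp add: field_simps)
        then show "0 \<le> dyadic_ceiling n (c u) + K" "dyadic_ceiling n (c u) + K \<le> 2 * K + 2"
          using dyadic_ceiling_ge[of "c u" n] dyadic_ceiling_less[of n "c u"] c(1,2)[of u] by linarith+
      qed
      show "0 \<le> \<phi> u" using ceil(1) c(1)[of u] by (auto simp: \<phi>_def intro!: mult_nonneg_nonneg add_nonneg_nonneg)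
      have "(2 * K) powr (p - 1) * (c u + K) \<le> (2 * K) powr (p - 1) * (2 * K)"
        using c(2)[of u] by (intro mult_left_mono) auto
      moreover have "3 powr p * of_bool (\<omega> 0 < u) \<le> 3 powr p" by simp
      moreover have "(C + 3) powr p * (dyadic_ceiling n (c u) + K) \<le> (C + 3) powr p * (2 * K + 2)"
        using ceil(2) by (intro mult_left_mono) auto
      ultimately show "\<phi> u \<le> R" unfolding \<phi>_def R_def
        by (intro mult_left_mono[of _ _ "3 powr p"]) (linarith, simp)
    qed
  qed
  then have "(SUP n. sup_p_variation T p (dyadic_local_time n \<omega>)) \<le> ennreal (R powr (1 / p))"
    unfolding sup_p_variation_def by (intro SUP_least)
  then show ?thesis by (rule le_less_trans) simp
qed

section \<open>Convergence in the Hoelder space\<close>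

lemma stopped_value_continuous:
  assumes "\<omega> \<in> paths"
  shows "continuous_on {0..} (stopped_value \<omega> \<sigma>)"
proof (cases \<sigma>)
  case (real r)
  have eq: "stopped_value \<omega> \<sigma> t = \<omega> (min r t)" if "t \<in> {0..}" for t
    using that real by (simp add: stopped_value_def min_def)
  have \<omega>: "continuous_on {0..} \<omega>" using assms by (simp add: paths_def)
  have "continuous_on {0..} (\<lambda>t. min r t)" by (intro continuous_on_min continuous_on_const continuous_on_id)
  then have "continuous_on {0..} (\<lambda>t. \<omega> (min r t))"
    by (rule continuous_on_compose2[OF \<omega>]) (use real in auto)
  then show ?thesis by (rule continuous_on_eq) (use eq in simp)
next
  case top
  have eq: "stopped_value \<omega> \<sigma> t = \<omega> t" if "t \<in> {0..}" for t
    using that top by (simp add: stopped_value_def)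
  have "continuous_on {0..} \<omega>" using assms by (simp add: paths_def)
  then show ?thesis by (rule continuous_on_eq) (use eq in simp)
qed

text \<open>
  The number of terms is the same for all times up to \<open>T\<close> and all heights. This makes continuity in
  time and joint measurability obvious.
\<close>

lemma local_time_finite_sum:
  assumes \<omega>: "\<omega> \<in> paths" and T: "0 \<le> T"
  obtains J where "\<And>t u. t \<in> {0..T} \<Longrightarrow> dyadic_local_time n \<omega> t u = max (u - \<omega> t) 0 - max (u - \<omega> 0) 0 +
    (\<Sum>k\<le>J. of_bool (skeleton n \<omega> k < u) * (stopped_value \<omega> (lebesgue_time n \<omega> (Suc k)) t - stopped_value \<omega>
        (lebesgue_time n \<omega> k) t))"
proof -
  note part = lebesgue_partition[OF \<omega>, of n]
  obtain J where J: "ennreal T < lebesgue_time n \<omega> (Suc J)"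
    using partition_index[OF part T] by metis
  show ?thesis
  proof (rule that[of J])
    fix t u assume t: "t \<in> {0..T}"
    then have "0 \<le> t" by simp
    have "ennreal t \<le> ennreal T" using t by (intro ennreal_leI) simp
    also note J
    finally have "ennreal t \<le> lebesgue_time n \<omega> (Suc J)" by (rule less_imp_le)
    show "dyadic_local_time n \<omega> t u = max (u - \<omega> t) 0 - max (u - \<omega> 0) 0 +
      (\<Sum>k\<le>J. of_bool (skeleton n \<omega> k < u) * (stopped_value \<omega> (lebesgue_time n \<omega> (Suc k)) t - stopped_value \<omega>
          (lebesgue_time n \<omega> k) t))"
      unfolding discrete_tanaka[OF \<omega> \<open>0 \<le> t\<close>] level_integral_def path_integral_finite_sum[OF part \<open>0
          \<le> t\<close> \<open>ennreal t \<le> lebesgue_time n \<omega> (Suc J)\<close>] ..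
  qed
qed

lemma local_time_continuous_in_time:
  assumes \<omega>: "\<omega> \<in> paths" and T: "0 \<le> T" and t: "t \<in> {0..T}" and \<eta>: "0 < \<eta>"
  shows "\<forall>\<^sub>F s in at t within {0..T}. \<forall>u. \<bar>dyadic_local_time n \<omega> s u - dyadic_local_time n \<omega> t u\<bar> \<le> \<eta>"
proof -
  obtain J where J: "\<And>t u. t \<in> {0..T} \<Longrightarrow> dyadic_local_time n \<omega> t u = max (u - \<omega> t) 0 - max (u - \<omega> 0) 0 +
    (\<Sum>k\<le>J. of_bool (skeleton n \<omega> k < u) * (stopped_value \<omega> (lebesgue_time n \<omega> (Suc k)) t - stopped_value \<omega>
        (lebesgue_time n \<omega> k) t))"
    using local_time_finite_sum[OF \<omega> T] by blast
  let ?S = "\<lambda>k. stopped_value \<omega> (lebesgue_time n \<omega> k)"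
  have regroup: "(a - m + x) - (b - m + y) = (a - b) + (x - y)" for a b m x y :: real by simp
  define D where "D s = \<bar>\<omega> s - \<omega> t\<bar> + (\<Sum>k\<le>J. \<bar>?S (Suc k) s - ?S (Suc k) t\<bar> + \<bar>?S k s - ?S k t\<bar>)" for s
  have "continuous_on {0..T} D"
    unfolding D_def
    by (intro continuous_intros paths_continuous[OF \<omega>] continuous_on_subset[OF stopped_value_continuous[OF
        \<omega>]]) auto
  then have "(D \<longlongrightarrow> D t) (at t within {0..T})" using t by (simp add: continuous_on_def)
  then have "(D \<longlongrightarrow> 0) (at t within {0..T})" by (simp add: D_def)
  then have "\<forall>\<^sub>F s in at t within {0..T}. D s < \<eta>" using \<eta> by (rule order_tendstoD)
  moreover have "\<forall>\<^sub>F s in at t within {0..T}. s \<in> {0..T}" by (simp add: eventually_at_filter)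
  ultimately show ?thesis
  proof eventually_elim
    case (elim s)
    have bound: "\<bar>dyadic_local_time n \<omega> s u - dyadic_local_time n \<omega> t u\<bar> \<le> D s" for u
    proof -
      let ?b = "\<lambda>k. of_bool (skeleton n \<omega> k < u) :: real"
      have eq: "dyadic_local_time n \<omega> s u - dyadic_local_time n \<omega> t u = (max (u - \<omega> s) 0 - max (u - \<omega> t) 0) +
        (\<Sum>k\<le>J. ?b k * (?S (Suc k) s - ?S k s) - ?b k * (?S (Suc k) t - ?S k t))"
        unfolding J[OF elim(2)] J[OF t] sum_subtractf by (rule regroup)
      show ?thesis
        unfolding eq D_def
      proof (intro order_trans[OF abs_triangle_ineq] add_mono)
        show "\<bar>max (u - \<omega> s) 0 - max (u - \<omega> t) 0\<bar> \<le> \<bar>\<omega> s - \<omega> t\<bar>" by (auto simp: max_def)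
        show "\<bar>\<Sum>k\<le>J. ?b k * (?S (Suc k) s - ?S k s) - ?b k * (?S (Suc k) t - ?S k t)\<bar> \<le>
          (\<Sum>k\<le>J. \<bar>?S (Suc k) s - ?S (Suc k) t\<bar> + \<bar>?S k s - ?S k t\<bar>)"
          by (intro order_trans[OF sum_abs] sum_mono) auto
      qed
    qed
    show ?case
    proof
      fix u show "\<bar>dyadic_local_time n \<omega> s u - dyadic_local_time n \<omega> t u\<bar> \<le> \<eta>"
        by (rule order_trans[OF bound less_imp_le[OF elim(1)]])
    qed
  qed
qed

text \<open>
  The essential supremum of a function that is not measurable is infinite by definition, so the norm
  estimate needs this.
\<close>

lemma local_time_measurable:
  assumes \<omega>: "\<omega> \<in> paths" and T: "0 \<le> T"
  shows "(\<lambda>(t, u). dyadic_local_time n \<omega> t u) \<in> borel_measurable (restrict_space borel ({0..T} \<times> UNIV))"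
proof -
  obtain J where J: "\<And>t u. t \<in> {0..T} \<Longrightarrow> dyadic_local_time n \<omega> t u = max (u - \<omega> t) 0 - max (u - \<omega> 0) 0 +
    (\<Sum>k\<le>J. of_bool (skeleton n \<omega> k < u) * (stopped_value \<omega> (lebesgue_time n \<omega> (Suc k)) t - stopped_value \<omega>
        (lebesgue_time n \<omega> k) t))"
    using local_time_finite_sum[OF \<omega> T] by blast
  let ?M = "restrict_space borel ({0..T} \<times> (UNIV :: real set))"
  have fst: "(\<lambda>x. g (fst x)) \<in> borel_measurable ?M" if "continuous_on {0..} g" for g :: "real \<Rightarrow> real"
    by (intro borel_measurable_continuous_on_restrict, rule continuous_on_compose2[OF that])
       (auto intro: continuous_intros)
  have [measurable]: "snd \<in> borel_measurable ?M"
    by (intro borel_measurable_continuous_on_restrict continuous_intros)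
  have [measurable]: "(\<lambda>x. \<omega> (fst x)) \<in> borel_measurable ?M" using \<omega> by (intro fst) (simp add: paths_def)
  have [measurable]: "(\<lambda>x. stopped_value \<omega> (lebesgue_time n \<omega> k) (fst x)) \<in> borel_measurable ?M" for k
    by (intro fst stopped_value_continuous \<omega>)
  have "(\<lambda>x. max (snd x - \<omega> (fst x)) 0 - max (snd x - \<omega> 0) 0 +
    (\<Sum>k\<le>J. of_bool (skeleton n \<omega> k < snd x) * (stopped_value \<omega> (lebesgue_time n \<omega> (Suc k)) (fst x) -
        stopped_value \<omega> (lebesgue_time n \<omega> k) (fst x))))
    \<in> borel_measurable ?M" by measurable
  then show ?thesis
    by (rule measurable_cong[THEN iffD2, rotated]) (auto simp: space_restrict_space J)
qed

lemma holder_norm_le: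
  assumes "\<And>u. \<bar>f u\<bar> \<le> a" "\<And>u v. \<bar>f u - f v\<bar> \<le> b * \<bar>u - v\<bar> powr \<alpha>" "0 \<le> a" "0 \<le> b"
  shows "holder_norm \<alpha> f \<le> ennreal (a + b)"
proof -
  have "(SUP u. ennreal \<bar>f u\<bar>) \<le> ennreal a" using assms(1) by (intro SUP_least ennreal_leI)
  moreover have "(SUP u. SUP v\<in>-{u}. ennreal (\<bar>f u - f v\<bar> / \<bar>u - v\<bar> powr \<alpha>)) \<le> ennreal b"
    using assms(2) by (intro SUP_least ennreal_leI) (auto simp: pos_divide_le_eq)
  ultimately show ?thesis unfolding holder_norm_def using assms(3,4) by (simp add: add_mono)
qed

text \<open>
  An increment \<open>y\<close> is bounded by \<open>2x\<close> and by \<open>C d\<^sup>\<beta>\<close>, hence by the product of these bounds to the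
  powers \<open>1 - \<theta>\<close> and \<open>\<theta>\<close>, with \<open>\<theta> = \<alpha>/\<beta>\<close>.
\<close>

lemma holder_interpolation:
  fixes \<alpha> \<beta> x C :: real
  assumes \<alpha>: "0 < \<alpha>" "\<alpha> < \<beta>" and x: "\<And>u. \<bar>f u\<bar> \<le> x" "0 < x" and C: "\<And>u v. \<bar>f u - f v\<bar> \<le> C * \<bar>u - v\<bar> powr \<beta>"
      "0 < C"
  shows "\<bar>f u - f v\<bar> \<le> (C powr (\<alpha> / \<beta>) * (2 * x) powr (1 - \<alpha> / \<beta>)) * \<bar>u - v\<bar> powr \<alpha>"
proof -
  define y where "y = \<bar>f u - f v\<bar>"
  define \<theta> where "\<theta> = \<alpha> / \<beta>"
  have \<theta>: "0 < \<theta>" "\<theta> < 1" "\<beta> * \<theta> = \<alpha>" using \<alpha> by (simp_all add: \<theta>_def)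
  have y: "0 \<le> y" "y \<le> 2 * x" "y \<le> C * \<bar>u - v\<bar> powr \<beta>" using x(1)[of u] x(1)[of v] C(1)[of u v]
    by (auto simp: y_def)
  have "y = y powr \<theta> * y powr (1 - \<theta>)" using y(1) by (simp flip: powr_add)
  also have "\<dots> \<le> (C * \<bar>u - v\<bar> powr \<beta>) powr \<theta> * (2 * x) powr (1 - \<theta>)"
    using y \<theta> by (intro mult_mono powr_mono2) auto
  also have "\<dots> = C powr \<theta> * (2 * x) powr (1 - \<theta>) * \<bar>u - v\<bar> powr \<alpha>"
    using C(2) \<theta>(3) by (simp add: powr_mult powr_powr)
  finally show ?thesis by (simp add: y_def \<theta>_def)
qed

lemma linfty_norm_le:
  assumes "(\<lambda>(t, u). f t u) \<in> borel_measurable (restrict_space borel ({0..T} \<times> UNIV))"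
    and "\<And>t u. t \<in> {0..T} \<Longrightarrow> \<bar>f t u\<bar> \<le> c"
  shows "linfty_norm T f \<le> ennreal c"
proof -
  let ?M = "restrict_space lborel ({0..T} \<times> (UNIV :: real set))"
  have "sets ?M = sets (restrict_space borel ({0..T} \<times> (UNIV :: real set)))"
    by (rule sets_restrict_space_cong) simp
  then have [measurable]: "(\<lambda>(t, u). f t u) \<in> borel_measurable ?M"
    using assms(1) by (simp cong: measurable_cong_sets)
  have "(\<lambda>(t, u). ennreal \<bar>f t u\<bar>) = (\<lambda>x. ennreal \<bar>(\<lambda>(t, u). f t u) x\<bar>)" by auto
  also have "\<dots> \<in> borel_measurable ?M" by measurable
  finally have meas: "(\<lambda>(t, u). ennreal \<bar>f t u\<bar>) \<in> borel_measurable ?M" .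
  show ?thesis
    unfolding linfty_norm_def esssup_eq_AE[OF meas]
    using assms(2) by (intro Inf_lower CollectI AE_I2) (auto simp: space_restrict_space intro: ennreal_leI)
qed

text \<open>
  Work with some \<open>\<beta>\<close> between \<open>\<alpha>\<close> and \<open>1/2\<close>. The rate for \<open>\<beta>\<close> beats the one that is claimed, and the
  margin between the exponents provides the continuity in time with respect to the Hoelder norm.
\<close>

theorem local_time_convergence:
  assumes \<omega>: "\<omega> \<in> paths" and conc: "concentrated \<omega>" and T: "0 < T" and \<alpha>: "0 < \<alpha>" "\<alpha> < 1 / 2"
  shows "\<exists>L \<in> continuous_holder_space T \<alpha>.
           uniform_limit ({0..T} \<times> UNIV)
             (\<lambda>n (t, u). dyadic_local_time n \<omega> t u) (\<lambda>(t, u). L t u) sequentially \<and>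
           (\<exists>C::real>0. (SUP n. ennreal (2 powr (real n * \<alpha>)) *
               linfty_norm T (\<lambda>t u. dyadic_local_time n \<omega> t u - L t u)) \<le> ennreal C)"
proof -
  let ?L = "limit_local_time \<omega>"
  obtain \<beta> where \<beta>: "\<alpha> < \<beta>" "\<beta> < 1 / 2" using dense[OF \<alpha>(2)] by blast
  have \<beta>0: "0 < \<beta>" using \<alpha> \<beta> by simp
  define \<rho> :: real where "\<rho> = 2 powr - \<beta>"
  have \<rho>: "0 < \<rho>" "\<rho> < 1" using \<beta>0 by (simp_all add: \<rho>_def powr_less_one)
  obtain C where C: "0 < C"
    "\<And>t u. t \<in> {0..T} \<Longrightarrow> (\<lambda>n. dyadic_local_time n \<omega> t u) \<longlonglongrightarrow> ?L t u"
    "\<And>n t u. t \<in> {0..T} \<Longrightarrow> \<bar>dyadic_local_time n \<omega> t u - ?L t u\<bar> \<le> C * (2 powr - \<beta>) ^ n"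
    "\<And>t u. t \<in> {0..T} \<Longrightarrow> \<bar>?L t u\<bar> \<le> C"
    "\<And>t u v. t \<in> {0..T} \<Longrightarrow> \<bar>?L t u - ?L t v\<bar> \<le> C * \<bar>u - v\<bar> powr \<beta>"
    using holder_estimates[OF \<omega> conc T \<beta>0 \<beta>(2)] by metis
  note rate = C(3)[folded \<rho>_def]
  have small: "\<exists>N. C * \<rho> ^ N < e" if e: "0 < e" for e
  proof -
    obtain N where "\<rho> ^ N < e / C" using real_arch_pow_inv[of "e / C" \<rho>] e C(1) \<rho> by auto
    then show ?thesis using C(1) by (intro exI[of _ N]) (simp add: field_simps)
  qed
  have bounded: "?L t \<in> holder_space \<alpha>" if t: "t \<in> {0..T}" for t
  proof -
    have "holder_norm \<alpha> (?L t) \<le> ennreal (C + C powr (\<alpha> / \<beta>) * (2 * C) powr (1 - \<alpha> / \<beta>))"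
      using holder_interpolation[OF \<alpha>(1) \<beta>(1) C(4)[OF t] C(1) C(5)[OF t] C(1)] C(1) C(4)[OF t]
      by (intro holder_norm_le) auto
    then show ?thesis by (auto simp: holder_space_def intro: le_less_trans)
  qed
  have time_continuous: "\<forall>\<^sub>F s in at t within {0..T}. \<forall>u. \<bar>?L s u - ?L t u\<bar> \<le> \<eta>" if t: "t \<in> {0..T}"
      and \<eta>: "0 < \<eta>" for t \<eta>
  proof -
    obtain N where N: "C * \<rho> ^ N < \<eta> / 3" using small[of "\<eta> / 3"] \<eta> by auto
    have "\<forall>\<^sub>F s in at t within {0..T}. \<forall>u. \<bar>dyadic_local_time N \<omega> s u - dyadic_local_time N \<omega> t u\<bar> \<le> \<eta> / 3"
      using T t \<eta> by (intro local_time_continuous_in_time[OF \<omega>]) auto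
    moreover have "\<forall>\<^sub>F s in at t within {0..T}. s \<in> {0..T}" by (simp add: eventually_at_filter)
    ultimately show ?thesis
    proof eventually_elim
      case (elim s)
      show ?case
      proof
        fix u show "\<bar>?L s u - ?L t u\<bar> \<le> \<eta>"
          using spec[OF elim(1), of u] rate[OF elim(2), of N u] rate[OF t, of N u] N by linarith
      qed
    qed
  qed
  have "((\<lambda>s. holder_norm \<alpha> (\<lambda>u. ?L s u - ?L t u)) \<longlongrightarrow> 0) (at t within {0..T})" if t: "t \<in> {0..T}" for t
  proof (rule order_tendstoI)
    fix a :: ennreal assume "0 < a"
    then obtain e where e: "0 < e" "ennreal e \<le> a" by (cases a) (auto intro: that[of 1])
    let ?g = "\<lambda>x. x + (2 * C) powr (\<alpha> / \<beta>) * (2 * x) powr (1 - \<alpha> / \<beta>)"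
    have "(?g \<longlongrightarrow> 0 + (2 * C) powr (\<alpha> / \<beta>) * (2 * 0) powr (1 - \<alpha> / \<beta>)) (at_right 0)"
      using \<alpha> \<beta> by (intro tendsto_intros tendsto_powr') (auto simp: eventually_at_filter)
    then have "\<forall>\<^sub>F x in at_right 0. ?g x < e" using e(1) by (intro order_tendstoD(2)[of _ 0]) auto
    moreover have "\<forall>\<^sub>F x in at_right 0. (0::real) < x" by (simp add: eventually_at_filter)
    ultimately obtain x where x: "?g x < e" "0 < x"
      using eventually_happens'[OF trivial_limit_at_right_real] eventually_conj by (metis (no_types, lifting))
    have "\<forall>\<^sub>F s in at t within {0..T}. s \<in> {0..T}" by (simp add: eventually_at_filter)
    with time_continuous[OF t x(2)] show "\<forall>\<^sub>F s in at t within {0..T}. holder_norm \<alpha> (\<lambda>u. ?L s u - ?L t u) < a"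
    proof eventually_elim
      case (elim s)
      have "\<bar>(?L s u - ?L t u) - (?L s v - ?L t v)\<bar> \<le> (2 * C) * \<bar>u - v\<bar> powr \<beta>" for u v
        using C(5)[OF elim(2), of u v] C(5)[OF t, of u v] by linarith
      then have "holder_norm \<alpha> (\<lambda>u. ?L s u - ?L t u) \<le> ennreal (?g x)"
        using elim(1) x(2) C(1) by (intro holder_norm_le holder_interpolation[OF \<alpha>(1) \<beta>(1)]) auto
      also have "\<dots> < ennreal e" using x e by (intro ennreal_lessI) auto
      finally show ?case using e(2) by simp
    qed
  qed simp
  then have space: "?L \<in> continuous_holder_space T \<alpha>" using bounded by (simp add: continuous_holder_space_def)
  have unif: "uniform_limit ({0..T} \<times> UNIV) (\<lambda>n (t, u). dyadic_local_time n \<omega> t u) (\<lambda>(t,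
      u). ?L t u) sequentially"
  proof (rule uniform_limitI)
    fix e :: real assume "0 < e"
    then obtain N where N: "C * \<rho> ^ N < e" using small by blast
    have "dist (dyadic_local_time n \<omega> t u) (?L t u) < e" if "N \<le> n" "t \<in> {0..T}" for n t u
    proof -
      have "C * \<rho> ^ n \<le> C * \<rho> ^ N" using \<rho> C(1) that by (intro mult_left_mono power_decreasing) auto
      then show ?thesis using rate[OF that(2), of n u] N by (simp add: dist_real_def)
    qed
    then show "\<forall>\<^sub>F n in sequentially. \<forall>x\<in>{0..T} \<times> UNIV. dist ((\<lambda>(t, u). dyadic_local_time n \<omega> t u) x) ((\<lambda>(t,
        u). ?L t u) x) < e"
      by (auto simp: eventually_sequentially intro!: exI[of _ N])
  qed
  let ?M = "restrict_space borel ({0..T} \<times> (UNIV :: real set))"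
  have Lmeas: "(\<lambda>(t, u). ?L t u) \<in> borel_measurable ?M"
  proof (rule borel_measurable_LIMSEQ_real)
    show "(\<lambda>(t, u). dyadic_local_time n \<omega> t u) \<in> borel_measurable ?M" for n
      using T by (intro local_time_measurable[OF \<omega>]) simp
    show "(\<lambda>n. (\<lambda>(t, u). dyadic_local_time n \<omega> t u) x) \<longlonglongrightarrow> (\<lambda>(t, u). ?L t u) x" if "x \<in> space ?M" for x
      using that C(2) by (auto simp: space_restrict_space)
  qed
  have "ennreal (2 powr (real n * \<alpha>)) * linfty_norm T (\<lambda>t u. dyadic_local_time n \<omega> t u - ?L t u) \<le> ennreal C"
      for n
  proof -
    have "(\<lambda>x. (\<lambda>(t, u). dyadic_local_time n \<omega> t u) x - (\<lambda>(t, u). ?L t u) x) \<in> borel_measurable ?M"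
      using T by (intro borel_measurable_diff local_time_measurable[OF \<omega>] Lmeas) simp
    then have "(\<lambda>(t, u). dyadic_local_time n \<omega> t u - ?L t u) \<in> borel_measurable ?M"
      by (simp add: case_prod_beta)
    then have "linfty_norm T (\<lambda>t u. dyadic_local_time n \<omega> t u - ?L t u) \<le> ennreal (C * \<rho> ^ n)"
      by (rule linfty_norm_le) (rule rate)
    then have "ennreal (2 powr (real n * \<alpha>)) * linfty_norm T (\<lambda>t u. dyadic_local_time n \<omega> t u - ?L t u) \<le>
       ennreal (2 powr (real n * \<alpha>)) * ennreal (C * \<rho> ^ n)" by (rule mult_left_mono) simp
    also have "\<dots> = ennreal (2 powr (real n * \<alpha>) * (C * \<rho> ^ n))" using C(1) \<rho> by (simp add: ennreal_mult)
    also have "\<dots> \<le> ennreal C"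
    proof (rule ennreal_leI)
      have "\<rho> ^ n = 2 powr (- \<beta> * real n)" unfolding \<rho>_def by (simp add: powr_powr flip: powr_realpow)
      then have "2 powr (real n * \<alpha>) * \<rho> ^ n = 2 powr (real n * (\<alpha> - \<beta>))"
        by (simp add: algebra_simps flip: powr_add)
      also have "\<dots> \<le> 2 powr 0" using \<beta> by (intro powr_mono) (auto simp: mult_nonneg_nonpos)
      finally have "C * (2 powr (real n * \<alpha>) * \<rho> ^ n) \<le> C * 1" using C(1) by (intro mult_left_mono) auto
      then show "2 powr (real n * \<alpha>) * (C * \<rho> ^ n) \<le> C" by (simp add: algebra_simps)
    qed
    finally show ?thesis .
  qed
  then have "(SUP n. ennreal (2 powr (real n * \<alpha>)) * linfty_norm T (\<lambda>t u. dyadic_local_time n \<omega> t u - ?L t u))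
      \<le> ennreal C"
    by (intro SUP_least)
  then show ?thesis using space unif C(1) by blast
qed

lemma typical_mono:
  assumes "typical P" "\<And>\<omega>. \<omega> \<in> paths \<Longrightarrow> P \<omega> \<Longrightarrow> Q \<omega>"
  shows "typical Q"
  using assms unfolding typical_def by (elim outer_price_zero_mono[rotated]) auto

theorem theorem3p5:
  fixes T \<alpha> :: real
  assumes "T > 0" and "0 < \<alpha>" and "\<alpha> < 1 / 2"
  shows "typical (\<lambda>\<omega>. \<exists>L \<in> continuous_holder_space T \<alpha>.
           uniform_limit ({0..T} \<times> UNIV)
             (\<lambda>n (t, u). dyadic_local_time n \<omega> t u) (\<lambda>(t, u). L t u) sequentially \<and>
           (\<exists>C::real>0. (SUP n. ennreal (2 powr (real n * \<alpha>)) *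
               linfty_norm T (\<lambda>t u. dyadic_local_time n \<omega> t u - L t u)) \<le> ennreal C)) \<and>
         (\<forall>p::real>2. typical (\<lambda>\<omega>.
           (SUP n. sup_p_variation T p (dyadic_local_time n \<omega>)) < \<infinity>))"
proof (intro conjI allI impI)
  show "typical (\<lambda>\<omega>. \<exists>L \<in> continuous_holder_space T \<alpha>.
           uniform_limit ({0..T} \<times> UNIV)
             (\<lambda>n (t, u). dyadic_local_time n \<omega> t u) (\<lambda>(t, u). L t u) sequentially \<and>
           (\<exists>C::real>0. (SUP n. ennreal (2 powr (real n * \<alpha>)) *
               linfty_norm T (\<lambda>t u. dyadic_local_time n \<omega> t u - L t u)) \<le> ennreal C))"
    by (rule typical_mono[OF typical_concentrated local_time_convergence[OF _ _ assms]])
  fix p :: real assume "2 < p"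
  show "typical (\<lambda>\<omega>. (SUP n. sup_p_variation T p (dyadic_local_time n \<omega>)) < \<infinity>)"
    by (rule typical_mono[OF typical_concentrated local_time_p_variation[OF _ _ assms(1) \<open>2 < p\<close>]])
qed

end
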